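(* Let $\boldsymbol{k}$ be a field of characteristic zero, let $k\ge 1$ and $r\ge 0$ be integers, and set $m=2k+r+1$. Let $\mathcal A$ be an arrangement of $m$ distinct lines in $\mathbb P^2=\mathbb P^2_{\boldsymbol{k}}$ having a point of multiplicity $h$ with $k\le h\le k+r+1$. Then $\mathcal A$ is free with exponents $(k,k+r)$ if and only if $c_2(\mathcal T_{\mathbb P^2}(-\log D_{\mathcal A}))=k(k+r)$.
   Context: For a line arrangement $\mathcal A=(H_1,\dots,H_m)$ (distinct lines of $\mathbb P^2$ defined over $\boldsymbol{k}$), $D_{\mathcal A}=H_1\cup\dots\cup H_m$; let $f$ be the product of linear forms defining the $H_i$. The sheaf of logarithmic vector fields is $$\mathcal T_{\mathbb P^2}(-\log D_{\mathcal A})=\ker\Bigl((\partial_0 f,\partial_1 f,\partial_2 f):\mathcal O_{\mathbb P^2}^{3}\to\mathcal O_{\mathbb P^2}(m-1)\Bigr),$$ where $\partial_i=\partial/\partial x_i$ for homogeneous coordinates $x_0,x_1,x_2$. It is a rank-2 vector bundle on $\mathbb P^2$. The arrangement $\mathcal A$ is free with exponents $(a,b)$ if $\mathcal T_{\mathbb P^2}(-\log D_{\mathcal A})\simeq\mathcal O_{\mathbb P^2}(-a)\oplus\mathcal O_{\mathbb P^2}(-b)$. A point has multiplicity $h$ if it lies on exactly $h$ lines of $\mathcal A$. Chern classes on $\mathbb P^2$ are written as integers. *)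

theory Defs
  imports
    "HOL-Library.Poly_Mapping"
    "HOL-Library.Numeral_Type"
    "HOL-Computational_Algebra.Polynomial"
    "HOL-Computational_Algebra.Fraction_Field"
begin

text \<open>
  The homogeneous coordinate ring of the projective plane is \<open>k[x_0,x_1,x_2]\<close>, with the three
  variables indexed by the type \<open>3\<close>. A polynomial is a finitely supported map from exponent
  vectors to coefficients.
\<close>

type_synonym 'a hpoly = "(3 \<Rightarrow>\<^sub>0 nat) \<Rightarrow>\<^sub>0 'a"

definition mon_degree :: "(3 \<Rightarrow>\<^sub>0 nat) \<Rightarrow> nat" where
  "mon_degree m = (\<Sum>i\<in>UNIV. Poly_Mapping.lookup m i)"

text \<open>The zero polynomial is homogeneous of every degree.\<close>

definition homogeneous :: "nat \<Rightarrow> 'a::zero hpoly \<Rightarrow> bool" where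
  "homogeneous d p \<longleftrightarrow> (\<forall>m\<in>Poly_Mapping.keys p. mon_degree m = d)"

definition hcomponent :: "nat \<Rightarrow> 'a::comm_monoid_add hpoly \<Rightarrow> 'a hpoly" where
  "hcomponent d p = (\<Sum>m\<in>{m\<in>Poly_Mapping.keys p. mon_degree m = d}. Poly_Mapping.single m (Poly_Mapping.lookup p m))"

definition hvar :: "3 \<Rightarrow> 'a::zero_neq_one hpoly" where
  "hvar i = Poly_Mapping.single (Poly_Mapping.single i 1) 1"

definition partial :: "3 \<Rightarrow> 'a::comm_semiring_1 hpoly \<Rightarrow> 'a hpoly" where
  "partial i p =
     (\<Sum>m\<in>Poly_Mapping.keys p. Poly_Mapping.single (m - Poly_Mapping.single i 1) (of_nat (Poly_Mapping.lookup m i) * Poly_Mapping.lookup p m))"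


section \<open>The projective plane and sheaves on it\<close>

text \<open>
  The plane is \<open>Proj k[x_0,x_1,x_2]\<close>: its points are the homogeneous prime ideals that do not
  contain the irrelevant ideal.
\<close>

type_synonym 'a pt = "'a hpoly set"

definition proj_plane :: "'a::field pt set" where
  "proj_plane = {P.
     0 \<in> P \<and> (\<forall>p\<in>P. \<forall>q\<in>P. p + q \<in> P) \<and> (\<forall>p\<in>P. \<forall>q. q * p \<in> P) \<and>
     1 \<notin> P \<and> (\<forall>p q. p * q \<in> P \<longrightarrow> p \<in> P \<or> q \<in> P) \<and>
     (\<forall>p\<in>P. \<forall>d. hcomponent d p \<in> P) \<and>
     \<not> (\<forall>i. hvar i \<in> P)}"

definition zero_locus :: "'a::field hpoly set \<Rightarrow> 'a pt set" where
  "zero_locus J = {P \<in> proj_plane. J \<subseteq> P}"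

definition zopen :: "'a::field pt set \<Rightarrow> bool" where
  "zopen U \<longleftrightarrow> (\<exists>J. U = proj_plane - zero_locus J)"

text \<open>
  The plane is integral with homogeneous function field \<open>K = k(x_0,x_1,x_2)\<close>. All sheaves below
  are torsion free and are realised inside constant sheaves \<open>K^n\<close> so that the restriction maps
  are inclusions. Only nonempty open sets are considered; the sections over the empty set are
  zero for every sheaf and carry no information.
\<close>

type_synonym 'a ratfun = "'a hpoly fract"
type_synonym ('a, 'i) psheaf = "'a pt set \<Rightarrow> ('i \<Rightarrow> 'a ratfun) set"

text \<open>
  Sections of the line bundle \<open>O(n)\<close>: homogeneous fractions of degree \<open>n\<close> that are regular at
  every point of \<open>U\<close>, i.e. the intersection of the stalks \<open>O(n)_P\<close>. For \<open>n = 0\<close> this is the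
  structure sheaf.
\<close>

definition twist :: "int \<Rightarrow> 'a::field pt set \<Rightarrow> 'a ratfun set" where
  "twist n U = {z. \<forall>P\<in>U. \<exists>d e g h.
     homogeneous d g \<and> homogeneous e h \<and> int d = int e + n \<and> h \<notin> P \<and> z = Fract g h}"

text \<open>The direct sum of the line bundles \<open>O(n)\<close> for the entries \<open>n\<close> of the list.\<close>

definition line_sum :: "int list \<Rightarrow> ('a::field, nat) psheaf" where
  "line_sum ns U =
     {s. (\<forall>i<length ns. s i \<in> twist (ns ! i) U) \<and> (\<forall>i\<ge>length ns. s i = 0)}"

text \<open>Morphisms of sheaves of modules over the structure sheaf.\<close>

definition sheaf_hom ::
  "('a::field, 'i) psheaf \<Rightarrow> ('a, 'j) psheaf \<Rightarrow>
   ('a pt set \<Rightarrow> ('i \<Rightarrow> 'a ratfun) \<Rightarrow> ('j \<Rightarrow> 'a ratfun)) \<Rightarrow> bool" where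
  "sheaf_hom F G \<phi> \<longleftrightarrow> (\<forall>U. zopen U \<and> U \<noteq> {} \<longrightarrow>
     (\<forall>s\<in>F U. \<phi> U s \<in> G U) \<and>
     (\<forall>s\<in>F U. \<forall>t\<in>F U. \<phi> U (\<lambda>i. s i + t i) = (\<lambda>j. \<phi> U s j + \<phi> U t j)) \<and>
     (\<forall>c\<in>twist 0 U. \<forall>s\<in>F U. \<phi> U (\<lambda>i. c * s i) = (\<lambda>j. c * \<phi> U s j)) \<and>
     (\<forall>V. zopen V \<and> V \<noteq> {} \<and> V \<subseteq> U \<longrightarrow> (\<forall>s\<in>F U. \<phi> V s = \<phi> U s)))"

definition sheaf_isomorphic :: "('a::field, 'i) psheaf \<Rightarrow> ('a, 'j) psheaf \<Rightarrow> bool" where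
  "sheaf_isomorphic F G \<longleftrightarrow>
     (\<exists>\<phi>. sheaf_hom F G \<phi> \<and> (\<forall>U. zopen U \<and> U \<noteq> {} \<longrightarrow> bij_betw (\<phi> U) (F U) (G U)))"

text \<open>
  Exactness of \<open>0 \<rightarrow> F \<rightarrow> G \<rightarrow> H \<rightarrow> 0\<close> as a sequence of sheaves: exactness on sections at \<open>F\<close>
  and \<open>G\<close> (equivalent to exactness as sheaves there), and local surjectivity onto \<open>H\<close>.
\<close>

definition short_exact ::
  "('a::field, 'i) psheaf \<Rightarrow> ('a, 'j) psheaf \<Rightarrow> ('a, 'l) psheaf \<Rightarrow>
   ('a pt set \<Rightarrow> ('i \<Rightarrow> 'a ratfun) \<Rightarrow> ('j \<Rightarrow> 'a ratfun)) \<Rightarrow>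
   ('a pt set \<Rightarrow> ('j \<Rightarrow> 'a ratfun) \<Rightarrow> ('l \<Rightarrow> 'a ratfun)) \<Rightarrow> bool" where
  "short_exact F G H \<phi> \<psi> \<longleftrightarrow>
     sheaf_hom F G \<phi> \<and> sheaf_hom G H \<psi> \<and>
     (\<forall>U. zopen U \<and> U \<noteq> {} \<longrightarrow>
        inj_on (\<phi> U) (F U) \<and>
        \<phi> U ` F U = {s \<in> G U. \<psi> U s = (\<lambda>_. 0)} \<and>
        (\<forall>t\<in>H U. \<forall>P\<in>U. \<exists>V. zopen V \<and> P \<in> V \<and> V \<subseteq> U \<and> (\<exists>s\<in>G V. \<psi> V s = t)))"


section \<open>Chern classes\<close>

text \<open>
  Chern classes live in \<open>Z[t]/(t^3)\<close>, with \<open>t\<close> the class of a line. The total Chern class is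
  multiplicative on short exact sequences and \<open>O(n)\<close> has total Chern class \<open>1 + n t\<close>. Every
  vector bundle on the plane has a resolution by direct sums of line bundles of length one
  (Hilbert's syzygy theorem; its module of twisted global sections has depth at least two), so
  that its Chern classes are determined as the quotient of two products. They are independent
  of the chosen resolution.
\<close>

definition total_chern :: "int list \<Rightarrow> int poly" where
  "total_chern ns = (\<Prod>n\<leftarrow>ns. [:1, n:])"

definition has_chern_classes :: "('a::field, 'i) psheaf \<Rightarrow> int \<Rightarrow> int \<Rightarrow> bool" where
  "has_chern_classes E c1 c2 \<longleftrightarrow>
     (\<exists>as bs \<phi> \<psi>. short_exact (line_sum bs) (line_sum as) E \<phi> \<psi> \<and>
        (\<forall>i<3. coeff ([:1, c1, c2:] * total_chern bs) i = coeff (total_chern as) i))"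

definition has_second_chern_class :: "('a::field, 'i) psheaf \<Rightarrow> int \<Rightarrow> bool" where
  "has_second_chern_class E c2 \<longleftrightarrow> (\<exists>c1. has_chern_classes E c1 c2)"


section \<open>Line arrangements and logarithmic vector fields\<close>

text \<open>
  A line is given by the coefficient vector of a linear form; the arrangement has the \<open>m\<close> lines
  with forms \<open>\<alpha> 0, \<dots>, \<alpha> (m - 1)\<close>. Distinctness refers to the lines as subsets of the plane,
  since a form is determined by its line only up to a scalar.
\<close>

definition linear_form :: "(3 \<Rightarrow> 'a::field) \<Rightarrow> 'a hpoly" where
  "linear_form a = (\<Sum>i\<in>UNIV. Poly_Mapping.single (Poly_Mapping.single i 1) (a i))"

definition line_arrangement :: "nat \<Rightarrow> (nat \<Rightarrow> 3 \<Rightarrow> 'a::field) \<Rightarrow> bool" where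
  "line_arrangement m \<alpha> \<longleftrightarrow>
     (\<forall>i<m. \<alpha> i \<noteq> (\<lambda>_. 0)) \<and> inj_on (\<lambda>i. zero_locus {linear_form (\<alpha> i)}) {..<m}"

definition defining_poly :: "nat \<Rightarrow> (nat \<Rightarrow> 3 \<Rightarrow> 'a::field) \<Rightarrow> 'a hpoly" where
  "defining_poly m \<alpha> = (\<Prod>i<m. linear_form (\<alpha> i))"

text \<open>The number of lines through the rational point with homogeneous coordinates \<open>v\<close>.\<close>

definition point_multiplicity :: "nat \<Rightarrow> (nat \<Rightarrow> 3 \<Rightarrow> 'a::field) \<Rightarrow> (3 \<Rightarrow> 'a) \<Rightarrow> nat" where
  "point_multiplicity m \<alpha> v = card {i. i < m \<and> (\<Sum>j\<in>UNIV. \<alpha> i j * v j) = 0}"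

text \<open>The kernel of the map from \<open>O^3\<close> to \<open>O(m - 1)\<close> given by the partial derivatives of \<open>f\<close>.\<close>

definition log_vector_fields :: "'a::field hpoly \<Rightarrow> ('a, 3) psheaf" where
  "log_vector_fields f U =
     {s. (\<forall>i. s i \<in> twist 0 U) \<and> (\<Sum>i\<in>UNIV. Fract (partial i f) 1 * s i) = 0}"

definition log_tangent_sheaf :: "nat \<Rightarrow> (nat \<Rightarrow> 3 \<Rightarrow> 'a::field) \<Rightarrow> ('a, 3) psheaf" where
  "log_tangent_sheaf m \<alpha> = log_vector_fields (defining_poly m \<alpha>)"

definition free_with_exponents :: "nat \<Rightarrow> (nat \<Rightarrow> 3 \<Rightarrow> 'a::field) \<Rightarrow> nat \<Rightarrow> nat \<Rightarrow> bool" where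
  "free_with_exponents m \<alpha> a b \<longleftrightarrow>
     sheaf_isomorphic (log_tangent_sheaf m \<alpha>) (line_sum [- int a, - int b])"

end

theory Submission
  imports Defs "HOL-Library.Function_Algebras"
begin

text \<open>
  A resolution of the sheaf by sums of line bundles induces a resolution of the graded module
  \<open>D\<close> of logarithmic fields killing the equation \<open>f\<close> (the defect is torsion at the irrelevant ideal,
  which the Koszul complex removes). Comparing Hilbert polynomials expresses \<open>c\<^sub>2\<close> through \<open>D\<close>.

  Let \<open>h\<close> lines pass through \<open>v\<close>, and let \<open>M = m - h\<close> not do so. Modulo the Euler field, an element of
  \<open>D\<close> is a pair \<open>(w, b)\<close> such that \<open>b\<close> interpolates prescribed multiples of \<open>w\<close> on those \<open>M\<close> lines. The
  forms \<open>w\<close> that admit such a \<open>b\<close> make up an ideal \<open>I\<close>, the pairs with \<open>w = 0\<close> a free module, and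
  \<open>c\<^sub>2 = M (h - 1) + \<delta>\<close> with \<open>\<delta>\<close> the eventual codimension of \<open>I\<close>. A general line through \<open>v\<close> is a
  nonzerodivisor modulo \<open>I\<close>, so the codimension of \<open>I\<close> increases to \<open>\<delta>\<close>.

  Let \<open>c\<^sub>2 = k (k + r)\<close>. For \<open>h > k\<close> this forces \<open>\<delta> = 0\<close>, hence \<open>1 \<in> I\<close> and \<open>h - 1 \<in> {k, k + r}\<close>. For
  \<open>h = k\<close> it gives \<open>\<delta> = r + 1\<close>. Then \<open>I\<close> contains a linear form: otherwise \<open>I\<close> restricts onto all forms of
  degree \<open>r\<close> on the general line, in degrees where the interpolants are unique, and this extends the
  unique interpolation to \<open>1 \<in> I\<close>, so that \<open>\<delta> = 0\<close>. By dimension count the linear form and a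
  form of degree \<open>r + 1\<close> yield independent elements of \<open>D\<close> of degrees \<open>k\<close> and \<open>k + r\<close>. In both cases
  Saito's criterion applies.
\<close>

section \<open>Homogeneous polynomials\<close>

text \<open>The class \<open>c2\<close> is defined through the existence of a resolution about which
  nothing else is known. The only thing taken from it is a Hilbert function, and since the module
  \<open>D\<close> is computed directly from the lines, every resolution gives the same
  \<open>c2\<close>. Freeness, in turn, is not proved by exhibiting generators: two elements of
  \<open>D\<close> whose degrees add up to \<open>m - 1\<close> and whose determinant with the Euler
  field is nonzero are enough.

  The affine line \<open>u + z v\<close> has \<open>v\<close> at infinity. A line off
  \<open>v\<close> meets it in a finite point, and for general \<open>u\<close> these points are
  distinct, so interpolation on lines becomes Lagrange interpolation in \<open>z\<close>.

  With \<open>d = h - 1\<close> the sum \<open>M + d = 2 k + r\<close> is fixed, and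
  \<open>M d - k (k + r) = (d - k) (k + r - d)\<close>. In the given range this is negative only for
  \<open>h = k\<close>. That end carries the difficulty: there \<delta> is positive and the two
  fields cannot be read off from the pencil of lines at \<open>v\<close>.

  Characteristic zero enters twice: \<open>m\<close> is invertible, so the Euler field splits off,
  and the field is infinite, so general lines exist.\<close>

definition hconst :: "'a::zero \<Rightarrow> 'a hpoly" where
  "hconst c = Poly_Mapping.single 0 c"

lemma UNIV_3: "(UNIV :: 3 set) = {0, 1, 2}"
proof -
  have "x \<in> {0, 1, 2}" for x :: 3
  proof (cases x)
    case (of_int z)
    then have "z = 0 \<or> z = 1 \<or> z = 2" by auto
    with of_int show ?thesis by auto
  qed
  then show ?thesis by blast
qed

lemma distinct_3: "(0::3) \<noteq> 1" "(0::3) \<noteq> 2" "(1::3) \<noteq> 2" "(1::3) \<noteq> 0" "(2::3) \<noteq> 0" "(2::3) \<noteq> 1"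
  by simp_all

lemma sum_3: "(\<Sum>i\<in>(UNIV::3 set). f i) = f 0 + f 1 + (f 2 :: 'b::comm_monoid_add)"
  unfolding UNIV_3 by (simp add: add.assoc)

lemma all_3: "(\<forall>i::3. P i) \<longleftrightarrow> P 0 \<and> P 1 \<and> P 2"
proof -
  have "(\<forall>i\<in>(UNIV::3 set). P i) \<longleftrightarrow> P 0 \<and> P 1 \<and> P 2"
    unfolding UNIV_3 by simp
  then show ?thesis by simp
qed

lemma hpoly_sum_single:
  "(p :: 'b \<Rightarrow>\<^sub>0 'c::comm_monoid_add) = (\<Sum>m\<in>Poly_Mapping.keys p. Poly_Mapping.single m (Poly_Mapping.lookup p m))"
  by (rule poly_mapping_eqI)
     (simp add: lookup_sum lookup_single when_def in_keys_iff sum.delta')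

text \<open>The monomial case keeps the information that the term occurs in \<open>p\<close>, so
  that homogeneity of \<open>p\<close> is available there.\<close>

lemma hpoly_induct [case_names zero single add]:
  fixes p :: "'b \<Rightarrow>\<^sub>0 'c::comm_monoid_add"
  assumes "P 0"
    and "\<And>m c. m \<in> Poly_Mapping.keys p \<Longrightarrow> c = Poly_Mapping.lookup p m \<Longrightarrow> P (Poly_Mapping.single m c)"
    and "\<And>p q. P p \<Longrightarrow> P q \<Longrightarrow> P (p + q)"
  shows "P p"
proof -
  have "P (\<Sum>m\<in>A. Poly_Mapping.single m (Poly_Mapping.lookup p m))"
    if "finite A" "A \<subseteq> Poly_Mapping.keys p" for A
    using that by (induction A rule: finite_induct) (auto intro: assms)
  then show ?thesis
    by (subst hpoly_sum_single) simp
qed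

lemma mon_degree_add: "mon_degree (m + n) = mon_degree m + mon_degree n"
  by (simp add: mon_degree_def lookup_add sum.distrib)

lemma mon_degree_zero [simp]: "mon_degree 0 = 0"
  by (simp add: mon_degree_def)

lemma mon_degree_single [simp]: "mon_degree (Poly_Mapping.single i k) = k"
  by (simp add: mon_degree_def lookup_single when_def)

lemma homogeneous_zero [simp]: "homogeneous d 0"
  by (simp add: homogeneous_def)

lemma homogeneous_add: "homogeneous d p \<Longrightarrow> homogeneous d q \<Longrightarrow> homogeneous d (p + q)"
  for p q :: "'a::comm_monoid_add hpoly"
  unfolding homogeneous_def using keys_add[of p q] by blast

lemma homogeneous_uminus: "homogeneous d p \<Longrightarrow> homogeneous d (- p)"
  for p :: "'a::ab_group_add hpoly"
  unfolding homogeneous_def by (simp add: in_keys_iff)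

lemma homogeneous_diff: "homogeneous d p \<Longrightarrow> homogeneous d q \<Longrightarrow> homogeneous d (p - q)"
  for p q :: "'a::ab_group_add hpoly"
  using homogeneous_add[of d p "- q"] homogeneous_uminus[of d q] by simp

lemma homogeneous_mult: "homogeneous d p \<Longrightarrow> homogeneous e q \<Longrightarrow> homogeneous (d + e) (p * q)"
  unfolding homogeneous_def using keys_mult[of p q] by (fastforce simp: mon_degree_add)

lemma homogeneous_single: "homogeneous (mon_degree m) (Poly_Mapping.single m c)"
  by (simp add: homogeneous_def)

lemma homogeneous_hconst [simp]: "homogeneous 0 (hconst c)"
  using homogeneous_single[of 0 c] by (simp add: hconst_def)

lemma hconst_one [simp]: "hconst 1 = 1"
  by (simp add: hconst_def)

lemma hconst_zero [simp]: "hconst 0 = 0"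
  by (simp add: hconst_def)

lemma hconst_add: "hconst (a + b) = hconst a + hconst b"
  by (simp add: hconst_def single_add)

lemma hconst_uminus: "hconst (- a) = - hconst a"
  by (simp add: hconst_def single_uminus)

lemma hconst_diff: "hconst (a - b) = hconst a - hconst b"
  by (simp add: hconst_def single_diff)

lemma hconst_mult: "hconst (a * b) = hconst a * hconst b"
  by (simp add: hconst_def mult_single)

lemma hconst_eq_iff [simp]: "hconst a = hconst b \<longleftrightarrow> a = b"
  unfolding hconst_def by (metis lookup_single_eq)

lemma hconst_eq_0_iff [simp]: "hconst a = 0 \<longleftrightarrow> a = 0"
  using hconst_eq_iff[of a 0] by simp

lemma homogeneous_one [simp]: "homogeneous 0 (1 :: 'a::comm_semiring_1 hpoly)"
  using homogeneous_hconst[of "1 :: 'a"] by simp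

lemma homogeneous_hvar [simp]: "homogeneous (Suc 0) (hvar i)"
  using homogeneous_single[of "Poly_Mapping.single i 1"] by (simp add: hvar_def)

lemma homogeneous_sum: "(\<And>i. i \<in> A \<Longrightarrow> homogeneous d (f i)) \<Longrightarrow> homogeneous d (sum f A)"
  by (induction A rule: infinite_finite_induct) (auto intro: homogeneous_add)

lemma homogeneous_prod:
  "(\<And>i. i \<in> A \<Longrightarrow> homogeneous (d i) (f i)) \<Longrightarrow> homogeneous (sum d A) (prod f A)"
  for f :: "'b \<Rightarrow> 'a::comm_semiring_1 hpoly"
  by (induction A rule: infinite_finite_induct) (auto intro: homogeneous_mult)

lemma homogeneous_power: "homogeneous d p \<Longrightarrow> homogeneous (n * d) (p ^ n)"
  for p :: "'a::comm_semiring_1 hpoly"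
  by (induction n) (auto intro: homogeneous_mult)

lemma linear_form_eq: "linear_form a = (\<Sum>i\<in>UNIV. hconst (a i) * hvar i)"
  for a :: "3 \<Rightarrow> 'a::field"
  by (simp add: linear_form_def hconst_def hvar_def mult_single)

lemma homogeneous_linear_form [simp]: "homogeneous (Suc 0) (linear_form a)"
  unfolding linear_form_def
  by (rule homogeneous_sum) (simp add: homogeneous_def)

lemma hvar_nonzero [simp]: "hvar i \<noteq> (0 :: 'a::zero_neq_one hpoly)"
  unfolding hvar_def by (metis lookup_single_eq lookup_zero zero_neq_one)

lemma linear_form_hvar_lookup:
  "Poly_Mapping.lookup (linear_form a) (Poly_Mapping.single i 1) = a i"
proof -
  have "Poly_Mapping.lookup (linear_form a) (Poly_Mapping.single i 1) = 
    (\<Sum>j\<in>UNIV. if i = j then a j else 0)"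
    unfolding linear_form_def lookup_sum lookup_single when_def
    by (rule sum.cong) (auto simp: poly_mapping_eq_iff fun_eq_iff lookup_single when_def)
  then show ?thesis by simp
qed

lemma linear_form_eq_0_iff: "linear_form a = 0 \<longleftrightarrow> a = (\<lambda>_. 0)"
proof
  assume "linear_form a = 0"
  then show "a = (\<lambda>_. 0)"
    using linear_form_hvar_lookup[of a] by (auto simp: fun_eq_iff)
qed (simp add: linear_form_def)

lemma lookup_hcomponent:
  "Poly_Mapping.lookup (hcomponent d p) m = (if mon_degree m = d then Poly_Mapping.lookup p m else 0)"
  unfolding hcomponent_def lookup_sum lookup_single when_def
  by (subst sum.delta) (auto simp: in_keys_iff)

lemma homogeneous_hcomponent [simp]: "homogeneous d (hcomponent d p)"
  by (auto simp: homogeneous_def in_keys_iff lookup_hcomponent split: if_splits)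

lemma hcomponent_add: "hcomponent d (p + q) = hcomponent d p + hcomponent d q"
  by (rule poly_mapping_eqI) (simp add: lookup_hcomponent lookup_add)

lemma hcomponent_zero [simp]: "hcomponent d 0 = 0"
  by (simp add: hcomponent_def)

lemma hcomponent_sum: "hcomponent d (sum f A) = (\<Sum>i\<in>A. hcomponent d (f i))"
  by (induction A rule: infinite_finite_induct) (auto simp: hcomponent_add)

lemma hcomponent_homogeneous:
  "homogeneous e p \<Longrightarrow> hcomponent d p = (if d = e then p else 0)"
  by (rule poly_mapping_eqI)
     (auto simp: lookup_hcomponent homogeneous_def in_keys_iff)

lemma sum_hcomponent: "p = (\<Sum>d\<in>mon_degree ` Poly_Mapping.keys p. hcomponent d p)"
proof (rule poly_mapping_eqI)
  fix m
  show "Poly_Mapping.lookup p m = Poly_Mapping.lookup (\<Sum>d\<in>mon_degree ` Poly_Mapping.keys p. hcomponent d p) m"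
    by (cases "m \<in> Poly_Mapping.keys p") (auto simp: lookup_sum lookup_hcomponent in_keys_iff)
qed

lemma hpoly_eqI_hcomponent: "(\<And>d. hcomponent d p = hcomponent d q) \<Longrightarrow> p = q"
  by (rule poly_mapping_eqI) (metis lookup_hcomponent)

lemma hcomponent_mult:
  fixes p q :: "'a::comm_semiring_0 hpoly"
  assumes "homogeneous e q"
  shows "hcomponent d (p * q) = (if e \<le> d then hcomponent (d - e) p * q else 0)"
proof (induction p rule: hpoly_induct)
  case (single m c)
  have "homogeneous (mon_degree m + e) (Poly_Mapping.single m c * q)"
    by (intro homogeneous_mult homogeneous_single assms)
  then show ?case
    by (auto simp: hcomponent_homogeneous hcomponent_homogeneous[OF homogeneous_single])
qed (auto simp: hcomponent_add distrib_right)

text \<open>Degrees are integers and the pieces of negative degree are zero, so that shifts such as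
  \<open>n - 1\<close> or \<open>n - M\<close> need no case distinction.\<close>

definition hset :: "int \<Rightarrow> 'a::zero hpoly set" where
  "hset n = {p. homogeneous (nat n) p \<and> (n < 0 \<longrightarrow> p = 0)}"

lemma hset_neg: "n < 0 \<Longrightarrow> hset n = {0}"
  by (auto simp: hset_def)

lemma hset_int [simp]: "p \<in> hset (int n) \<longleftrightarrow> homogeneous n p"
  by (simp add: hset_def)

lemma zero_in_hset [simp]: "0 \<in> hset n"
  by (simp add: hset_def)

lemma hset_add: "p \<in> hset n \<Longrightarrow> q \<in> hset n \<Longrightarrow> p + q \<in> hset n"
  for p q :: "'a::comm_monoid_add hpoly"
  by (auto simp: hset_def intro: homogeneous_add)

lemma hset_diff: "p \<in> hset n \<Longrightarrow> q \<in> hset n \<Longrightarrow> p - q \<in> hset n"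
  for p q :: "'a::ab_group_add hpoly"
  by (auto simp: hset_def intro: homogeneous_diff)

lemma hset_uminus: "p \<in> hset n \<Longrightarrow> - p \<in> hset n"
  for p :: "'a::ab_group_add hpoly"
  by (auto simp: hset_def intro: homogeneous_uminus)

lemma hset_sum: "(\<And>i. i \<in> A \<Longrightarrow> f i \<in> hset n) \<Longrightarrow> sum f A \<in> hset n"
  by (induction A rule: infinite_finite_induct) (auto intro: hset_add)

lemma hset_mult: "p \<in> hset a \<Longrightarrow> q \<in> hset b \<Longrightarrow> p * q \<in> hset (a + b)"
  for p q :: "'a::comm_semiring_0 hpoly"
  using homogeneous_mult[of "nat a" p "nat b" q]
  by (cases "a < 0 \<or> b < 0") (auto simp: hset_def nat_add_distrib)

lemma hset_mult': "p \<in> hset a \<Longrightarrow> q \<in> hset b \<Longrightarrow> c = a + b \<Longrightarrow> p * q \<in> hset c"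
  for p q :: "'a::comm_semiring_0 hpoly"
  using hset_mult by blast

lemma hconst_in_hset [simp]: "hconst c \<in> hset 0"
  by (simp add: hset_def)

lemma one_in_hset [simp]: "(1 :: 'a::comm_semiring_1 hpoly) \<in> hset 0"
  by (simp add: hset_def)

lemma hset_hconst_mult: "p \<in> hset a \<Longrightarrow> hconst c * p \<in> hset a"
  for p :: "'a::comm_semiring_1 hpoly"
  using hset_mult[OF hconst_in_hset, of p a c] by simp

lemma hvar_in_hset [simp]: "hvar i \<in> hset 1"
  using hset_int[of "hvar i" 1] by simp

lemma linear_form_in_hset [simp]: "linear_form a \<in> hset 1"
  using hset_int[of "linear_form a" 1] by simp

lemma hset_power: "p \<in> hset 1 \<Longrightarrow> p ^ n \<in> hset (int n)"
  for p :: "'a::comm_semiring_1 hpoly"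
  using homogeneous_power[of 1 p n] by (simp add: hset_def)

lemma hset_prod: "finite A \<Longrightarrow> (\<And>i. i \<in> A \<Longrightarrow> f i \<in> hset 1) \<Longrightarrow> prod f A \<in> hset (int (card A))"
  for f :: "'b \<Rightarrow> 'a::comm_semiring_1 hpoly"
  using homogeneous_prod[of A "\<lambda>_. 1" f] by (simp add: hset_def)

text \<open>Multiplication by \<open>p\<close> shifts components by \<open>a\<close> and is
  injective, so every component of \<open>q\<close> outside degree \<open>b - a\<close> is
  zero.\<close>

lemma hset_cancel:
  fixes p q :: "'a::idom hpoly"
  assumes "p \<in> hset a" "p \<noteq> 0" "q * p \<in> hset b"
  shows "q \<in> hset (b - a)"
proof -
  from assms have a: "a \<ge> 0" "homogeneous (nat a) p"
    by (auto simp: hset_def)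
  have *: "hcomponent j q = 0" if "int j \<noteq> b - a" for j
  proof -
    have "hcomponent (j + nat a) (q * p) = hcomponent j q * p"
      using hcomponent_mult[OF a(2), of "j + nat a" q] by simp
    moreover have "hcomponent (j + nat a) (q * p) = 0"
      using assms(3) that a(1) hcomponent_homogeneous[of "nat b" "q * p" "j + nat a"]
      by (cases "b < 0") (auto simp: hset_def)
    ultimately show ?thesis using assms(2) by simp
  qed
  show ?thesis
  proof (cases "b - a < 0")
    case True
    then have "hcomponent j q = hcomponent j 0" for j
      using *[of j] by simp
    then have "q = 0" by (rule hpoly_eqI_hcomponent)
    then show ?thesis by simp
  next
    case False
    have "hcomponent d q = hcomponent d (hcomponent (nat (b - a)) q)" for d
      using *[of d] False
      by (cases "d = nat (b - a)") (auto simp: hcomponent_homogeneous[OF homogeneous_hcomponent])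
    then have "q = hcomponent (nat (b - a)) q" by (rule hpoly_eqI_hcomponent)
    then have "homogeneous (nat (b - a)) q"
      using homogeneous_hcomponent by metis
    with False show ?thesis by (simp add: hset_def)
  qed
qed

lemma hset_0_hconst:
  assumes "p \<in> hset 0"
  obtains c where "p = hconst c"
proof
  have *: "m = 0" if "mon_degree m = 0" for m
    using that by (intro poly_mapping_eqI) (simp add: mon_degree_def)
  have "Poly_Mapping.lookup p m = Poly_Mapping.lookup (hconst (Poly_Mapping.lookup p 0)) m" for m
  proof (cases "m = 0")
    case False
    with * assms have "m \<notin> Poly_Mapping.keys p"
      by (auto simp: hset_def homogeneous_def)
    with False show ?thesis
      by (simp add: hconst_def lookup_single when_def in_keys_iff)
  qed (simp add: hconst_def)
  then show "p = hconst (Poly_Mapping.lookup p 0)"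
    by (rule poly_mapping_eqI)
qed

text \<open>A monomial of positive degree contains some variable, which can be split off. Inductions
  on the degree of a form rest on this.\<close>

lemma hset_hvar_expansion:
  fixes p :: "'a::comm_ring_1 hpoly"
  assumes "p \<in> hset n" and n: "n \<ge> 1"
  obtains q where "\<And>i. q i \<in> hset (n - 1)" "p = (\<Sum>i\<in>UNIV. hvar i * q i)"
proof -
  have "\<exists>q. (\<forall>i. q i \<in> hset (n - 1)) \<and> p = (\<Sum>i\<in>UNIV. hvar i * q i)"
  proof (induction p rule: hpoly_induct)
    case zero
    show ?case by (rule exI[of _ "\<lambda>_. 0"]) simp
  next
    case (single m c)
    with assms have m: "int (mon_degree m) = n"
      by (auto simp: hset_def homogeneous_def)
    have "\<exists>i. Poly_Mapping.lookup m i \<noteq> 0"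
    proof (rule ccontr)
      assume "\<not> ?thesis"
      then have "mon_degree m = 0" by (simp add: mon_degree_def)
      with m n show False by simp
    qed
    then obtain i where i: "Poly_Mapping.lookup m i \<noteq> 0" ..
    define m' where "m' = m - Poly_Mapping.single i 1"
    have mm': "m = Poly_Mapping.single i 1 + m'"
    proof (rule poly_mapping_eqI)
      fix k
      show "Poly_Mapping.lookup m k = Poly_Mapping.lookup (Poly_Mapping.single i 1 + m') k"
        using i by (cases "k = i") (simp_all add: m'_def lookup_add lookup_minus lookup_single)
    qed
    have "mon_degree m = mon_degree (Poly_Mapping.single i 1 + m')"
      by (rule arg_cong[OF mm'])
    also have "\<dots> = 1 + mon_degree m'"
      unfolding mon_degree_add mon_degree_single ..
    finally have "mon_degree m = 1 + mon_degree m'" .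
    then have "int (mon_degree m') = n - 1" 
      unfolding m[symmetric] by (rule ssubst) simp
    then have 1: "Poly_Mapping.single m' c \<in> hset (n - 1)"
      using homogeneous_single[of m' c] by (metis hset_int)
    have 2: "Poly_Mapping.single m c = hvar i * Poly_Mapping.single m' c"
      by (subst mm') (simp add: hvar_def mult_single)
    have "(\<Sum>j\<in>UNIV. hvar j * (if j = i then Poly_Mapping.single m' c else 0)) =
      (\<Sum>j\<in>UNIV. if j = i then hvar j * Poly_Mapping.single m' c else 0)"
      by (rule sum.cong) auto
    also have "\<dots> = hvar i * Poly_Mapping.single m' c" by simp
    finally show ?case
      using 1 2 by (intro exI[of _ "\<lambda>j. if j = i then Poly_Mapping.single m' c else 0"]) simp
  next
    case (add p q)
    then obtain a b where "\<forall>i. a i \<in> hset (n - 1)" "p = (\<Sum>i\<in>UNIV. hvar i * a i)"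
      "\<forall>i. b i \<in> hset (n - 1)" "q = (\<Sum>i\<in>UNIV. hvar i * b i)" by blast
    then show ?case
      by (intro exI[of _ "\<lambda>i. a i + b i"]) (auto simp: distrib_left sum.distrib intro: hset_add)
  qed
  with that show ?thesis by blast

qed

section \<open>Restriction to a line\<close>

definition lval :: "(3 \<Rightarrow> 'a::comm_semiring_0) \<Rightarrow> (3 \<Rightarrow> 'a) \<Rightarrow> 'a" where
  "lval a v = (\<Sum>i\<in>UNIV. a i * v i)"

text \<open>The restriction of a polynomial to the affine line \<open>u + z v\<close>, as a polynomial in \<open>z\<close>.\<close>

definition peval :: "(3 \<Rightarrow> 'a::field) \<Rightarrow> (3 \<Rightarrow> 'a) \<Rightarrow> 'a hpoly \<Rightarrow> 'a poly" where
  "peval u v p = (\<Sum>m\<in>Poly_Mapping.keys p.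
     smult (Poly_Mapping.lookup p m) (\<Prod>i\<in>UNIV. [:u i, v i:] ^ Poly_Mapping.lookup m i))"

lemma peval_superset:
  "finite A \<Longrightarrow> Poly_Mapping.keys p \<subseteq> A \<Longrightarrow> peval u v p =
    (\<Sum>m\<in>A. smult (Poly_Mapping.lookup p m) (\<Prod>i\<in>UNIV. [:u i, v i:] ^ Poly_Mapping.lookup m i))"
  unfolding peval_def by (rule sum.mono_neutral_left) (auto simp: in_keys_iff)

lemma peval_zero [simp]: "peval u v 0 = 0"
  by (simp add: peval_def)

lemma peval_add: "peval u v (p + q) = peval u v p + peval u v q"
proof -
  let ?A = "Poly_Mapping.keys p \<union> Poly_Mapping.keys q"
  have "Poly_Mapping.keys (p + q) \<subseteq> ?A" by (rule keys_add)
  then show ?thesis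
    by (simp add: peval_superset[of ?A] lookup_add smult_add_left sum.distrib)
qed

lemma peval_single:
  "peval u v (Poly_Mapping.single m c) = smult c (\<Prod>i\<in>UNIV. [:u i, v i:] ^ Poly_Mapping.lookup m i)"
  by (subst peval_superset[of "{m}"]) auto

lemma peval_mult: "peval u v (p * q) = peval u v p * peval u v q"
proof (induction p rule: hpoly_induct)
  case (single m c)
  show ?case
  proof (induction q rule: hpoly_induct)
    case (single m' c')
    show ?case
      by (simp add: mult_single peval_single lookup_add power_add prod.distrib mult.commute)
  qed (auto simp: peval_add algebra_simps)
qed (auto simp: peval_add algebra_simps)

lemma peval_hconst [simp]: "peval u v (hconst c) = [:c:]"
  by (simp add: hconst_def peval_single)

lemma peval_one [simp]: "peval u v 1 = 1"
  using peval_hconst[of u v 1] by (simp add: one_pCons)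

lemma peval_uminus: "peval u v (- p) = - peval u v p"
proof -
  have "peval u v p + peval u v (- p) = 0"
    unfolding peval_add[symmetric] by simp
  then show ?thesis by (rule minus_unique[symmetric])
qed

lemma peval_diff: "peval u v (p - q) = peval u v p - peval u v q"
  using peval_add[of u v p "- q"] unfolding peval_uminus by simp

lemma peval_sum: "peval u v (sum f A) = (\<Sum>i\<in>A. peval u v (f i))"
  by (induction A rule: infinite_finite_induct) (auto simp: peval_add)

lemma peval_prod: "peval u v (prod f A) = (\<Prod>i\<in>A. peval u v (f i))"
  by (induction A rule: infinite_finite_induct) (auto simp: peval_mult)

lemma peval_power: "peval u v (p ^ n) = peval u v p ^ n"
  by (induction n) (auto simp: peval_mult)

lemma peval_hvar [simp]: "peval u v (hvar i) = [:u i, v i:]"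
proof -
  have "(\<Prod>j\<in>UNIV. [:u j, v j:] ^ Poly_Mapping.lookup (Poly_Mapping.single i 1) j) =
    (\<Prod>j\<in>UNIV. if j = i then [:u j, v j:] else 1)"
    by (rule prod.cong) (auto simp: lookup_single when_def)
  then show ?thesis by (simp add: hvar_def peval_single)
qed

lemma peval_linear_form [simp]: "peval u v (linear_form a) = [:lval a u, lval a v:]"
  unfolding linear_form_eq sum_3 lval_def
  by (simp add: peval_add peval_mult)

text \<open>A degree bound that may be negative and then forces the zero polynomial, in step with
  \<open>hset\<close>.\<close>

definition pset :: "int \<Rightarrow> 'a::zero poly set" where
  "pset n = {p. \<forall>j. int j > n \<longrightarrow> coeff p j = 0}"

lemma pset_add: "p \<in> pset n \<Longrightarrow> q \<in> pset n \<Longrightarrow> p + q \<in> pset n"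
  by (simp add: pset_def)

lemma pset_smult: "p \<in> pset n \<Longrightarrow> smult c p \<in> pset n"
  by (simp add: pset_def)

lemma pset_mult_linear:
  assumes "p \<in> pset (n - 1)"
  shows "[:a, b:] * p \<in> pset n"
proof -
  have "coeff ([:a, b:] * p) j = 0" if j: "int j > n" for j
  proof (cases j)
    case 0
    with j assms show ?thesis by (simp add: pset_def)
  next
    case (Suc i)
    with j assms have 1: "coeff p i = 0" 
      by (simp add: pset_def)
    have 2: "coeff p (Suc i) = 0"
      using j assms Suc by (simp add: pset_def)
    with Suc 1 2 show ?thesis by (simp add: coeff_pCons)
  qed
  then show ?thesis by (simp add: pset_def)
qed

lemma peval_in_pset:
  assumes "p \<in> hset n"
  shows "peval u v p \<in> pset n"
  using assms
proof (induction "nat n" arbitrary: n p)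
  case 0
  show ?case
  proof (cases "n < 0")
    case False
    with 0 obtain c where "p = hconst c" using hset_0_hconst[of p] by auto
    then show ?thesis using False by (simp add: pset_def coeff_eq_0)
  qed (use 0 in \<open>auto simp: hset_def pset_def\<close>)
next
  case (Suc k)
  then have "n \<ge> 1" by simp
  with Suc.prems obtain q where q: "\<And>i. q i \<in> hset (n - 1)" "p = (\<Sum>i\<in>UNIV. hvar i * q i)"
    by (rule hset_hvar_expansion) blast
  have "peval u v (q i) \<in> pset (n - 1)" for i
    using Suc(1)[of "n - 1"] Suc(2) q(1) by simp
  then show ?case
    unfolding q(2) peval_sum peval_mult peval_hvar unfolding sum_3
    by (intro pset_add pset_mult_linear)
qed

section \<open>Dimensions\<close>

text \<open>A relation instead of a function: it asserts finite dimensionality along with the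
  dimension.\<close>

definition vdim :: "('a::field \<Rightarrow> 'b::ab_group_add \<Rightarrow> 'b) \<Rightarrow> 'b set \<Rightarrow> nat \<Rightarrow> bool" where
  "vdim s V n \<longleftrightarrow> (\<exists>B. finite B \<and> card B = n \<and> \<not> module.dependent s B \<and> module.span s B = V)"

lemma vdim_unique:
  assumes "vector_space s" "vdim s V m" "vdim s V n"
  shows "m = n"
proof -
  interpret vector_space s by fact
  from assms(2,3) show ?thesis
    unfolding vdim_def using dim_span_eq_card_independent by metis
qed

lemma vdim_trivial:
  assumes "vector_space s"
  shows "vdim s {0} 0"
proof -
  interpret vector_space s by fact
  show ?thesis unfolding vdim_def by (intro exI[of _ "{}"]) (simp add: independent_empty)
qed

lemma vdim_subspace:
  assumes "vector_space s" "vdim s V n" "module.subspace s W" "W \<subseteq> V"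
  obtains k where "vdim s W k" "k \<le> n" "k = n \<Longrightarrow> W = V"
proof -
  interpret vector_space s by fact
  from assms(2) obtain B where B: "finite B" "card B = n" "independent B" "span B = V"
    unfolding vdim_def by blast
  obtain C where C: "C \<subseteq> W" "independent C" "W \<subseteq> span C"
    using maximal_independent_subset by metis
  have "C \<subseteq> span B" using C(1) assms(4) B(4) by blast
  from independent_span_bound[OF B(1) C(2) this]
  have fin: "finite C" "card C \<le> n" using B(2) by auto
  have sp: "span C = W" using C span_subspace assms(3) by blast
  show thesis
  proof (rule that)
    show "vdim s W (card C)" unfolding vdim_def using fin C sp by blast
    show "card C \<le> n" by fact
    assume "card C = n"
    have "b \<in> span C" if "b \<in> B" for b
    proof (rule ccontr)
      assume b: "b \<notin> span C"
      then have "independent (insert b C)" using C(2) by (rule independent_insertI)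
      moreover have "insert b C \<subseteq> span B" using that \<open>C \<subseteq> span B\<close> span_base by blast
      ultimately have "card (insert b C) \<le> card B" using independent_span_bound[OF B(1)] by blast
      moreover have "b \<notin> C" using b span_base by blast
      ultimately show False using fin \<open>card C = n\<close> B(2) by simp
    qed
    then have "span B \<subseteq> span C" by (intro span_minimal) auto
    with sp B(4) assms(4) show "W = V" by blast
  qed
qed

text \<open>Linearity is asked for on \<open>V\<close> alone, and kernels and images are sets, so
  that graded pieces can be handled without types of their own.\<close>

locale subspace_map =
  s1: vector_space s1 + s2: vector_space s2
  for s1 :: "'a::field \<Rightarrow> 'b::ab_group_add \<Rightarrow> 'b" and s2 :: "'a \<Rightarrow> 'c::ab_group_add \<Rightarrow> 'c" +
  fixes V :: "'b set" and f :: "'b \<Rightarrow> 'c"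
  assumes subspace: "s1.subspace V"
    and add: "\<And>x y. x \<in> V \<Longrightarrow> y \<in> V \<Longrightarrow> f (x + y) = f x + f y"
    and scale: "\<And>c x. x \<in> V \<Longrightarrow> f (s1 c x) = s2 c (f x)"
begin

lemma zero: "f 0 = 0"
  using add[of 0 0] s1.subspace_0[OF subspace] by simp

lemma in_subspace_sum: "A \<subseteq> V \<Longrightarrow> (\<Sum>x\<in>A. s1 (c x) x) \<in> V"
  by (rule s1.subspace_sum[OF subspace]) (auto intro: s1.subspace_scale[OF subspace])

lemma sum: "finite A \<Longrightarrow> A \<subseteq> V \<Longrightarrow> f (\<Sum>x\<in>A. s1 (c x) x) = (\<Sum>x\<in>A. s2 (c x) (f x))"
proof (induction A rule: finite_induct)
  case (insert x A)
  then have "f (s1 (c x) x + (\<Sum>x\<in>A. s1 (c x) x)) = f (s1 (c x) x) + f (\<Sum>x\<in>A. s1 (c x) x)"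
    by (intro add in_subspace_sum s1.subspace_scale[OF subspace]) auto
  with insert show ?case by (simp add: scale)
qed (simp add: zero)

text \<open>Rank-nullity: a basis of the kernel together with preimages of a basis of the image is a
  basis of \<open>V\<close>.\<close>

lemma vdim_exact:
  assumes "vdim s1 {x \<in> V. f x = 0} a" "vdim s2 (f ` V) b"
  shows "vdim s1 V (a + b)"
proof -
  obtain B where B: "finite B" "card B = a" "s1.independent B" "s1.span B = {x \<in> V. f x = 0}"
    using assms(1) unfolding vdim_def by blast
  obtain C where C: "finite C" "card C = b" "s2.independent C" "s2.span C = f ` V"
    using assms(2) unfolding vdim_def by blast
  have "\<forall>c\<in>C. \<exists>x\<in>V. f x = c" using C(4) s2.span_superset[of C] by auto
  then obtain g where g: "\<And>c. c \<in> C \<Longrightarrow> g c \<in> V" "\<And>c. c \<in> C \<Longrightarrow> f (g c) = c" by metis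
  have inj: "inj_on g C" by (rule inj_onI) (metis g(2))
  have BV: "B \<subseteq> V" and fB: "\<And>x. x \<in> B \<Longrightarrow> f x = 0"
    using B(4) s1.span_superset[of B] by auto
  have gV: "g ` C \<subseteq> V" using g by auto
  have "0 \<notin> C" using C(3) s2.dependent_zero by blast
  then have disj: "B \<inter> g ` C = {}" using g(2) fB by fastforce
  have "s1.independent (B \<union> g ` C)"
  proof (rule s1.independent_if_scalars_zero)
    show "finite (B \<union> g ` C)" using B C by simp
    fix u x assume u: "(\<Sum>x\<in>B \<union> g ` C. s1 (u x) x) = 0" and x: "x \<in> B \<union> g ` C"
    have "0 = f (\<Sum>x\<in>B \<union> g ` C. s1 (u x) x)" using u zero by simp
    also have "\<dots> = (\<Sum>x\<in>B \<union> g ` C. s2 (u x) (f x))"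
      using B C BV gV by (intro sum) auto
    also have "\<dots> = (\<Sum>x\<in>B. s2 (u x) (f x)) + (\<Sum>x\<in>g ` C. s2 (u x) (f x))"
      using B C disj by (intro sum.union_disjoint) auto
    also have "\<dots> = (\<Sum>c\<in>C. s2 (u (g c)) c)"
      using fB by (simp add: sum.reindex[OF inj] g(2))
    finally have "(\<Sum>c\<in>C. s2 (u (g c)) c) = 0" by simp
    then have uc: "u (g c) = 0" if "c \<in> C" for c
      using s2.independentD[OF C(3,1) order_refl _ that, of "\<lambda>c. u (g c)"] by simp
    have "(\<Sum>x\<in>B \<union> g ` C. s1 (u x) x) = (\<Sum>x\<in>B. s1 (u x) x) + (\<Sum>x\<in>g ` C. s1 (u x) x)"
      using B C disj by (intro sum.union_disjoint) auto
    moreover have "(\<Sum>x\<in>g ` C. s1 (u x) x) = 0"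
      using uc by (intro sum.neutral) auto
    ultimately have "(\<Sum>x\<in>B. s1 (u x) x) = 0" using u by simp
    then have "u x = 0" if "x \<in> B" for x
      using s1.independentD[OF B(3,1) order_refl _ that] by simp
    with uc x show "u x = 0" by auto
  qed
  moreover have "s1.span (B \<union> g ` C) = V"
  proof (rule s1.span_subspace)
    show "B \<union> g ` C \<subseteq> V" using BV gV by simp
    show "V \<subseteq> s1.span (B \<union> g ` C)"
    proof
      fix v assume v: "v \<in> V"
      then have "f v \<in> s2.span C" using C(4) by simp
      then obtain r where r: "f v = (\<Sum>c\<in>C. s2 (r c) c)"
        unfolding s2.span_finite[OF C(1)] by auto
      define w where "w = (\<Sum>x\<in>g ` C. s1 (r (f x)) x)"
      have wV: "w \<in> V" unfolding w_def by (rule in_subspace_sum[OF gV])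
      have "f w = (\<Sum>x\<in>g ` C. s2 (r (f x)) (f x))"
        unfolding w_def using C gV by (intro sum) auto
      also have "\<dots> = f v" unfolding r sum.reindex[OF inj] by (simp add: g(2))
      finally have fw: "f w = f v" .
      have vw: "v - w \<in> V" using v wV by (rule s1.subspace_diff[OF subspace])
      have "f v = f (v - w) + f w" using add[OF vw wV] by simp
      with fw vw have "v - w \<in> s1.span B" using B(4) by simp
      then have "v - w \<in> s1.span (B \<union> g ` C)"
        using s1.span_mono[of B "B \<union> g ` C"] by auto
      moreover have "w \<in> s1.span (B \<union> g ` C)"
        unfolding w_def by (intro s1.span_sum s1.span_scale s1.span_base) auto
      ultimately have "(v - w) + w \<in> s1.span (B \<union> g ` C)" by (rule s1.span_add)
      then show "v \<in> s1.span (B \<union> g ` C)" by simp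
    qed
    show "s1.subspace V" by (rule subspace)
  qed
  moreover have "card (B \<union> g ` C) = a + b"
    using B C disj card_image[OF inj] by (subst card_Un_disjoint) auto
  ultimately show ?thesis unfolding vdim_def using B(1) C(1)
    by (intro exI[of _ "B \<union> g ` C"]) simp
qed

lemma vdim_image:
  assumes "vdim s1 V n" "\<And>x. x \<in> V \<Longrightarrow> f x = 0 \<Longrightarrow> x = 0"
  shows "vdim s2 (f ` V) n"
proof -
  obtain B where B: "finite B" "card B = n" "s1.independent B" "s1.span B = V"
    using assms(1) unfolding vdim_def by blast
  have BV: "B \<subseteq> V" using B(4) s1.span_superset by blast
  have inj: "inj_on f V"
  proof (rule inj_onI)
    fix x y assume xy: "x \<in> V" "y \<in> V" "f x = f y"
    have 1: "x - y \<in> V" using xy by (intro s1.subspace_diff[OF subspace])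
    have "f (x - y) = 0" using add[OF 1 xy(2)] xy(3) by simp
    with 1 assms(2) show "x = y" by fastforce
  qed
  then have injB: "inj_on f B" using BV inj_on_subset by blast
  have "s2.independent (f ` B)"
  proof (rule s2.independent_if_scalars_zero)
    show "finite (f ` B)" using B by simp
    fix u y assume u: "(\<Sum>y\<in>f ` B. s2 (u y) y) = 0" and y: "y \<in> f ` B"
    have "f (\<Sum>x\<in>B. s1 (u (f x)) x) = 0"
      using u unfolding sum[OF B(1) BV] sum.reindex[OF injB] by simp
    then have "(\<Sum>x\<in>B. s1 (u (f x)) x) = 0" by (rule assms(2)[OF in_subspace_sum[OF BV]])
    then have "u (f x) = 0" if "x \<in> B" for x
      using s1.independentD[OF B(3,1) order_refl _ that, of "\<lambda>x. u (f x)"] by simp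
    with y show "u y = 0" by auto
  qed
  moreover have "s2.span (f ` B) = f ` V"
  proof -
    have "f ` V = range (\<lambda>u. f (\<Sum>x\<in>B. s1 (u x) x))"
      unfolding B(4)[symmetric] s1.span_finite[OF B(1)] by auto
    also have "\<dots> = range (\<lambda>u. \<Sum>x\<in>B. s2 (u x) (f x))"
      unfolding sum[OF B(1) BV] ..
    also have "\<dots> = range (\<lambda>u. \<Sum>y\<in>f ` B. s2 (u y) y)"
    proof -
      have 1: "(\<Sum>x\<in>B. s2 (u x) (f x)) = (\<Sum>y\<in>f ` B. s2 (u (inv_into B f y)) y)" for u
        unfolding sum.reindex[OF injB] by (simp add: inv_into_f_f[OF injB])
      have 2: "(\<Sum>y\<in>f ` B. s2 (u y) y) = (\<Sum>x\<in>B. s2 (u (f x)) (f x))" for u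
        unfolding sum.reindex[OF injB] by simp
      show ?thesis
      proof (intro equalityI subsetI)
        fix z assume "z \<in> range (\<lambda>u. \<Sum>x\<in>B. s2 (u x) (f x))"
        then obtain u where "z = (\<Sum>y\<in>f ` B. s2 (u (inv_into B f y)) y)" using 1 by auto
        then show "z \<in> range (\<lambda>u. \<Sum>y\<in>f ` B. s2 (u y) y)"
          by (intro range_eqI[of _ _ "\<lambda>y. u (inv_into B f y)"])
      next
        fix z assume "z \<in> range (\<lambda>u. \<Sum>y\<in>f ` B. s2 (u y) y)"
        then obtain u where "z = (\<Sum>x\<in>B. s2 (u (f x)) (f x))" using 2 by auto
        then show "z \<in> range (\<lambda>u. \<Sum>x\<in>B. s2 (u x) (f x))"
          by (auto intro: range_eqI[of _ _ "\<lambda>x. u (f x)"])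
      qed
    qed
    also have "\<dots> = s2.span (f ` B)" using s2.span_finite B(1) by simp
    finally show ?thesis ..
  qed
  ultimately show ?thesis
    unfolding vdim_def using B card_image[OF injB] by (intro exI[of _ "f ` B"]) simp
qed

lemma subspace_image: "s2.subspace (f ` V)"
proof -
  have "0 \<in> f ` V" using zero s1.subspace_0[OF subspace] by force
  moreover have "f x + f y \<in> f ` V" if "x \<in> V" "y \<in> V" for x y
    using add[OF that] s1.subspace_add[OF subspace that] by (metis imageI)
  moreover have "s2 c (f x) \<in> f ` V" if "x \<in> V" for c x
    using scale[OF that] s1.subspace_scale[OF subspace that] by (metis imageI)
  ultimately show ?thesis unfolding s2.subspace_def by auto
qed

lemma subspace_kernel: "s1.subspace {x \<in> V. f x = 0}"
  unfolding s1.subspace_def using subspace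
  by (auto simp: add scale zero s1.subspace_0 s1.subspace_add s1.subspace_scale)

end

definition hscale :: "'a::field \<Rightarrow> 'a hpoly \<Rightarrow> 'a hpoly" where
  "hscale c p = hconst c * p"

definition fscale :: "'a::field \<Rightarrow> ('i \<Rightarrow> 'a hpoly) \<Rightarrow> 'i \<Rightarrow> 'a hpoly" where
  "fscale c f = (\<lambda>i. hconst c * f i)"

lemma vector_space_hscale: "vector_space hscale"
  by standard (auto simp: hscale_def hconst_add hconst_mult algebra_simps)

lemma vector_space_fscale: "vector_space fscale"
  by standard (auto simp: fscale_def hconst_add hconst_mult algebra_simps fun_eq_iff)

lemma vector_space_smult: "vector_space (smult :: 'a::field \<Rightarrow> _)"
  by standard (auto simp: smult_add_left smult_add_right)

lemma subspace_hscale: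
  "module.subspace hscale V \<longleftrightarrow> 0 \<in> V \<and> (\<forall>x\<in>V. \<forall>y\<in>V. x + y \<in> V) \<and> (\<forall>c. \<forall>x\<in>V. hconst c * x \<in> V)"
proof -
  interpret vector_space hscale by (rule vector_space_hscale)
  show ?thesis unfolding subspace_def hscale_def ..
qed

lemma subspace_fscale:
  "module.subspace fscale V \<longleftrightarrow> 0 \<in> V \<and> (\<forall>x\<in>V. \<forall>y\<in>V. x + y \<in> V) \<and>
    (\<forall>c. \<forall>x\<in>V. (\<lambda>i. hconst c * x i) \<in> V)"
proof -
  interpret vector_space fscale by (rule vector_space_fscale)
  show ?thesis unfolding subspace_def fscale_def ..
qed

lemma vdim_pset: "vdim smult (pset n :: 'a::field poly set) (nat (n + 1))"
proof -
  interpret vector_space "smult :: 'a \<Rightarrow> _" by (rule vector_space_smult)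
  let ?N = "nat (n + 1)" and ?m = "monom (1 :: 'a)"
  have inj: "inj_on ?m {..<?N}" by (rule inj_onI) (simp add: monom_eq_iff')
  have expand: "(\<Sum>x\<in>?m ` {..<?N}. smult (c x) x) = (\<Sum>i<?N. monom (c (?m i)) i)" for c
    unfolding sum.reindex[OF inj] by (simp add: smult_monom)
  have coeff: "coeff (\<Sum>i<?N. monom (c i) i) j = (if j < ?N then c j else 0)" for c :: "nat \<Rightarrow> 'a" and j
    by (simp add: coeff_sum)
  have "independent (?m ` {..<?N})"
  proof (rule independent_if_scalars_zero)
    fix c x assume "(\<Sum>x\<in>?m ` {..<?N}. smult (c x) x) = 0" "x \<in> ?m ` {..<?N}"
    then obtain j where "j < ?N" "x = ?m j" "(\<Sum>i<?N. monom (c (?m i)) i) = 0"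
      unfolding expand by auto
    then show "c x = 0" using coeff[of "\<lambda>i. c (?m i)" j] by simp
  qed simp
  moreover have "span (?m ` {..<?N}) = pset n"
  proof (rule span_subspace)
    show "?m ` {..<?N} \<subseteq> pset n" by (auto simp: pset_def)
    show "subspace (pset n)" unfolding subspace_def by (simp add: pset_add pset_smult) (simp add: pset_def)
    show "pset n \<subseteq> span (?m ` {..<?N})"
    proof
      fix p :: "'a poly" assume p: "p \<in> pset n"
      have "p = (\<Sum>i<?N. monom (coeff p i) i)"
        using p by (intro poly_eqI) (auto simp: coeff pset_def)
      also have "\<dots> = (\<Sum>i<?N. smult (coeff p i) (?m i))" by (simp add: smult_monom)
      also have "\<dots> \<in> span (?m ` {..<?N})"
        by (intro span_sum span_scale span_base) auto
      finally show "p \<in> span (?m ` {..<?N})" .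
    qed
  qed
  ultimately show ?thesis
    unfolding vdim_def using card_image[OF inj] by (intro exI[of _ "?m ` {..<?N}"]) simp
qed

section \<open>Linear forms\<close>

text \<open>The coefficient vector of the line joining \<open>u\<close> and \<open>v\<close>; it is
  nonzero exactly when the two vectors are independent.\<close>

definition cross :: "(3 \<Rightarrow> 'a::comm_ring) \<Rightarrow> (3 \<Rightarrow> 'a) \<Rightarrow> 3 \<Rightarrow> 'a" where
  "cross u v i = (if i = 0 then u 1 * v 2 - u 2 * v 1
     else if i = 1 then u 2 * v 0 - u 0 * v 2 else u 0 * v 1 - u 1 * v 0)"

lemma cross_simps [simp]:
  "cross u v 0 = u 1 * v 2 - u 2 * v 1"
  "cross u v 1 = u 2 * v 0 - u 0 * v 2"
  "cross u v 2 = u 0 * v 1 - u 1 * v 0"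
  by (simp_all add: cross_def)

lemma lval_3: "lval a v = a 0 * v 0 + a 1 * v 1 + a 2 * v 2"
  unfolding lval_def sum_3 ..

lemma lval_cross [simp]:
  fixes u v :: "3 \<Rightarrow> 'a::comm_ring"
  shows "lval (cross u v) u = 0" "lval (cross u v) v = 0"
  unfolding lval_3 by (simp_all add: algebra_simps)

lemma linear_form_3:
  "linear_form a = hconst (a 0) * hvar 0 + hconst (a 1) * hvar 1 + hconst (a 2) * hvar 2"
  for a :: "3 \<Rightarrow> 'a::field"
  unfolding linear_form_eq sum_3 ..

lemma linear_form_scale: "linear_form (\<lambda>i. c * a i) = hconst c * linear_form a"
  for a :: "3 \<Rightarrow> 'a::field"
  unfolding linear_form_3 by (simp add: hconst_mult algebra_simps)

text \<open>If \<open>e\<close> has determinant one with \<open>u\<close> and \<open>v\<close>, then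
  \<open>cross v e\<close>, \<open>cross e u\<close> and \<open>cross u v\<close> form the basis
  dual to \<open>u\<close>, \<open>v\<close>, \<open>e\<close>.\<close>

lemma dual_basis:
  fixes u v :: "3 \<Rightarrow> 'a::field"
  assumes "cross u v \<noteq> (\<lambda>_. 0)"
  obtains a b e where "lval a u = 1" "lval a v = 0" "lval b u = 0" "lval b v = 1"
    "\<And>j. hvar j = hconst (u j) * linear_form a + hconst (v j) * linear_form b
       + hconst (e j) * linear_form (cross u v)"
    "\<And>i j. u j * a i + v j * b i + e j * cross u v i = (if i = j then 1 else 0)"
proof -
  from assms obtain k where k: "cross u v k \<noteq> 0" by auto
  define e where "e = (\<lambda>i. if i = k then 1 / cross u v k else 0)"
  have "(\<Sum>i\<in>UNIV. cross u v i * e i) = (\<Sum>i\<in>UNIV. if i = k then 1 else 0)"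
    by (rule sum.cong) (use k in \<open>auto simp: e_def\<close>)
  then have "lval (cross u v) e = 1" unfolding lval_def by simp
  then have e: "(u 1 * v 2 - u 2 * v 1) * e 0 + (u 2 * v 0 - u 0 * v 2) * e 1 + (u 0 * v 1 - u 1 * v 0) * e 2 = 1"
    unfolding lval_3 by simp
  define a where "a = cross v e"
  define b where "b = cross e u"
  have hv: "hvar j = hconst (u j) * linear_form a + hconst (v j) * linear_form b
       + hconst (e j) * linear_form (cross u v)"
    if "\<And>i. u j * a i + v j * b i + e j * cross u v i = (if i = j then 1 else 0)" for j
  proof -
    have "hconst (u j) * linear_form a + hconst (v j) * linear_form b
       + hconst (e j) * linear_form (cross u v) =
      (\<Sum>i\<in>UNIV. hconst (u j * a i + v j * b i + e j * cross u v i) * hvar i)"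
      unfolding linear_form_eq sum_distrib_left sum.distrib[symmetric]
      by (rule sum.cong) (simp_all add: hconst_add hconst_mult algebra_simps)
    also have "\<dots> = (\<Sum>i\<in>UNIV. if i = j then hvar i else 0)"
      unfolding that by (rule sum.cong) auto
    finally show ?thesis by simp
  qed
  have id: "\<forall>j. \<forall>i. u j * a i + v j * b i + e j * cross u v i = (if i = j then 1 else 0)"
    unfolding all_3 a_def b_def using e by (simp add: algebra_simps)
  show thesis
  proof (rule that)
    show "lval a u = 1" "lval a v = 0" "lval b u = 0" "lval b v = 1"
      unfolding lval_3 a_def b_def using e by (simp_all add: algebra_simps)
    show "u j * a i + v j * b i + e j * cross u v i = (if i = j then 1 else 0)" for i j
      using id by blast
    then show "hvar j = hconst (u j) * linear_form a + hconst (v j) * linear_form b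
       + hconst (e j) * linear_form (cross u v)" for j
      by (rule hv)
  qed
qed

text \<open>In the coordinates \<open>A\<close>, \<open>B\<close>, \<open>L\<close> a form is a
  binary form in \<open>A\<close> and \<open>B\<close> plus a multiple of \<open>L\<close>. This
  decomposition determines both kernel and image of the restriction to the line
  \<open>L = 0\<close>.\<close>

lemma hpoly_normal_form:
  fixes u v :: "3 \<Rightarrow> 'a::field" and A B L :: "'a hpoly"
  assumes hv: "\<And>j. hvar j = hconst (u j) * A + hconst (v j) * B + hconst (e j) * L"
    and A: "A \<in> hset 1" and B: "B \<in> hset 1" and p: "p \<in> hset (int n)"
  shows "\<exists>\<gamma> q. q \<in> hset (int n - 1) \<and> p = (\<Sum>i\<le>n. hconst (\<gamma> i) * A ^ (n - i) * B ^ i) + L * q"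
proof -
  define T where "T n = {p. \<exists>\<gamma> q. q \<in> hset (int n - 1) \<and>
    p = (\<Sum>i\<le>n. hconst (\<gamma> i) * A ^ (n - i) * B ^ i) + L * q}" for n
  have T_I: "p \<in> T n" if "q \<in> hset (int n - 1)"
    "p = (\<Sum>i\<le>n. hconst (\<gamma> i) * A ^ (n - i) * B ^ i) + L * q" for n p q and \<gamma> :: "nat \<Rightarrow> 'a"
    using that unfolding T_def by blast
  have T_add: "p + p' \<in> T n" if "p \<in> T n" "p' \<in> T n" for p p' n
  proof -
    from that obtain \<gamma> q \<gamma>' q' where *: "q \<in> hset (int n - 1)" "q' \<in> hset (int n - 1)"
      "p = (\<Sum>i\<le>n. hconst (\<gamma> i) * A ^ (n - i) * B ^ i) + L * q"
      "p' = (\<Sum>i\<le>n. hconst (\<gamma>' i) * A ^ (n - i) * B ^ i) + L * q'"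
      unfolding T_def by blast
    show ?thesis unfolding T_def
      by (rule CollectI, rule exI[of _ "\<lambda>i. \<gamma> i + \<gamma>' i"], rule exI[of _ "q + q'"])
         (simp add: * hset_add hconst_add algebra_simps sum.distrib)
  qed
  have T_const: "hconst c * p \<in> T n" if "p \<in> T n" for c p n
  proof -
    from that obtain \<gamma> q where *: "q \<in> hset (int n - 1)"
      "p = (\<Sum>i\<le>n. hconst (\<gamma> i) * A ^ (n - i) * B ^ i) + L * q"
      unfolding T_def by blast
    have "hconst c * p = (\<Sum>i\<le>n. hconst (c * \<gamma> i) * A ^ (n - i) * B ^ i) + L * (hconst c * q)"
      by (simp add: * hconst_mult algebra_simps sum_distrib_left)
    with hset_hconst_mult[OF *(1), of c] show ?thesis by (rule T_I)
  qed
  have T_A: "A * p \<in> T (Suc n)" if p: "p \<in> T n" for p n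
  proof -
    from p obtain \<gamma> q where *: "q \<in> hset (int n - 1)"
      "p = (\<Sum>i\<le>n. hconst (\<gamma> i) * A ^ (n - i) * B ^ i) + L * q"
      unfolding T_def by blast
    have "A * (\<Sum>i\<le>n. hconst (\<gamma> i) * A ^ (n - i) * B ^ i) =
      (\<Sum>i\<le>n. hconst (if i \<le> n then \<gamma> i else 0) * A ^ (Suc n - i) * B ^ i)"
      unfolding sum_distrib_left by (rule sum.cong) (auto simp: Suc_diff_le algebra_simps)
    then have "A * p = (\<Sum>i\<le>Suc n. hconst (if i \<le> n then \<gamma> i else 0) * A ^ (Suc n - i) * B ^ i)
        + L * (A * q)"
      unfolding *(2) distrib_left by (simp add: algebra_simps)
    moreover have "A * q \<in> hset (int (Suc n) - 1)"
      using hset_mult[OF A *(1)] by simp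
    ultimately show ?thesis by (intro T_I)
  qed
  have T_B: "B * p \<in> T (Suc n)" if p: "p \<in> T n" for p n
  proof -
    from p obtain \<gamma> q where *: "q \<in> hset (int n - 1)"
      "p = (\<Sum>i\<le>n. hconst (\<gamma> i) * A ^ (n - i) * B ^ i) + L * q"
      unfolding T_def by blast
    let ?\<gamma> = "\<lambda>i. case i of 0 \<Rightarrow> 0 | Suc j \<Rightarrow> \<gamma> j"
    have "(\<Sum>i\<le>Suc n. hconst (?\<gamma> i) * A ^ (Suc n - i) * B ^ i) = B * (\<Sum>i\<le>n. hconst (\<gamma> i) * A ^ (n - i) * B ^ i)"
      unfolding sum.atMost_Suc_shift sum_distrib_left by (simp add: algebra_simps)
    then have "B * p = (\<Sum>i\<le>Suc n. hconst (?\<gamma> i) * A ^ (Suc n - i) * B ^ i) + L * (B * q)"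
      unfolding *(2) distrib_left by (simp only: mult.left_commute[of B L])
    moreover have "B * q \<in> hset (int (Suc n) - 1)"
      using hset_mult[OF B *(1)] by simp
    ultimately show ?thesis by (intro T_I)
  qed
  have T_L: "L * p \<in> T (Suc n)" if "p \<in> hset (int n)" for p n
    unfolding T_def
    by (rule CollectI, rule exI[of _ "\<lambda>_. 0"], rule exI[of _ p]) (use that in simp)
  have "p \<in> T n" if "p \<in> hset (int n)" for n p
    using that
  proof (induction n arbitrary: p)
    case 0
    then obtain c where "p = hconst c" using hset_0_hconst[of p] by auto
    then show ?case unfolding T_def
      by (intro CollectI exI[of _ "\<lambda>_. c"] exI[of _ 0]) simp
  next
    case (Suc n)
    have "int (Suc n) \<ge> 1" by simp
    with Suc.prems obtain q where q: "\<And>i. q i \<in> hset (int (Suc n) - 1)"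
      "p = (\<Sum>i\<in>UNIV. hvar i * q i)" using hset_hvar_expansion[of p "int (Suc n)"] by metis
    have q': "q i \<in> hset (int n)" for i using q(1)[of i] by simp
    have "hvar i * q i \<in> T (Suc n)" for i
    proof -
      have "q i \<in> T n" using Suc.IH[OF q'] .
      then have "hconst (u i) * (A * q i) + hconst (v i) * (B * q i) + hconst (e i) * (L * q i) \<in> T (Suc n)"
        using q' by (intro T_add T_const T_A T_B T_L)
      then show ?thesis by (subst hv) (simp add: algebra_simps)
    qed
    then show ?case unfolding q(2) sum_3 by (intro T_add)
  qed
  from this[OF p] show ?thesis unfolding T_def by blast
qed

lemma sum_monom_eq:
  "(\<Sum>i\<le>n. [:\<gamma> i:] * [:0, 1:] ^ i) = (\<Sum>i\<le>n. monom (\<gamma> i) i)"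
  for \<gamma> :: "nat \<Rightarrow> 'a::field"
  by (rule sum.cong) (simp_all add: monom_altdef)

lemma coeff_sum_monom: "coeff (\<Sum>i\<le>n. monom (\<gamma> i) i) j = (if j \<le> n then \<gamma> j else 0)"
  by (simp add: coeff_sum)

text \<open>On \<open>u + z v\<close> the forms of the dual basis become \<open>1\<close>,
  \<open>z\<close> and \<open>0\<close>, so the binary part of the normal form restricts to the
  polynomial with the same coefficients.\<close>

lemma peval_kernel:
  fixes u v :: "3 \<Rightarrow> 'a::field"
  assumes uv: "cross u v \<noteq> (\<lambda>_. 0)" and p: "p \<in> hset n" and 0: "peval u v p = 0"
  obtains q where "q \<in> hset (n - 1)" "p = linear_form (cross u v) * q"
proof (cases "n < 0")
  case True
  with p that[of 0] show thesis by (simp add: hset_neg)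
next
  case False
  obtain a b e where ab: "lval a u = 1" "lval a v = 0" "lval b u = 0" "lval b v = 1"
    and hv: "\<And>j. hvar j = hconst (u j) * linear_form a + hconst (v j) * linear_form b
       + hconst (e j) * linear_form (cross u v)"
    using dual_basis[OF uv] by metis
  define m where "m = nat n"
  have n: "n = int m" using False m_def by simp
  obtain \<gamma> q where q: "q \<in> hset (int m - 1)" and
    pq: "p = (\<Sum>i\<le>m. hconst (\<gamma> i) * linear_form a ^ (m - i) * linear_form b ^ i) + linear_form (cross u v) * q"
    using hpoly_normal_form[OF hv _ _ p[unfolded n]] by auto
  have "0 = (\<Sum>i\<le>m. [:\<gamma> i:] * [:0, 1:] ^ i)"
    using 0 unfolding pq peval_add peval_sum peval_mult peval_power peval_linear_form peval_hconst
      ab lval_cross by (simp add: one_pCons[symmetric])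
  then have "(\<Sum>i\<le>m. monom (\<gamma> i) i) = 0" unfolding sum_monom_eq by simp
  then have "\<gamma> i = 0" if "i \<le> m" for i
    using coeff_sum_monom[of \<gamma> m i] that by simp
  then have "p = linear_form (cross u v) * q" unfolding pq by simp
  with q n that show thesis by blast
qed

lemma peval_surj:
  fixes u v :: "3 \<Rightarrow> 'a::field"
  assumes uv: "cross u v \<noteq> (\<lambda>_. 0)" and r: "r \<in> pset n"
  obtains p where "p \<in> hset n" "peval u v p = r"
proof (cases "n < 0")
  case True
  with r have "r = 0" by (auto simp: pset_def poly_eq_iff)
  with that[of 0] show thesis by simp
next
  case False
  obtain a b where ab: "lval a u = 1" "lval a v = 0" "lval b u = 0" "lval b v = 1"
    using dual_basis[OF uv] by metis
  define m where "m = nat n"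
  have n: "n = int m" using False m_def by simp
  \<comment> \<open>The homogenization of \<open>r\<close> in the coordinates that restrict to
    \<open>1\<close> and \<open>z\<close>.\<close>
  define p where "p = (\<Sum>i\<le>m. hconst (coeff r i) * (linear_form a ^ (m - i) * linear_form b ^ i))"
  show thesis
  proof (rule that)
    have "linear_form a ^ (m - i) * linear_form b ^ i \<in> hset n" if "i \<le> m" for i
      by (rule hset_mult'[OF hset_power hset_power]) (use that n in auto)
    then show "p \<in> hset n" unfolding p_def by (auto intro!: hset_sum hset_hconst_mult)
    have "peval u v p = (\<Sum>i\<le>m. [:coeff r i:] * [:0, 1:] ^ i)"
      unfolding p_def peval_sum peval_mult peval_power peval_linear_form peval_hconst ab
      by (simp add: one_pCons[symmetric])
    also have "\<dots> = r"
      unfolding sum_monom_eq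
      by (rule poly_eqI) (use r n in \<open>auto simp: coeff_sum_monom pset_def\<close>)
    finally show "peval u v p = r" .
  qed
qed

lemma linear_form_dvd_iff_peval:
  fixes u v :: "3 \<Rightarrow> 'a::field"
  assumes "cross u v \<noteq> (\<lambda>_. 0)" "p \<in> hset n"
  shows "linear_form (cross u v) dvd p \<longleftrightarrow> peval u v p = 0"
proof
  assume "peval u v p = 0"
  with peval_kernel[OF assms] show "linear_form (cross u v) dvd p" by (metis dvd_triv_left)
next
  assume "linear_form (cross u v) dvd p"
  then show "peval u v p = 0" by (elim dvdE) (simp add: peval_mult)
qed

text \<open>Two points spanning the line of \<open>a\<close>, solved for by dividing by a nonzero
  coordinate of \<open>a\<close>. It makes restriction available for every line.\<close>

lemma exists_cross_eq:
  fixes a :: "3 \<Rightarrow> 'a::field"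
  assumes "a \<noteq> (\<lambda>_. 0)"
  obtains u v where "cross u v = a"
proof -
  let ?f = "\<lambda>x y z i. if i = (0::3) then x else if i = 1 then y else (z :: 'a)"
  have eq: "c = a" if "c 0 = a 0" "c 1 = a 1" "c 2 = a 2" for c
    using that all_3[of "\<lambda>i. c i = a i"] by auto
  have "\<exists>i. a i \<noteq> 0" using assms by auto
  then have "a 0 \<noteq> 0 \<or> a 1 \<noteq> 0 \<or> a 2 \<noteq> 0" using all_3[of "\<lambda>i. a i = 0"] by auto
  then consider "a 0 \<noteq> 0" | "a 1 \<noteq> 0" | "a 2 \<noteq> 0" by blast
  then show thesis
  proof cases
    case 1
    show ?thesis
      by (rule that[of "?f (- a 1 / a 0) 1 0" "?f (- a 2) 0 (a 0)"], rule eq) (use 1 in simp_all)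
  next
    case 2
    show ?thesis
      by (rule that[of "?f 0 (- a 2 / a 1) 1" "?f (a 1) (- a 0) 0"], rule eq) (use 2 in simp_all)
  next
    case 3
    show ?thesis
      by (rule that[of "?f 1 0 (- a 0 / a 2)" "?f 0 (a 2) (- a 1)"], rule eq) (use 3 in simp_all)
  qed
qed

text \<open>Divisibility by a linear form is vanishing of the restriction to its line, and
  restrictions multiply in the domain \<open>'a poly\<close>.\<close>

lemma linear_form_prime:
  fixes a :: "3 \<Rightarrow> 'a::field"
  assumes "a \<noteq> (\<lambda>_. 0)" "p \<in> hset m" "q \<in> hset n" "linear_form a dvd p * q"
  shows "linear_form a dvd p \<or> linear_form a dvd q"
proof -
  obtain u v where uv: "cross u v = a" using exists_cross_eq[OF assms(1)] .
  have "cross u v \<noteq> (\<lambda>_. 0)" using assms(1) uv by simp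
  note * = linear_form_dvd_iff_peval[OF this, unfolded uv]
  show ?thesis
    using assms(4) unfolding *[OF hset_mult[OF assms(2,3)]] *[OF assms(2)] *[OF assms(3)] peval_mult
    by simp
qed

lemma linear_form_dvd_hset:
  fixes a :: "3 \<Rightarrow> 'a::field"
  assumes "a \<noteq> (\<lambda>_. 0)" "p \<in> hset n" "linear_form a dvd p"
  obtains q where "q \<in> hset (n - 1)" "p = linear_form a * q"
proof -
  from assms(3) obtain q where q: "p = linear_form a * q" by blast
  have "q \<in> hset (n - 1)"
    by (rule hset_cancel[OF linear_form_in_hset[of a]])
       (use assms q in \<open>auto simp: linear_form_eq_0_iff mult.commute\<close>)
  with q that show thesis by blast
qed

lemma linear_form_dvd_linear_form:
  fixes a b :: "3 \<Rightarrow> 'a::field"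
  assumes "a \<noteq> (\<lambda>_. 0)" "linear_form a dvd linear_form b"
  obtains c where "b = (\<lambda>i. c * a i)"
proof -
  obtain q where q: "q \<in> hset 0" "linear_form b = linear_form a * q"
    using linear_form_dvd_hset[OF assms(1) linear_form_in_hset assms(2)] by auto
  from q(1) obtain c where "q = hconst c" by (rule hset_0_hconst)
  then have "linear_form b = linear_form (\<lambda>i. c * a i)"
    using q(2) by (simp add: linear_form_scale mult.commute)
  then have "b i = c * a i" for i
    using linear_form_hvar_lookup[of b i] linear_form_hvar_lookup[of "\<lambda>i. c * a i" i] by simp
  with that show thesis by blast
qed

lemma linear_form_not_dvd_prod:
  fixes a :: "3 \<Rightarrow> 'a::field"
  assumes "a \<noteq> (\<lambda>_. 0)" "finite A" "\<And>i. i \<in> A \<Longrightarrow> \<not> linear_form a dvd linear_form (b i)"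
  shows "\<not> linear_form a dvd (\<Prod>i\<in>A. linear_form (b i))"
  using assms(2,3)
proof (induction A rule: finite_induct)
  case empty
  show ?case
  proof
    assume "linear_form a dvd (\<Prod>i\<in>{}. linear_form (b i))"
    then have "linear_form a dvd 1" by simp
    from linear_form_dvd_hset[OF assms(1) one_in_hset this]
    obtain q where "q \<in> hset (0 - 1)" "1 = linear_form a * q" .
    then show False by (simp add: hset_neg)
  qed
next
  case (insert x A)
  have "(\<Prod>i\<in>A. linear_form (b i)) \<in> hset (int (card A))"
    by (rule hset_prod) (use insert in auto)
  with insert linear_form_prime[OF assms(1) linear_form_in_hset this] show ?case by auto
qed

lemma prod_linear_forms_dvd:
  fixes a :: "'i \<Rightarrow> 3 \<Rightarrow> 'a::field"
  assumes "finite A" "\<And>i. i \<in> A \<Longrightarrow> a i \<noteq> (\<lambda>_. 0)"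
    and "\<And>i j. i \<in> A \<Longrightarrow> j \<in> A \<Longrightarrow> i \<noteq> j \<Longrightarrow> \<not> linear_form (a i) dvd linear_form (a j)"
    and "p \<in> hset n" "\<And>i. i \<in> A \<Longrightarrow> linear_form (a i) dvd p"
  obtains q where "q \<in> hset (n - int (card A))" "p = (\<Prod>i\<in>A. linear_form (a i)) * q"
proof -
  have "\<exists>q. q \<in> hset (n - int (card A)) \<and> p = (\<Prod>i\<in>A. linear_form (a i)) * q"
    using assms(1,2,3,5)
  proof (induction A rule: finite_induct)
    case empty
    show ?case using assms(4) by auto
  next
    case (insert x A)
    then obtain q where q: "q \<in> hset (n - int (card A))" "p = (\<Prod>i\<in>A. linear_form (a i)) * q"
      by blast
    have P: "(\<Prod>i\<in>A. linear_form (a i)) \<in> hset (int (card A))"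
      by (rule hset_prod) (use insert in auto)
    have "\<not> linear_form (a x) dvd (\<Prod>i\<in>A. linear_form (a i))"
      by (rule linear_form_not_dvd_prod) (use insert in auto)
    moreover have "linear_form (a x) dvd (\<Prod>i\<in>A. linear_form (a i)) * q"
      using insert.prems(3)[of x] q(2) by simp
    ultimately have "linear_form (a x) dvd q"
      using linear_form_prime[OF _ P q(1)] insert.prems(1) by blast
    then obtain q' where q': "q' \<in> hset (n - int (card A) - 1)" "q = linear_form (a x) * q'"
      using linear_form_dvd_hset[OF _ q(1)] insert.prems(1) by blast
    have "q' \<in> hset (n - int (card (insert x A)))" using q'(1) insert(1,2) by (simp add: algebra_simps)
    moreover have "p = (\<Prod>i\<in>insert x A. linear_form (a i)) * q'"
      using insert(1,2) q(2) q'(2) by (simp add: algebra_simps)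
    ultimately show ?case by blast
  qed
  with that show thesis by blast
qed

section \<open>Hilbert functions\<close>

lemma subspace_hset: "module.subspace hscale (hset n)"
  unfolding subspace_hscale by (auto intro: hset_add hset_hconst_mult)

lemma subspace_map_peval: "module.subspace hscale V \<Longrightarrow> subspace_map hscale smult V (peval u v)"
  unfolding subspace_map_def subspace_map_axioms_def
  by (simp add: vector_space_hscale vector_space_smult peval_add peval_mult hscale_def)

lemma subspace_map_mult: "module.subspace hscale V \<Longrightarrow> subspace_map hscale hscale V (\<lambda>p. q * p)"
  unfolding subspace_map_def subspace_map_axioms_def
  by (simp add: vector_space_hscale hscale_def algebra_simps)

definition hil :: "int \<Rightarrow> nat" where
  "hil t = (if t < 0 then 0 else nat ((t + 1) * (t + 2) div 2))"

lemma hil_rec: "t \<ge> 0 \<Longrightarrow> hil t = hil (t - 1) + nat (t + 1)"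
proof -
  assume t: "t \<ge> 0"
  have "(t + 1) * (t + 2) = t * (t + 1) + (t + 1) * 2" by (simp add: algebra_simps)
  then have "(t + 1) * (t + 2) div 2 = t * (t + 1) div 2 + (t + 1)" by simp
  with t show ?thesis by (cases "t = 0") (auto simp: hil_def nat_add_distrib algebra_simps)
qed

text \<open>The polynomial has its roots at -1 and -2, where there are no forms either; hence the
  bound.\<close>

lemma hil_of_nat: "t \<ge> -2 \<Longrightarrow> 2 * int (hil t) = (t + 1) * (t + 2)"
proof -
  assume "t \<ge> -2"
  moreover have "even ((t + 1) * (t + 2))" by simp
  ultimately show ?thesis
    by (cases "t = -1 \<or> t = -2") (auto simp: hil_def)
qed

lemma hset_kernel_peval:
  fixes u v :: "3 \<Rightarrow> 'a::field"
  assumes "cross u v \<noteq> (\<lambda>_. 0)"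
  shows "{p \<in> hset n. peval u v p = 0} = (\<lambda>q. linear_form (cross u v) * q) ` hset (n - 1)"
proof (intro equalityI subsetI)
  fix p assume "p \<in> {p \<in> hset n. peval u v p = 0}"
  then have "p \<in> hset n" "peval u v p = 0" by auto
  from peval_kernel[OF assms this] obtain q where "q \<in> hset (n - 1)" "p = linear_form (cross u v) * q" .
  then show "p \<in> (\<lambda>q. linear_form (cross u v) * q) ` hset (n - 1)" by blast
next
  fix p assume "p \<in> (\<lambda>q. linear_form (cross u v) * q) ` hset (n - 1)"
  then obtain q where q: "q \<in> hset (n - 1)" "p = linear_form (cross u v) * q" by blast
  have "p \<in> hset (1 + (n - 1))" unfolding q(2) by (rule hset_mult) (simp_all add: q(1))
  with q(2) show "p \<in> {p \<in> hset n. peval u v p = 0}" by (simp add: peval_mult)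
qed

text \<open>Multiplication by the form of one line, followed by restriction to that line, is exact;
  degree \<open>t\<close> therefore adds the \<open>t + 1\<close> monomials in
  \<open>z\<close>.\<close>

lemma vdim_hset: "vdim hscale (hset t :: 'a::field hpoly set) (hil t)"
proof -
  define u v :: "3 \<Rightarrow> 'a" where "u = (\<lambda>i. if i = 0 then 1 else 0)" and "v = (\<lambda>i. if i = 1 then 1 else 0)"
  have "cross u v 2 = 1" by (simp add: u_def v_def)
  then have uv: "cross u v \<noteq> (\<lambda>_. 0)" by (metis zero_neq_one)
  \<comment> \<open>The shift starts the induction in degree -1, where the space is zero.\<close>
  have "vdim hscale (hset (int n - 1) :: 'a hpoly set) (hil (int n - 1))" for n
  proof (induction n)
    case 0
    show ?case using vdim_trivial[OF vector_space_hscale] by (simp add: hil_def hset_neg)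
  next
    case (Suc n)
    let ?t = "int n"
    interpret m: subspace_map hscale hscale "hset (?t - 1) :: 'a hpoly set" "\<lambda>q. linear_form (cross u v) * q"
      by (rule subspace_map_mult[OF subspace_hset])
    have 1: "vdim hscale {p \<in> hset ?t. peval u v p = 0} (hil (?t - 1))"
      unfolding hset_kernel_peval[OF uv]
      by (rule m.vdim_image[OF Suc.IH]) (use uv in \<open>simp add: linear_form_eq_0_iff\<close>)
    have im: "peval u v ` hset ?t = pset ?t"
    proof
      show "peval u v ` hset ?t \<subseteq> pset ?t" by (rule image_subsetI) (rule peval_in_pset)
      show "pset ?t \<subseteq> peval u v ` hset ?t"
        using peval_surj[OF uv] by (metis image_eqI subsetI)
    qed
    interpret p: subspace_map hscale smult "hset ?t" "peval u v"
      by (rule subspace_map_peval[OF subspace_hset])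
    have "vdim hscale (hset ?t :: 'a hpoly set) (hil (?t - 1) + nat (?t + 1))"
      by (rule p.vdim_exact[OF 1]) (simp only: im vdim_pset)
    then show ?case using hil_rec[of ?t] by simp
  qed
  from this[of "nat (t + 1)"] show ?thesis
    using vdim_trivial[OF vector_space_hscale]
    by (cases "t < 0") (auto simp: hil_def hset_neg)
qed

lemma vdim_product:
  fixes W :: "nat \<Rightarrow> 'a::field hpoly set"
  assumes "\<And>j. j < l \<Longrightarrow> vdim hscale (W j) (d j)" "\<And>j. j < l \<Longrightarrow> module.subspace hscale (W j)"
  shows "vdim fscale {s. (\<forall>j<l. s j \<in> W j) \<and> (\<forall>j\<ge>l. s j = 0)} (\<Sum>j<l. d j)"
  using assms
proof (induction l)
  case 0
  have "{s :: nat \<Rightarrow> 'a hpoly. (\<forall>j<0. s j \<in> W j) \<and> (\<forall>j\<ge>0. s j = 0)} = {0}"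
    by (auto simp: fun_eq_iff)
  then show ?case using vdim_trivial[OF vector_space_fscale] by simp
next
  case (Suc l)
  let ?V = "\<lambda>l. {s :: nat \<Rightarrow> 'a hpoly. (\<forall>j<l. s j \<in> W j) \<and> (\<forall>j\<ge>l. s j = 0)}"
  have W: "0 \<in> W j" "\<And>x y. x \<in> W j \<Longrightarrow> y \<in> W j \<Longrightarrow> x + y \<in> W j"
    "\<And>x c. x \<in> W j \<Longrightarrow> hconst c * x \<in> W j" if "j < Suc l" for j
    using Suc.prems(2)[OF that] unfolding subspace_hscale by auto
  have sub: "module.subspace fscale (?V (Suc l))"
    unfolding subspace_fscale using W by auto
  interpret subspace_map fscale hscale "?V (Suc l)" "\<lambda>s. s l"
    unfolding subspace_map_def subspace_map_axioms_def
    using sub by (simp add: vector_space_fscale vector_space_hscale fscale_def hscale_def)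
  have "{s \<in> ?V (Suc l). s l = 0} = ?V l"
    using W(1)[of l] by (auto simp: less_Suc_eq) (metis Suc_leI le_neq_implies_less)
  then have 1: "vdim fscale {s \<in> ?V (Suc l). s l = 0} (\<Sum>j<l. d j)"
    using Suc.IH Suc.prems by simp
  have "w \<in> (\<lambda>s. s l) ` ?V (Suc l)" if "w \<in> W l" for w
    by (rule image_eqI[of _ _ "\<lambda>j. if j = l then w else 0"]) (use that W(1) in auto)
  then have "(\<lambda>s. s l) ` ?V (Suc l) = W l" by auto
  then have 2: "vdim hscale ((\<lambda>s. s l) ` ?V (Suc l)) (d l)" using Suc.prems(1) by simp
  show ?case using vdim_exact[OF 1 2] by simp
qed

section \<open>Interpolation on lines not through a point\<close>

lemma hset_1_linear_form:
  fixes p :: "'a::field hpoly"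
  assumes "p \<in> hset 1"
  obtains a where "p = linear_form a"
proof -
  obtain q where q: "\<And>i. q i \<in> hset (1 - 1)" "p = (\<Sum>i\<in>UNIV. hvar i * q i)"
    using hset_hvar_expansion[OF assms] by auto
  have "\<forall>i. \<exists>c. q i = hconst c" using q(1) hset_0_hconst by (metis diff_self)
  then obtain c where "\<And>i. q i = hconst (c i)" by metis
  then have "p = linear_form c" unfolding q(2) linear_form_eq by (simp add: mult.commute)
  with that show thesis by blast
qed

lemma linear_poly_dvd_iff:
  fixes a b :: "'a::field"
  assumes "b \<noteq> 0"
  shows "[:a, b:] dvd p \<longleftrightarrow> poly p (- a / b) = 0"
proof -
  have "[:a, b:] = smult b [:- (- a / b), 1:]" using assms by simp
  then show ?thesis using assms by (simp only: smult_dvd_iff poly_eq_0_iff_dvd) simp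
qed

text \<open>The determinant condition says that the roots \<open>- a i / b i\<close> are
  distinct.\<close>

lemma prod_linear_poly_dvd:
  fixes a b :: "'i \<Rightarrow> 'a::field"
  assumes "finite A" "\<And>i. i \<in> A \<Longrightarrow> b i \<noteq> 0"
    "\<And>i j. i \<in> A \<Longrightarrow> j \<in> A \<Longrightarrow> i \<noteq> j \<Longrightarrow> a i * b j \<noteq> a j * b i"
    "\<And>i. i \<in> A \<Longrightarrow> [:a i, b i:] dvd p"
  shows "(\<Prod>i\<in>A. [:a i, b i:]) dvd p"
  using assms
proof (induction A rule: finite_induct)
  case (insert x A)
  then have "(\<Prod>i\<in>A. [:a i, b i:]) dvd p" by blast
  then obtain q where q: "p = (\<Prod>i\<in>A. [:a i, b i:]) * q" by blast
  let ?x = "- a x / b x"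
  have bx: "b x \<noteq> 0" using insert by blast
  have "poly p ?x = 0" using insert.prems(3)[of x] linear_poly_dvd_iff[OF bx] by blast
  moreover have "poly (\<Prod>i\<in>A. [:a i, b i:]) ?x \<noteq> 0"
    unfolding poly_prod
  proof (subst prod_zero_iff[OF insert(1)], rule notI)
    assume "\<exists>i\<in>A. poly [:a i, b i:] ?x = 0"
    then obtain i where i: "i \<in> A" "poly [:a i, b i:] ?x = 0" by blast
    then have "a i * b x = a x * b i" using bx by (simp add: field_simps)
    moreover have "i \<noteq> x" using i insert(2) by blast
    ultimately show False using insert.prems(2)[of i x] i by blast
  qed
  ultimately have "poly q ?x = 0" unfolding q by simp
  then have "[:a x, b x:] dvd q" using linear_poly_dvd_iff[OF bx] by blast
  then show ?case unfolding q prod.insert[OF insert(1,2)] mult.commute[of _ q] by (rule mult_dvd_mono) simp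
qed simp

lemma degree_prod_linear_poly:
  fixes a b :: "'i \<Rightarrow> 'a::field"
  assumes "\<And>i. i \<in> A \<Longrightarrow> b i \<noteq> 0"
  shows "degree (\<Prod>i\<in>A. [:a i, b i:]) = card A" "(\<Prod>i\<in>A. [:a i, b i:]) \<noteq> 0"
proof -
  have "degree (\<Prod>i\<in>A. [:a i, b i:]) = (\<Sum>i\<in>A. degree [:a i, b i:])"
    by (rule degree_prod_sum_eq) (use assms in auto)
  also have "\<dots> = (\<Sum>i\<in>A. 1)" by (rule sum.cong) (use assms in auto)
  finally show "degree (\<Prod>i\<in>A. [:a i, b i:]) = card A" by simp
  show "(\<Prod>i\<in>A. [:a i, b i:]) \<noteq> 0"
    using assms by (cases "finite A") auto
qed

lemma pset_mult_cancel:
  fixes p q :: "'a::field poly"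
  assumes "p \<noteq> 0" "p * q \<in> pset n"
  shows "q \<in> pset (n - int (degree p))"
proof (cases "q = 0")
  case False
  then have "coeff (p * q) (degree p + degree q) \<noteq> 0"
    using assms(1) by (simp add: coeff_mult_degree_sum)
  then have "int (degree p + degree q) \<le> n"
    using assms(2) unfolding pset_def by (metis (mono_tags) mem_Collect_eq not_le)
  then show ?thesis unfolding pset_def by (auto intro!: coeff_eq_0)
qed (simp add: pset_def)

text \<open>
  \<open>S\<close> indexes the lines that avoid the point \<open>v\<close>, and \<open>u + z v\<close> runs through a general line \<open>L\<close>
  containing \<open>v\<close>. A pair with \<open>lift t w b\<close> is a logarithmic field of degree \<open>t + d\<close> modulo the Euler field.
\<close>

locale interpolation =
  fixes \<alpha> :: "'i \<Rightarrow> 3 \<Rightarrow> 'a::field" and S :: "'i set" and F :: "'a hpoly" and c :: "'i \<Rightarrow> 'a"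
    and d :: nat and u v :: "3 \<Rightarrow> 'a"
  assumes fin: "finite S"
    and F: "F \<in> hset (int d)"
    and off: "\<And>i. i \<in> S \<Longrightarrow> lval (\<alpha> i) v \<noteq> 0"
    and generic: "\<And>i j. i \<in> S \<Longrightarrow> j \<in> S \<Longrightarrow> i \<noteq> j \<Longrightarrow>
      lval (\<alpha> i) u * lval (\<alpha> j) v \<noteq> lval (\<alpha> j) u * lval (\<alpha> i) v"
    and uv: "cross u v \<noteq> (\<lambda>_. 0)"
begin

abbreviation A :: "'i \<Rightarrow> 'a hpoly" where "A i \<equiv> linear_form (\<alpha> i)"
abbreviation L :: "'a hpoly" where "L \<equiv> linear_form (cross u v)"
abbreviation \<pi> :: "'a hpoly \<Rightarrow> 'a poly" where "\<pi> \<equiv> peval u v"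

definition g :: "'a hpoly" where "g = (\<Prod>i\<in>S. A i)"
definition M :: int where "M = int (card S)"

text \<open>The congruence modulo \<open>A i\<close> expresses tangency of a field to that line: its
  component along \<open>v\<close> must be the prescribed multiple of its component
  \<open>F * w\<close> in the other direction.\<close>

definition lift :: "int \<Rightarrow> 'a hpoly \<Rightarrow> 'a hpoly \<Rightarrow> bool" where
  "lift t w b \<longleftrightarrow> w \<in> hset t \<and> b \<in> hset (t + int d) \<and> (\<forall>i\<in>S. A i dvd b - hconst (c i) * F * w)"

definition I :: "int \<Rightarrow> 'a hpoly set" where
  "I t = {w. \<exists>b. lift t w b}"

lemma IE: "w \<in> I t \<Longrightarrow> (\<And>b. lift t w b \<Longrightarrow> P) \<Longrightarrow> P"
  unfolding I_def by blast

lemma liftD: "lift t w b \<Longrightarrow> w \<in> hset t" "lift t w b \<Longrightarrow> b \<in> hset (t + int d)"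
    "lift t w b \<Longrightarrow> i \<in> S \<Longrightarrow> A i dvd b - hconst (c i) * F * w"
  unfolding lift_def by blast+

lemma liftI_I: "lift t w b \<Longrightarrow> w \<in> I t"
  unfolding I_def by blast

lemma A_nonzero: "i \<in> S \<Longrightarrow> \<alpha> i \<noteq> (\<lambda>_. 0)"
  using off[of i] unfolding lval_3 by auto

lemma A_not_dvd: "i \<in> S \<Longrightarrow> j \<in> S \<Longrightarrow> i \<noteq> j \<Longrightarrow> \<not> A i dvd A j"
proof
  assume ij: "i \<in> S" "j \<in> S" "i \<noteq> j" "A i dvd A j"
  then obtain e where "\<alpha> j = (\<lambda>k. e * \<alpha> i k)"
    using linear_form_dvd_linear_form[OF A_nonzero[OF ij(1)]] by blast
  then have "lval (\<alpha> j) w = e * lval (\<alpha> i) w" for w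
    unfolding lval_3 by (simp add: algebra_simps)
  then show False using generic[OF ij(1-3)] by (simp add: algebra_simps)
qed

lemma A_not_dvd_L: "i \<in> S \<Longrightarrow> \<not> A i dvd L"
proof
  assume i: "i \<in> S" "A i dvd L"
  then obtain e where e: "cross u v = (\<lambda>k. e * \<alpha> i k)"
    using linear_form_dvd_linear_form[OF A_nonzero[OF i(1)]] by blast
  then have "lval (cross u v) v = e * lval (\<alpha> i) v"
    unfolding lval_3 by (simp add: algebra_simps)
  then have "e = 0" using off[OF i(1)] by simp
  with e uv show False by simp
qed

lemma L_nonzero [simp]: "L \<noteq> 0"
  using uv by (simp add: linear_form_eq_0_iff)

lemma \<pi>_A: "\<pi> (A i) = [:lval (\<alpha> i) u, lval (\<alpha> i) v:]" by simp

lemma \<pi>_L [simp]: "\<pi> L = 0" by simp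

lemma A_prime: "i \<in> S \<Longrightarrow> p \<in> hset m \<Longrightarrow> q \<in> hset n \<Longrightarrow> A i dvd p * q \<Longrightarrow> A i dvd p \<or> A i dvd q"
  using linear_form_prime[OF A_nonzero] by blast

lemma \<pi>_A_not_dvd_one: "i \<in> S \<Longrightarrow> \<not> \<pi> (A i) dvd 1"
  using off[of i] unfolding \<pi>_A by (simp add: is_unit_iff_degree)

lemma \<pi>_g: "\<pi> g = (\<Prod>i\<in>S. [:lval (\<alpha> i) u, lval (\<alpha> i) v:])"
  unfolding g_def peval_prod by simp

lemma g_hset: "g \<in> hset M"
  unfolding g_def M_def by (rule hset_prod[OF fin]) simp

lemma degree_\<pi>_g: "degree (\<pi> g) = card S" and \<pi>_g_nonzero: "\<pi> g \<noteq> 0"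
  unfolding \<pi>_g by (rule degree_prod_linear_poly, erule off)+

lemma g_nonzero [simp]: "g \<noteq> 0"
  using \<pi>_g_nonzero by auto

lemma dvd_g:
  assumes "p \<in> hset n" "\<And>i. i \<in> S \<Longrightarrow> A i dvd p"
  obtains q where "q \<in> hset (n - M)" "p = g * q"
proof (rule prod_linear_forms_dvd[where a = \<alpha>, OF fin A_nonzero A_not_dvd assms])
  fix q assume "q \<in> hset (n - int (card S))" "p = prod A S * q"
  then show thesis using that unfolding g_def M_def by blast
qed

lemma kernel_L:
  assumes "p \<in> hset n" "\<pi> p = 0"
  obtains q where "q \<in> hset (n - 1)" "p = L * q"
  using peval_kernel[OF uv assms] by blast

lemma lift_add: "lift t w b \<Longrightarrow> lift t w' b' \<Longrightarrow> lift t (w + w') (b + b')"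
proof -
  assume *: "lift t w b" "lift t w' b'"
  have "A i dvd (b + b') - hconst (c i) * F * (w + w')" if "i \<in> S" for i
    using dvd_add[OF liftD(3)[OF *(1) that] liftD(3)[OF *(2) that]] by (simp add: algebra_simps)
  with * show ?thesis unfolding lift_def by (simp add: hset_add)
qed

lemma lift_mult: "lift t w b \<Longrightarrow> q \<in> hset s \<Longrightarrow> lift (s + t) (q * w) (q * b)"
proof -
  assume *: "lift t w b" "q \<in> hset s"
  have "A i dvd q * b - hconst (c i) * F * (q * w)" if "i \<in> S" for i
    using dvd_mult[OF liftD(3)[OF *(1) that], of q] by (simp add: algebra_simps)
  then show ?thesis unfolding lift_def
    using hset_mult[OF *(2) liftD(1)[OF *(1)]] hset_mult[OF *(2) liftD(2)[OF *(1)]]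
    by (simp add: add.assoc)
qed

lemma lift_mult_1: "lift t w b \<Longrightarrow> q \<in> hset 1 \<Longrightarrow> lift (t + 1) (q * w) (q * b)"
  using lift_mult[of t w b q 1] by (simp add: add.commute)

lemma lift_hconst: "lift t w b \<Longrightarrow> lift t (hconst e * w) (hconst e * b)"
  using lift_mult[of t w b "hconst e" 0] by simp

lemma lift_diff: "lift t w b \<Longrightarrow> lift t w' b' \<Longrightarrow> lift t (w - w') (b - b')"
  using lift_add[OF _ lift_hconst[of t w' b' "- 1"], of w b] by (simp add: hconst_uminus)

lemma lift_zero [simp]: "lift t 0 0"
  unfolding lift_def by simp

lemma lift_sum: "(\<And>j. j \<in> J \<Longrightarrow> lift t (w j) (b j)) \<Longrightarrow> lift t (sum w J) (sum b J)"
  by (induction J rule: infinite_finite_induct) (auto intro: lift_add)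

text \<open>\<open>L\<close> is a nonzerodivisor modulo \<open>I\<close>, because the lines stay distinct modulo \<open>L\<close>.\<close>

lemma lift_cancel_L:
  assumes "lift (t + 1) (L * w) b" "w \<in> hset t"
  shows "\<exists>b'. lift t w b'"
proof -
  have b: "b \<in> hset (t + 1 + int d)" using liftD(2)[OF assms(1)] .
  have dvd: "\<pi> (A i) dvd \<pi> b" if "i \<in> S" for i
  proof -
    from liftD(3)[OF assms(1) that] obtain q where "b - hconst (c i) * F * (L * w) = A i * q" by blast
    then have "\<pi> (b - hconst (c i) * F * (L * w)) = \<pi> (A i * q)" by simp
    then have "\<pi> b = \<pi> (A i) * \<pi> q" unfolding peval_diff peval_mult \<pi>_L by simp
    then show ?thesis by (rule dvdI)
  qed
  have "\<pi> g dvd \<pi> b"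
    unfolding \<pi>_g by (rule prod_linear_poly_dvd[OF fin off generic]) (use dvd in auto)
  then obtain r where r: "\<pi> b = \<pi> g * r" by blast
  note deg = degree_\<pi>_g \<pi>_g_nonzero
  have "r \<in> pset (t + 1 + int d - M)"
    using pset_mult_cancel[OF deg(2), of r "t + 1 + int d"] peval_in_pset[OF b, of u v] unfolding r deg M_def by simp
  then obtain q where q: "q \<in> hset (t + 1 + int d - M)" "\<pi> q = r"
    using peval_surj[OF uv] by blast
  have gq: "g * q \<in> hset (t + 1 + int d)"
    by (rule hset_mult'[OF g_hset q(1)]) simp
  have "\<pi> (b - g * q) = 0" unfolding peval_diff peval_mult r q(2) by simp
  then obtain b' where b': "b' \<in> hset (t + 1 + int d - 1)" "b - g * q = L * b'"
    using kernel_L[OF hset_diff[OF b gq]] by blast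
  have b'': "b' \<in> hset (t + int d)" using b'(1) by simp
  have "A i dvd b' - hconst (c i) * F * w" if i: "i \<in> S" for i
  proof -
    have "A i dvd g" unfolding g_def using fin i by (rule dvd_prodI)
    then have "A i dvd b - hconst (c i) * F * (L * w) - g * q"
      by (rule dvd_diff[OF liftD(3)[OF assms(1) i] dvd_mult2])
    also have "\<dots> = (b - g * q) - hconst (c i) * F * (L * w)" by simp
    also have "\<dots> = L * (b' - hconst (c i) * F * w)" unfolding b'(2) by (simp add: algebra_simps)
    finally have *: "A i dvd L * (b' - hconst (c i) * F * w)" .
    have "hconst (c i) * F * w \<in> hset (t + int d)"
      by (rule hset_mult'[OF hset_hconst_mult[OF F] assms(2)]) simp
    from A_prime[OF i linear_form_in_hset hset_diff[OF b'' this] *] A_not_dvd_L[OF i]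
    show ?thesis by blast
  qed
  with b'' assms(2) show ?thesis unfolding lift_def by blast
qed

lemma I_cancel_L: "L * w \<in> I (t + 1) \<Longrightarrow> w \<in> hset t \<Longrightarrow> w \<in> I t"
  using lift_cancel_L unfolding I_def by blast

lemma I_mult: "w \<in> I t \<Longrightarrow> q \<in> hset s \<Longrightarrow> q * w \<in> I (s + t)"
  using lift_mult unfolding I_def by blast

lemma I_subset: "I t \<subseteq> hset t"
  unfolding I_def using liftD(1) by blast

lemma subspace_I: "module.subspace hscale (I t)"
  unfolding subspace_hscale I_def
  using lift_zero lift_add lift_hconst by blast

definition dI :: "int \<Rightarrow> nat" where "dI t = (THE n. vdim hscale (I t) n)"

text \<open>The Hilbert function of the quotient by the ideal \<open>I\<close>. Its eventual value
  is the correction term in \<open>c2\<close>.\<close>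

definition \<delta> :: "int \<Rightarrow> int" where "\<delta> t = int (hil t) - int (dI t)"

lemma vdim_I: "vdim hscale (I t) (dI t)" and dI_le: "dI t \<le> hil t"
  and dI_eq: "dI t = hil t \<Longrightarrow> I t = hset t"
proof -
  obtain k where k: "vdim hscale (I t) k" "k \<le> hil t" "k = hil t \<Longrightarrow> I t = hset t"
    using vdim_subspace[OF vector_space_hscale vdim_hset subspace_I I_subset] by blast
  have "dI t = k" unfolding dI_def
    using k(1) vdim_unique[OF vector_space_hscale] by blast
  with k show "vdim hscale (I t) (dI t)" "dI t \<le> hil t" "dI t = hil t \<Longrightarrow> I t = hset t" by auto
qed

lemma I_kernel: "{w \<in> I t. \<pi> w = 0} = (\<lambda>w. L * w) ` I (t - 1)"
proof (intro equalityI subsetI)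
  fix w assume w: "w \<in> {w \<in> I t. \<pi> w = 0}"
  then have "w \<in> hset t" "\<pi> w = 0" using I_subset by auto
  from kernel_L[OF this] obtain q where q: "q \<in> hset (t - 1)" "w = L * q" .
  with w have "q \<in> I (t - 1)" using I_cancel_L[of q "t - 1"] by simp
  with q(2) show "w \<in> (\<lambda>w. L * w) ` I (t - 1)" by blast
next
  fix w assume "w \<in> (\<lambda>w. L * w) ` I (t - 1)"
  then obtain q where "q \<in> I (t - 1)" "w = L * q" by blast
  with I_mult[of q "t - 1" L 1] show "w \<in> {w \<in> I t. \<pi> w = 0}" by (simp add: peval_mult)
qed

lemma \<pi>_I_subset: "\<pi> ` I t \<subseteq> pset t"
  using I_subset peval_in_pset by blast

text \<open>Rank-nullity for the restriction to \<open>L\<close>. Since \<open>L\<close> is a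
  nonzerodivisor modulo \<open>I\<close>, the kernel in degree \<open>t\<close> is \<open>L\<close>
  times \<open>I (t - 1)\<close>; the defect of \<open>r\<close> from \<open>t + 1\<close> is then
  the growth of \<open>\<delta>\<close> at \<open>t\<close>.\<close>

lemma dI_step:
  obtains r where "dI t = dI (t - 1) + r" "r \<le> nat (t + 1)" "r = nat (t + 1) \<Longrightarrow> \<pi> ` I t = pset t"
    "vdim smult (\<pi> ` I t) r"
proof -
  interpret p: subspace_map hscale smult "I t" \<pi>
    by (rule subspace_map_peval[OF subspace_I])
  interpret m: subspace_map hscale hscale "I (t - 1)" "\<lambda>w. L * w"
    by (rule subspace_map_mult[OF subspace_I])
  have 1: "vdim hscale {w \<in> I t. \<pi> w = 0} (dI (t - 1))"
    unfolding I_kernel by (rule m.vdim_image[OF vdim_I]) simp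
  obtain r where r: "vdim smult (\<pi> ` I t) r" "r \<le> nat (t + 1)" "r = nat (t + 1) \<Longrightarrow> \<pi> ` I t = pset t"
    using vdim_subspace[OF vector_space_smult vdim_pset p.subspace_image \<pi>_I_subset] by blast
  from p.vdim_exact[OF 1 r(1)] have "dI t = dI (t - 1) + r"
    using vdim_unique[OF vector_space_hscale vdim_I] by blast
  with r that show thesis by blast
qed

lemma \<delta>_nonneg: "\<delta> t \<ge> 0"
  using dI_le[of t] by (simp add: \<delta>_def)

lemma \<delta>_step: "\<delta> (t - 1) \<le> \<delta> t" "\<delta> (t - 1) = \<delta> t \<longleftrightarrow> \<pi> ` I t = pset t"
proof -
  obtain r where r: "dI t = dI (t - 1) + r" "r \<le> nat (t + 1)" "r = nat (t + 1) \<Longrightarrow> \<pi> ` I t = pset t"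
    "vdim smult (\<pi> ` I t) r" using dI_step[of t] by blast
  have hil: "hil t = hil (t - 1) + nat (t + 1)"
    using hil_rec[of t] by (cases "t \<ge> 0") (auto simp: hil_def)
  then have eq: "\<delta> t = \<delta> (t - 1) + (int (nat (t + 1)) - int r)"
    unfolding \<delta>_def r(1) by simp
  with r(2) show "\<delta> (t - 1) \<le> \<delta> t" by linarith
  have "r = nat (t + 1)" if "\<pi> ` I t = pset t"
    using vdim_unique[OF vector_space_smult vdim_pset r(4)[unfolded that]] by simp
  moreover have "\<delta> (t - 1) = \<delta> t \<longleftrightarrow> r = nat (t + 1)" using eq by linarith
  ultimately show "\<delta> (t - 1) = \<delta> t \<longleftrightarrow> \<pi> ` I t = pset t" using r(3) by blast
qed

lemma \<delta>_mono: "s \<le> t \<Longrightarrow> \<delta> s \<le> \<delta> t"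
proof (induction t rule: int_ge_induct)
  case (step i)
  with \<delta>_step(1)[of "i + 1"] show ?case by simp
qed simp

text \<open>A polynomial of degree at most \<open>t + 1\<close> is one of degree at most
  \<open>t\<close> plus \<open>z\<close> times a monomial of degree \<open>t\<close>, and the
  factors \<open>1\<close> and \<open>z\<close> are restrictions of linear forms.\<close>

lemma pset_surj_step:
  assumes "\<pi> ` I t = pset t" "t \<ge> 0"
  shows "\<pi> ` I (t + 1) = pset (t + 1)"
proof
  show "\<pi> ` I (t + 1) \<subseteq> pset (t + 1)" by (rule \<pi>_I_subset)
  show "pset (t + 1) \<subseteq> \<pi> ` I (t + 1)"
  proof
    fix p :: "'a poly" assume p: "p \<in> pset (t + 1)"
    define a where "a = coeff p (nat (t + 1))"
    have "[:0, 1:] \<in> pset 1" "1 \<in> pset (1 :: int)" by (auto simp: pset_def coeff_pCons split: nat.splits)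
    then obtain \<mu> \<mu>z where \<mu>: "\<mu> \<in> hset 1" "\<pi> \<mu> = 1" "\<mu>z \<in> hset 1" "\<pi> \<mu>z = [:0, 1:]"
      using peval_surj[OF uv] by metis
    have "monom a (nat t) \<in> pset t" using assms(2) by (auto simp: pset_def)
    then obtain x where x: "x \<in> I t" "\<pi> x = monom a (nat t)" using assms(1) by (metis imageE)
    have mon: "monom a (nat (t + 1)) = [:0, 1:] * monom a (nat t)"
      using assms(2) by (simp add: nat_add_distrib monom_Suc)
    have "coeff (p - monom a (nat (t + 1))) j = 0" if "int j > t" for j
      using that p assms(2) by (cases "int j = t + 1") (auto simp: a_def pset_def)
    then have "p - monom a (nat (t + 1)) \<in> pset t" by (simp add: pset_def)
    then obtain y where y: "y \<in> I t" "\<pi> y = p - monom a (nat (t + 1))" using assms(1) by (metis imageE)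
    have "\<mu> * y + \<mu>z * x \<in> I (1 + t)"
      using subspace_I[of "1 + t"] I_mult[OF y(1) \<mu>(1)] I_mult[OF x(1) \<mu>(3)]
      unfolding subspace_hscale by blast
    moreover have "\<pi> (\<mu> * y + \<mu>z * x) = p"
      unfolding peval_add peval_mult \<mu> x y mon by simp
    ultimately show "p \<in> \<pi> ` I (t + 1)" by (metis add.commute image_eqI)
  qed
qed

text \<open>By Lagrange interpolation on the line \<open>L\<close>.\<close>

lemma pset_surj_base:
  assumes "S \<noteq> {}"
  shows "\<pi> ` I (M - 1) = pset (M - 1)"
proof
  show "\<pi> ` I (M - 1) \<subseteq> pset (M - 1)" by (rule \<pi>_I_subset)
  show "pset (M - 1) \<subseteq> \<pi> ` I (M - 1)"
  proof
    fix p :: "'a poly" assume p: "p \<in> pset (M - 1)"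
    define G where "G i = (\<Prod>j\<in>S - {i}. A j)" for i
    have card: "int (card (S - {i})) = M - 1" if "i \<in> S" for i
      unfolding M_def card.remove[OF fin that] by simp
    have G: "G i \<in> hset (M - 1)" if "i \<in> S" for i
      unfolding G_def card[OF that, symmetric] by (rule hset_prod) (use fin in auto)
    \<comment> \<open>On every line other than the \<open>i\<close>-th both sides vanish with
      \<open>G i\<close>, so the multiplier \<open>c i\<close> may be used throughout.\<close>
    have lift: "lift (M - 1) (G i) (hconst (c i) * F * G i)" if i: "i \<in> S" for i
    proof -
      have "A j dvd hconst (c i) * F * G i - hconst (c j) * F * G i" if j: "j \<in> S" for j
      proof (cases "j = i")
        case False
        then have "A j dvd G i" unfolding G_def using fin j by (intro dvd_prodI) auto
        then show ?thesis by simp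
      qed simp
      moreover have "hconst (c i) * F * G i \<in> hset (M - 1 + int d)"
        by (rule hset_mult'[OF hset_hconst_mult[OF F] G[OF i]]) simp
      ultimately show ?thesis unfolding lift_def using G[OF i] by blast
    qed
    define x where "x i = - lval (\<alpha> i) u / lval (\<alpha> i) v" for i
    have A0: "poly (\<pi> (A i)) (x j) = 0 \<longleftrightarrow> i = j" if "i \<in> S" "j \<in> S" for i j
      using off[OF that(2)] generic[OF that] by (auto simp: x_def field_simps)
    have G0: "poly (\<pi> (G i)) (x j) = 0 \<longleftrightarrow> i \<noteq> j" if "i \<in> S" "j \<in> S" for i j
      unfolding G_def peval_prod poly_prod using A0 that fin by (subst prod_zero_iff) auto
    define \<kappa> where "\<kappa> i = poly p (x i) / poly (\<pi> (G i)) (x i)" for i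
    define w where "w = (\<Sum>i\<in>S. hconst (\<kappa> i) * G i)"
    have w: "w \<in> I (M - 1)"
      unfolding w_def by (rule liftI_I, rule lift_sum, rule lift_hconst, erule lift)
    have root: "poly (p - \<pi> w) (x j) = 0" if j: "j \<in> S" for j
    proof -
      have "poly (\<pi> w) (x j) = (\<Sum>i\<in>S. \<kappa> i * poly (\<pi> (G i)) (x j))"
        unfolding w_def peval_sum poly_sum peval_mult by simp
      also have "\<dots> = (\<Sum>i\<in>S. if i = j then \<kappa> j * poly (\<pi> (G j)) (x j) else 0)"
        by (rule sum.cong) (use G0 j in auto)
      also have "\<dots> = \<kappa> j * poly (\<pi> (G j)) (x j)" using fin j by simp
      also have "\<dots> = poly p (x j)" unfolding \<kappa>_def using G0[OF j j] by simp
      finally show ?thesis by simp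
    qed
    \<comment> \<open>A polynomial of degree less than \<open>M\<close> that has the
      \<open>M\<close> distinct roots \<open>x j\<close> is zero.\<close>
    have "(\<Prod>i\<in>S. [:lval (\<alpha> i) u, lval (\<alpha> i) v:]) dvd p - \<pi> w"
    proof (rule prod_linear_poly_dvd[OF fin off generic])
      fix i assume i: "i \<in> S"
      show "[:lval (\<alpha> i) u, lval (\<alpha> i) v:] dvd p - \<pi> w"
        unfolding linear_poly_dvd_iff[OF off[OF i]] using root[OF i] unfolding x_def .
    qed auto
    then obtain r where r: "p - \<pi> w = \<pi> g * r" unfolding \<pi>_g by blast
    note deg = degree_\<pi>_g \<pi>_g_nonzero
    have "\<pi> w \<in> pset (M - 1)" using w \<pi>_I_subset by blast
    then have "\<pi> g * r \<in> pset (M - 1)" using p unfolding r[symmetric] by (simp add: pset_def)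
    from pset_mult_cancel[OF deg(2) this] have "r \<in> pset (- 1)" unfolding deg M_def by simp
    then have "r = 0" by (auto simp: pset_def poly_eq_iff)
    with r have "p = \<pi> w" by simp
    with w show "p \<in> \<pi> ` I (M - 1)" by blast
  qed
qed

text \<open>Restriction to \<open>L\<close> is onto in degree \<open>M - 1\<close>, hence in all
  later degrees, and \<open>\<delta>\<close> grows only where it is not onto.\<close>

lemma \<delta>_stable:
  assumes "S \<noteq> {}" "t \<ge> M - 1"
  shows "\<delta> t = \<delta> (M - 1)"
proof -
  have M: "M - 1 \<ge> 0" using assms fin unfolding M_def by (simp add: Suc_leI card_gt_0_iff)
  have "\<pi> ` I t = pset t \<and> \<delta> t = \<delta> (M - 1)"
    using assms(2)
  proof (induction t rule: int_ge_induct)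
    case base
    show ?case using pset_surj_base[OF assms(1)] by simp
  next
    case (step i)
    then have "\<pi> ` I (i + 1) = pset (i + 1)" using M by (intro pset_surj_step) auto
    with step \<delta>_step(2)[of "i + 1"] show ?case by simp
  qed
  then show ?thesis ..
qed

lemma \<delta>_le: "S \<noteq> {} \<Longrightarrow> \<delta> t \<le> \<delta> (M - 1)"
  using \<delta>_stable[of t] \<delta>_mono[of t "M - 1"] by (cases "t \<ge> M - 1") auto

end

lemma power_linear_form_dvd_cancel:
  fixes a :: "3 \<Rightarrow> 'a::field"
  assumes "a \<noteq> (\<lambda>_. 0)" "p \<in> hset m" "\<not> linear_form a dvd p" "q \<in> hset n" "linear_form a ^ e dvd p * q"
  obtains q' where "q' \<in> hset (n - int e)" "q = linear_form a ^ e * q'"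
proof -
  have "\<exists>q'. q' \<in> hset (n - int e) \<and> q = linear_form a ^ e * q'"
    using assms(5)
  proof (induction e)
    case 0
    then show ?case using assms(4) by simp
  next
    case (Suc e)
    then have "linear_form a ^ e dvd p * q" using power_le_dvd[of _ "Suc e" _ e] by simp
    then obtain q' where q': "q' \<in> hset (n - int e)" "q = linear_form a ^ e * q'" using Suc.IH by blast
    from Suc.prems have "linear_form a ^ e * linear_form a dvd linear_form a ^ e * (p * q')"
      unfolding q'(2) by (simp add: algebra_simps)
    moreover have "linear_form a ^ e \<noteq> 0" using assms(1) by (simp add: linear_form_eq_0_iff)
    ultimately have "linear_form a dvd p * q'" by (simp only: dvd_mult_cancel_left simp_thms)
    then have "linear_form a dvd q'" using linear_form_prime[OF assms(1,2) q'(1)] assms(3) by blast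
    then obtain q'' where "q'' \<in> hset (n - int e - 1)" "q' = linear_form a * q''"
      using linear_form_dvd_hset[OF assms(1) q'(1)] by blast
    then show ?case unfolding q'(2) by (intro exI[of _ q'']) (simp add: algebra_simps)
  qed
  with that show thesis by blast
qed

section \<open>Pairings of lifts, and the construction of two independent ones\<close>

context interpolation
begin

lemma lift_unique:
  assumes "lift t w b" "lift t w b'" "t + int d < M"
  shows "b = b'"
proof -
  have diff: "b - b' \<in> hset (t + int d)" using assms(1,2) liftD(2) hset_diff by blast
  have "A i dvd b - b'" if "i \<in> S" for i
    using dvd_diff[OF liftD(3)[OF assms(1) that] liftD(3)[OF assms(2) that]] by simp
  from dvd_g[OF diff this] obtain q where "q \<in> hset (t + int d - M)" "b - b' = g * q" .
  with assms(3) show ?thesis by (simp add: hset_neg)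
qed

text \<open>Modulo \<open>A i\<close> both \<open>b\<close> and \<open>b'\<close> are the same
  multiple of \<open>w\<close> and \<open>w'\<close>, so the determinant vanishes on each of the
  lines. Up to a fixed factor it is the determinant of the two fields with the Euler field.\<close>

lemma lift_pairing:
  assumes "lift t w b" "lift t' w' b'"
  obtains q where "q \<in> hset (t + t' + int d - M)" "w * b' - w' * b = g * q"
proof -
  have "w * b' \<in> hset (t + t' + int d)"
    by (rule hset_mult'[OF liftD(1)[OF assms(1)] liftD(2)[OF assms(2)]]) simp
  moreover have "w' * b \<in> hset (t + t' + int d)"
    by (rule hset_mult'[OF liftD(1)[OF assms(2)] liftD(2)[OF assms(1)]]) simp
  ultimately have 1: "w * b' - w' * b \<in> hset (t + t' + int d)" by (rule hset_diff)
  have 2: "A i dvd w * b' - w' * b" if "i \<in> S" for i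
  proof -
    have "w * b' - w' * b = w * (b' - hconst (c i) * F * w') - w' * (b - hconst (c i) * F * w)"
      by (simp add: algebra_simps)
    then show ?thesis
      using liftD(3)[OF assms(1) that] liftD(3)[OF assms(2) that] by simp
  qed
  from dvd_g[OF 1 2] that show thesis by blast
qed

lemma exists_dual:
  obtains \<mu> \<mu>z where "\<mu> \<in> hset 1" "\<pi> \<mu> = 1" "\<mu>z \<in> hset 1" "\<pi> \<mu>z = [:0, 1:]"
proof -
  have "[:0, 1:] \<in> pset 1" "1 \<in> pset (1 :: int)" by (auto simp: pset_def coeff_pCons split: nat.splits)
  with that show thesis using peval_surj[OF uv] by metis
qed

text \<open>The forms \<open>w\<^sub>0\<close> and \<open>w\<^sub>1\<close> are coprime since they restrict to \<open>1\<close> and \<open>z^s\<close> on the line \<open>L\<close>.\<close>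

lemma coprime_relation:
  assumes w: "w0 \<in> hset (int s)" "w1 \<in> hset (int s)" "\<pi> w0 = 1" "\<pi> w1 = monom 1 s"
    and "p \<in> hset n" "q \<in> hset n" "w0 * p = w1 * q"
  shows "\<exists>\<nu>. \<nu> \<in> hset (n - int s) \<and> q = w0 * \<nu>"
  using assms(5-7)
proof (induction "nat (n + 1)" arbitrary: n p q)
  case 0
  then have "q = 0" by (simp add: hset_neg)
  then show ?case by (intro exI[of _ 0]) simp
next
  case (Suc m)
  have \<pi>p: "\<pi> p = monom 1 s * \<pi> q"
    using arg_cong[OF Suc.prems(3), of \<pi>] unfolding peval_mult w by simp
  have "coeff (\<pi> q) j = 0" if j: "int j > n - int s" for j
  proof -
    have "coeff (\<pi> p) (s + j) = coeff (\<pi> q) j" unfolding \<pi>p by (simp add: coeff_monom_mult)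
    moreover have "int (s + j) > n" using j by simp
    then have "coeff (\<pi> p) (s + j) = 0" using peval_in_pset[OF Suc.prems(1), of u v] unfolding pset_def by blast
    ultimately show ?thesis by simp
  qed
  then have "\<pi> q \<in> pset (n - int s)" by (simp add: pset_def)
  \<comment> \<open>\<open>q1\<close> is the right quotient on the line \<open>L\<close>. After
    division by \<open>L\<close> the errors \<open>q2\<close> and \<open>p2\<close> satisfy the same
    relation one degree lower.\<close>
  then obtain q1 where q1: "q1 \<in> hset (n - int s)" "\<pi> q1 = \<pi> q" using peval_surj[OF uv] by blast
  have h: "w0 * q1 \<in> hset n" "w1 * q1 \<in> hset n"
    by (rule hset_mult'[OF w(1) q1(1)], simp, rule hset_mult'[OF w(2) q1(1)], simp)
  have "\<pi> (q - w0 * q1) = 0" "\<pi> (p - w1 * q1) = 0"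
    unfolding peval_diff peval_mult w q1 \<pi>p by simp_all
  with kernel_L hset_diff[OF Suc.prems(2) h(1)] hset_diff[OF Suc.prems(1) h(2)]
  obtain q2 p2 where 2: "q2 \<in> hset (n - 1)" "q - w0 * q1 = L * q2"
    "p2 \<in> hset (n - 1)" "p - w1 * q1 = L * p2" by metis
  have "L * (w0 * p2) = w0 * (p - w1 * q1)" unfolding 2 by (simp add: algebra_simps)
  also have "\<dots> = w1 * (q - w0 * q1)" using Suc.prems(3) by (simp add: algebra_simps)
  also have "\<dots> = L * (w1 * q2)" unfolding 2 by (simp add: algebra_simps)
  finally have "w0 * p2 = w1 * q2" by simp
  moreover have "m = nat (n - 1 + 1)" using Suc(2) by simp
  ultimately obtain \<nu> where \<nu>: "\<nu> \<in> hset (n - 1 - int s)" "q2 = w0 * \<nu>"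
    using Suc(1)[of "n - 1" p2 q2] 2 by blast
  have "L * \<nu> \<in> hset (n - int s)"
    by (rule hset_mult'[OF linear_form_in_hset \<nu>(1)]) simp
  then have "q1 + L * \<nu> \<in> hset (n - int s)" by (rule hset_add[OF q1(1)])
  moreover have "q = w0 * (q1 + L * \<nu>)" using 2(2) unfolding \<nu>(2) by (simp add: algebra_simps)
  ultimately show ?case by blast
qed

text \<open>
  Descent on the power of \<open>L\<close> dividing the pairing. Lifts are unique in the degrees considered,
  so every relation \<open>\<mu>\<^sub>z w - \<mu> w' = L x\<close> between elements of \<open>I\<close> lifts, and the pairings of lifts of
  \<open>1, z, \<dots>, z^s\<close> with a fixed element form, modulo \<open>L\<close>, a geometric progression with ratio \<open>z\<close>; their
  degree is too small for that unless they vanish.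
\<close>

lemma pairing_zero:
  assumes s: "s \<ge> 1" and surj: "\<pi> ` I (int s) = pset (int s)"
    and small: "int s + 1 + int d < M"
    and l: "lift (int s) w b" and l': "lift (int s) w' b'"
  shows "w * b' = w' * b"
proof -
  obtain \<mu> \<mu>z where \<mu>: "\<mu> \<in> hset 1" "\<pi> \<mu> = 1" "\<mu>z \<in> hset 1" "\<pi> \<mu>z = [:0, 1:]"
    by (rule exists_dual)
  have L\<mu>: "\<not> L dvd \<mu>" unfolding linear_form_dvd_iff_peval[OF uv \<mu>(1)] \<mu> by simp
  \<comment> \<open>The degree of a pairing divided by \<open>g\<close>. It is less than
    \<open>s\<close>, so no nonzero polynomial within this bound is divisible by
    \<open>z^s\<close>.\<close>
  let ?D = "2 * int s + int d - M"
  have D: "?D < int s" using small by simp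
  define W where "W i = (SOME x. x \<in> I (int s) \<and> \<pi> x = monom 1 i)" for i
  have W: "W i \<in> I (int s) \<and> \<pi> (W i) = monom 1 i" if "i \<le> s" for i
  proof -
    have "monom 1 i \<in> pset (int s)" using that by (auto simp: pset_def)
    then have "\<exists>x. x \<in> I (int s) \<and> \<pi> x = monom 1 i" using surj by (metis imageE)
    then show ?thesis unfolding W_def by (rule someI_ex)
  qed
  define B where "B i = (SOME b. lift (int s) (W i) b)" for i
  have B: "lift (int s) (W i) (B i)" if "i \<le> s" for i
    using W[OF that] unfolding I_def B_def by (metis (mono_tags, lifting) mem_Collect_eq someI_ex)
  have rel: "\<exists>x y. lift (int s) x y \<and> \<mu>z * W i - \<mu> * W (Suc i) = L * x \<and> \<mu>z * B i - \<mu> * B (Suc i) = L * y"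
    if i: "Suc i \<le> s" for i
  proof -
    have l: "lift (int s + 1) (\<mu>z * W i - \<mu> * W (Suc i)) (\<mu>z * B i - \<mu> * B (Suc i))"
      using i B[of i] B[of "Suc i"] \<mu> by (intro lift_diff lift_mult_1) auto
    have "\<pi> (\<mu>z * W i - \<mu> * W (Suc i)) = 0"
      unfolding peval_diff peval_mult \<mu> using W[of i] W[of "Suc i"] i by (simp add: monom_Suc)
    from kernel_L[OF liftD(1)[OF l] this]
    obtain x where x: "x \<in> hset (int s + 1 - 1)" "\<mu>z * W i - \<mu> * W (Suc i) = L * x" .
    have x': "x \<in> hset (int s)" using x(1) by simp
    from lift_cancel_L[OF l[unfolded x(2)] x'] obtain y where y: "lift (int s) x y" by blast
    have "lift (int s + 1) (L * x) (L * y)" by (rule lift_mult_1[OF y]) simp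
    \<comment> \<open>Uniqueness of lifts is needed in degree \<open>s + 1\<close>, which is what
      the bound \<open>small\<close> provides.\<close>
    from lift_unique[OF l[unfolded x(2)] this small] x y show ?thesis by blast
  qed
  have "\<exists>q. q \<in> hset (?D - int e) \<and> w * b' - w' * b = g * L ^ e * q"
    if "lift (int s) w b" "lift (int s) w' b'" for e w b w' b'
    using that
  proof (induction e arbitrary: w b w' b')
    case 0
    from lift_pairing[OF 0] obtain q where "q \<in> hset (int s + int s + int d - M)" "w * b' - w' * b = g * q" .
    then show ?case by (intro exI[of _ q]) (simp add: algebra_simps)
  next
    case (Suc e)
    note l' = Suc.prems(2)
    have IH: "\<exists>q. q \<in> hset (?D - int e) \<and> x * b' - w' * y = g * L ^ e * q" if "lift (int s) x y" for x y
      using Suc.IH[OF that l'] .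
    have "\<forall>i. \<exists>q. i \<le> s \<longrightarrow> q \<in> hset (?D - int e) \<and> W i * b' - w' * B i = g * L ^ e * q"
      using IH B by blast
    then obtain Q where Q: "\<And>i. i \<le> s \<Longrightarrow> Q i \<in> hset (?D - int e)"
      "\<And>i. i \<le> s \<Longrightarrow> W i * b' - w' * B i = g * L ^ e * Q i" by metis
    have gL: "g * L ^ e \<noteq> 0" by simp
    have Qstep: "\<pi> (Q (Suc i)) = [:0, 1:] * \<pi> (Q i)" if i: "Suc i \<le> s" for i
    proof -
      from rel[OF i] obtain x y where xy: "lift (int s) x y"
        "\<mu>z * W i - \<mu> * W (Suc i) = L * x" "\<mu>z * B i - \<mu> * B (Suc i) = L * y" by blast
      from IH[OF xy(1)] obtain q where q: "x * b' - w' * y = g * L ^ e * q" by blast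
      have "g * L ^ e * (\<mu>z * Q i - \<mu> * Q (Suc i)) =
        \<mu>z * (g * L ^ e * Q i) - \<mu> * (g * L ^ e * Q (Suc i))"
        by (simp add: algebra_simps)
      also have "\<dots> = \<mu>z * (W i * b' - w' * B i) - \<mu> * (W (Suc i) * b' - w' * B (Suc i))"
        using Q(2)[of i] Q(2)[of "Suc i"] i by simp
      also have "\<dots> = (\<mu>z * W i - \<mu> * W (Suc i)) * b' - w' * (\<mu>z * B i - \<mu> * B (Suc i))"
        by (simp add: algebra_simps)
      also have "\<dots> = L * (x * b' - w' * y)" unfolding xy by (simp add: algebra_simps)
      also have "\<dots> = g * L ^ e * (L * q)" unfolding q by (simp add: algebra_simps)
      finally have "\<mu>z * Q i - \<mu> * Q (Suc i) = L * q" using gL by (simp only: mult_cancel_left) simp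
      from arg_cong[OF this, of \<pi>] show ?thesis unfolding peval_diff peval_mult \<mu> \<pi>_L by simp
    qed
    have Qpow: "\<pi> (Q i) = monom 1 i * \<pi> (Q 0)" if "i \<le> s" for i
      using that
    proof (induction i)
      case (Suc i)
      then show ?case using Qstep[of i] by (simp add: monom_Suc)
    qed simp
    have "coeff (\<pi> (Q 0)) j = 0" for j
    proof -
      have "coeff (\<pi> (Q 0)) j = coeff (\<pi> (Q s)) (s + j)"
        using Qpow[of s] by (simp add: coeff_monom_mult)
      moreover have "int (s + j) > ?D - int e" using D by simp
      then have "coeff (\<pi> (Q s)) (s + j) = 0"
        using peval_in_pset[OF Q(1)[of s], of u v] unfolding pset_def by blast
      ultimately show ?thesis by simp
    qed
    then have "\<pi> (Q 0) = 0" by (simp add: poly_eq_iff)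
    then have Q0: "\<pi> (Q i) = 0" if "i \<le> s" for i using Qpow[OF that] by simp
    have "\<forall>i. \<exists>q. i \<le> s \<longrightarrow> q \<in> hset (?D - int e - 1) \<and> Q i = L * q"
      using kernel_L[OF Q(1) Q0] by metis
    then obtain Q' where Q': "\<And>i. i \<le> s \<Longrightarrow> Q' i \<in> hset (?D - int e - 1)"
      "\<And>i. i \<le> s \<Longrightarrow> Q i = L * Q' i" by metis
    \<comment> \<open>On \<open>L\<close> the form \<open>w\<close> agrees with a combination
      \<open>w1\<close> of the \<open>W i\<close>, whose pairings have just gained a factor
      \<open>L\<close>. The rest \<open>w - w1\<close> is \<open>L\<close> times an element of
      \<open>I\<close>.\<close>
    define \<gamma> where "\<gamma> i = coeff (\<pi> w) i" for i
    define w1 where "w1 = (\<Sum>i\<le>s. hconst (\<gamma> i) * W i)"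
    define b1 where "b1 = (\<Sum>i\<le>s. hconst (\<gamma> i) * B i)"
    have l1: "lift (int s) w1 b1"
      unfolding w1_def b1_def by (intro lift_sum lift_hconst B) simp
    have wh: "w \<in> hset (int s)" using liftD(1)[OF Suc.prems(1)] .
    have "\<pi> w1 = (\<Sum>i\<le>s. monom (\<gamma> i) i)"
      unfolding w1_def peval_sum peval_mult peval_hconst
      by (rule sum.cong) (use W in \<open>auto simp: smult_monom\<close>)
    also have "\<dots> = \<pi> w"
      by (rule poly_eqI) (use peval_in_pset[OF wh, of u v] in \<open>auto simp: coeff_sum_monom \<gamma>_def pset_def\<close>)
    finally have \<pi>w1: "\<pi> (w - w1) = 0" by (simp add: peval_diff)
    have l2: "lift (int s) (w - w1) (b - b1)" by (rule lift_diff[OF Suc.prems(1) l1])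
    from kernel_L[OF liftD(1)[OF l2] \<pi>w1] obtain x where x: "x \<in> hset (int s - 1)" "w - w1 = L * x" .
    have "\<exists>y. lift (int s - 1) x y"
      by (rule lift_cancel_L[of "int s - 1"]) (use l2 x in auto)
    then obtain y where y: "lift (int s - 1) x y" by blast
    have bL: "b - b1 = L * y"
      by (rule lift_unique[OF l2[unfolded x(2)]]) (use lift_mult_1[OF y, of L] small in auto)
    from lift_pairing[OF y l'] obtain q1 where
      q1: "q1 \<in> hset (int s - 1 + int s + int d - M)" "x * b' - w' * y = g * q1" .
    \<comment> \<open>\<open>x\<close> has degree \<open>s - 1\<close>, so the induction hypothesis
      applies only to its product with \<open>\<mu>\<close>; as \<open>L\<close> does not divide
      \<open>\<mu>\<close>, this factor can be removed again.\<close>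
    have "lift (int s) (\<mu> * x) (\<mu> * y)" using lift_mult_1[OF y \<mu>(1)] by simp
    from IH[OF this] obtain q2 where q2: "\<mu> * x * b' - w' * (\<mu> * y) = g * L ^ e * q2" by blast
    have "g * (\<mu> * q1) = \<mu> * (x * b' - w' * y)" unfolding q1(2) by (simp add: algebra_simps)
    also have "\<dots> = g * (L ^ e * q2)" using q2 by (simp add: algebra_simps)
    finally have "\<mu> * q1 = L ^ e * q2" by simp
    then have "L ^ e dvd \<mu> * q1" by simp
    from power_linear_form_dvd_cancel[OF uv \<mu>(1) L\<mu> q1(1) this] obtain q3 where
      q3: "q3 \<in> hset (int s - 1 + int s + int d - M - int e)" "q1 = L ^ e * q3" .
    have "w * b' - w' * b = (w1 * b' - w' * b1) + ((w - w1) * b' - w' * (b - b1))"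
      by (simp add: algebra_simps)
    also have "(w - w1) * b' - w' * (b - b1) = L * (x * b' - w' * y)"
      unfolding x(2) bL by (simp add: algebra_simps)
    also have "\<dots> = g * L ^ Suc e * q3" unfolding q1(2) q3(2) by (simp add: algebra_simps)
    also have "w1 * b' - w' * b1 = (\<Sum>i\<le>s. hconst (\<gamma> i) * (W i * b' - w' * B i))"
      unfolding w1_def b1_def by (simp add: sum_distrib_left sum_distrib_right sum_subtractf algebra_simps)
    also have "\<dots> = (\<Sum>i\<le>s. g * L ^ Suc e * (hconst (\<gamma> i) * Q' i))"
    proof (rule sum.cong)
      fix i assume "i \<in> {..s}"
      then have "W i * b' - w' * B i = g * L ^ e * (L * Q' i)" using Q(2)[of i] Q'(2)[of i] by simp
      then show "hconst (\<gamma> i) * (W i * b' - w' * B i) = g * L ^ Suc e * (hconst (\<gamma> i) * Q' i)"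
        by (simp only: power_Suc mult_ac)
    qed simp
    finally have "w * b' - w' * b = g * L ^ Suc e * ((\<Sum>i\<le>s. hconst (\<gamma> i) * Q' i) + q3)"
      by (simp add: sum_distrib_left distrib_left)
    moreover have "(\<Sum>i\<le>s. hconst (\<gamma> i) * Q' i) + q3 \<in> hset (?D - int (Suc e))"
    proof (intro hset_add hset_sum hset_hconst_mult)
      show "Q' i \<in> hset (?D - int (Suc e))" if "i \<in> {..s}" for i
        using Q'(1)[of i] that by (simp add: algebra_simps)
      show "q3 \<in> hset (?D - int (Suc e))" using q3(1) by (simp add: algebra_simps)
    qed
    ultimately show ?case by blast
  qed
  \<comment> \<open>With this exponent the cofactor has negative degree.\<close>
  from this[OF l l', of "Suc (nat ?D)"] obtain q where
    "q \<in> hset (?D - int (Suc (nat ?D)))" "w * b' - w' * b = g * L ^ Suc (nat ?D) * q" by blast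
  then show ?thesis by (simp add: hset_neg)
qed

text \<open>Vanishing of the pairing of two coprime forms makes \<open>b0 / w0\<close> a polynomial.
  It lifts \<open>1\<close> because no \<open>A i\<close> divides \<open>w0\<close>, whose
  restriction to \<open>L\<close> is the constant one.\<close>

lemma one_in_I_if_surj:
  assumes "s \<ge> 1" "\<pi> ` I (int s) = pset (int s)" "int s + 1 + int d < M"
  shows "1 \<in> I 0"
proof -
  have "1 \<in> pset (int s)" "monom 1 s \<in> pset (int s)" by (auto simp: pset_def)
  then have "1 \<in> \<pi> ` I (int s)" "monom 1 s \<in> \<pi> ` I (int s)" using assms(2) by simp_all
  then obtain w0 w1 where w: "w0 \<in> I (int s)" "\<pi> w0 = 1" "w1 \<in> I (int s)" "\<pi> w1 = monom 1 s"
    by (elim imageE) simp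
  obtain b0 b1 where b: "lift (int s) w0 b0" "lift (int s) w1 b1" using w unfolding I_def by blast
  have "w0 * b1 = w1 * b0" by (rule pairing_zero[OF assms b])
  from coprime_relation[OF liftD(1)[OF b(1)] liftD(1)[OF b(2)] w(2,4) liftD(2)[OF b(2)] liftD(2)[OF b(1)] this]
  obtain \<nu> where \<nu>: "\<nu> \<in> hset (int s + int d - int s)" "b0 = w0 * \<nu>" by blast
  have \<nu>': "\<nu> \<in> hset (int d)" using \<nu>(1) by simp
  have "A i dvd \<nu> - hconst (c i) * F * 1" if i: "i \<in> S" for i
  proof -
    have "\<not> A i dvd w0"
    proof
      assume "A i dvd w0"
      then have "\<pi> (A i) dvd \<pi> w0" by (elim dvdE) (simp only: peval_mult dvd_triv_left)
      with \<pi>_A_not_dvd_one[OF i] w(2) show False by simp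
    qed
    moreover have "A i dvd w0 * (\<nu> - hconst (c i) * F)"
      using liftD(3)[OF b(1) i] unfolding \<nu>(2) by (simp add: algebra_simps)
    moreover have "\<nu> - hconst (c i) * F \<in> hset (int d)"
      by (intro hset_diff \<nu>' hset_hconst_mult F)
    ultimately have "A i dvd \<nu> - hconst (c i) * F" using A_prime[OF i liftD(1)[OF b(1)]] by blast
    then show ?thesis by simp
  qed
  then have "lift 0 1 \<nu>" unfolding lift_def using \<nu>' by simp
  then show ?thesis by (rule liftI_I)
qed

lemma \<delta>_zero_if_one: "1 \<in> I 0 \<Longrightarrow> \<delta> t = 0"
proof -
  assume 1: "1 \<in> I 0"
  have "I t = hset t" using I_subset I_mult[OF 1, of _ t] by fastforce
  then have "dI t = hil t"
    using vdim_unique[OF vector_space_hscale vdim_I[of t]] vdim_hset[of t] by simp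
  then show ?thesis by (simp add: \<delta>_def)
qed

theorem exists_independent_lifts:
  fixes k r :: nat
  assumes S: "S \<noteq> {}" and M: "M + int d = 2 * int k + int r" and k: "k \<ge> 1" "k \<le> d + 1" "d \<le> k + r"
    and \<delta>: "\<delta> (M - 1) = int k * int (k + r) - M * int d"
  obtains w b w' b' where "lift (int k - int d) w b" "lift (int (k + r) - int d) w' b'" "w * b' - w' * b \<noteq> 0"
proof (cases "k \<le> d")
  case True
  define j where "j = int d - int k"
  have j: "0 \<le> j" "j \<le> int r" using True k j_def by auto
  have d: "int d = int k + j" "M = int k + int r - j" using M j_def by auto
  \<comment> \<open>The product \<open>M d\<close> exceeds \<open>k (k + r)\<close> by
    \<open>j (r - j)\<close>, and \<open>\<delta>\<close> cannot be negative, so both have to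
    vanish.\<close>
  have "int k * int (k + r) - M * int d = - (j * (int r - j))"
    unfolding d by (simp add: algebra_simps)
  moreover have "j * (int r - j) \<ge> 0" using j by simp
  ultimately have 0: "\<delta> (M - 1) = 0" "j * (int r - j) = 0" using \<delta> \<delta>_nonneg[of "M - 1"] by auto
  have "\<delta> 0 = 0" using \<delta>_le[OF S, of 0] \<delta>_nonneg[of 0] 0 by simp
  then have "I 0 = hset 0" using dI_eq[of 0] by (simp add: \<delta>_def)
  then obtain b where b: "lift 0 1 b" unfolding I_def using one_in_hset by blast
  have "A i dvd g" if "i \<in> S" for i unfolding g_def using fin that by (rule dvd_prodI)
  \<comment> \<open>As fields, the lifts \<open>(1, b)\<close> and \<open>(0, g)\<close> have
    degrees \<open>d\<close> and \<open>M\<close>; their pairing is \<open>g\<close> up to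
    sign.\<close>
  then have g: "lift (M - int d) 0 g" unfolding lift_def using g_hset by simp
  from 0(2) consider "j = 0" | "j = int r" by auto
  then show thesis
  proof cases
    case 1
    then show thesis using that[of 1 b 0 g] b g d by simp
  next
    case 2
    then show thesis using that[of 0 g 1 b] b g d by simp
  qed
next
  case False
  then have d: "int d = int k - 1" using k by simp
  then have M': "M = int k + int r + 1" using M by simp
  \<comment> \<open>\<open>(k - 1) (k + r + 1)\<close> falls short of \<open>k (k + r)\<close> by
    \<open>r + 1\<close>.\<close>
  have \<delta>r: "\<delta> (M - 1) = int r + 1" unfolding \<delta> unfolding M' d by (simp add: algebra_simps)
  then have not1: "1 \<notin> I 0" using \<delta>_zero_if_one[of "M - 1"] by auto
  have I1: "\<exists>w\<in>I 1. w \<noteq> 0"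
  proof (rule ccontr)
    assume "\<not> ?thesis"
    then have "I 1 = {0}" using subspace_I[of 1] unfolding subspace_hscale by blast
    then have "dI 1 = 0" using vdim_unique[OF vector_space_hscale vdim_I[of 1]] vdim_trivial[OF vector_space_hscale] by simp
    then have \<delta>1: "\<delta> 1 = 3" by (simp add: \<delta>_def hil_def)
    then have r: "r \<ge> 2" using \<delta>_le[OF S, of 1] \<delta>r by simp
    \<comment> \<open>From \<open>\<delta> 1 = 3\<close> on, every degree in which the restriction
      is not onto raises \<open>\<delta>\<close> by at least one. If this went on up to degree
      \<open>r\<close>, the value there would be at least \<open>r + 2\<close>, more than the final
      value \<open>r + 1\<close>.\<close>
    have "\<exists>i\<ge>2. i \<le> r \<and> \<pi> ` I (int i) = pset (int i)"
    proof (rule ccontr)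
      assume neg: "\<not> ?thesis"
      have "\<delta> (int i) \<ge> int i + 2" if "1 \<le> i" "i \<le> r" for i
        using that
      proof (induction i rule: nat_induct_at_least)
        case base
        then show ?case using \<delta>1 by simp
      next
        case (Suc i)
        have "\<delta> (int (Suc i) - 1) \<noteq> \<delta> (int (Suc i))"
          using neg Suc.hyps Suc.prems unfolding \<delta>_step(2)[of "int (Suc i)"]
          by (metis Suc_le_mono numeral_2_eq_2 One_nat_def)
        with \<delta>_step(1)[of "int (Suc i)"] Suc show ?case by simp
      qed
      from this[of r] r \<delta>_le[OF S, of "int r"] \<delta>r show False by simp
    qed
    then obtain i where i: "i \<ge> 2" "i \<le> r" "\<pi> ` I (int i) = pset (int i)" by blast
    have "\<pi> ` I (int r) = pset (int r)"
      using i(2)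
    proof (induction r rule: dec_induct)
      case (step n)
      then show ?case using pset_surj_step[of "int n"] by (simp add: add.commute)
    qed (rule i(3))
    then have "1 \<in> I 0" by (rule one_in_I_if_surj[rotated]) (use r d M' in auto)
    with not1 show False ..
  qed
  then obtain w b where w: "lift 1 w b" "w \<noteq> 0" unfolding I_def by blast
  obtain a where a: "w = linear_form a" using hset_1_linear_form[OF liftD(1)[OF w(1)]] .
  have a0: "a \<noteq> (\<lambda>_. 0)" using w(2) unfolding a by (simp add: linear_form_eq_0_iff)
  \<comment> \<open>The multiples of \<open>w\<close> have codimension \<open>r + 2\<close> in
    degree \<open>r + 1\<close>, one more than the codimension of \<open>I\<close> can be.\<close>
  have "\<not> I (int r + 1) \<subseteq> (\<lambda>q. w * q) ` hset (int r)"
  proof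
    assume sub: "I (int r + 1) \<subseteq> (\<lambda>q. w * q) ` hset (int r)"
    interpret m: subspace_map hscale hscale "hset (int r)" "\<lambda>q. w * q"
      by (rule subspace_map_mult[OF subspace_hset])
    have "vdim hscale ((\<lambda>q. w * q) ` hset (int r)) (hil (int r))"
      by (rule m.vdim_image[OF vdim_hset]) (use w(2) in simp)
    from vdim_subspace[OF vector_space_hscale this subspace_I sub]
    obtain l where "vdim hscale (I (int r + 1)) l" "l \<le> hil (int r)" by blast
    then have "dI (int r + 1) \<le> hil (int r)"
      using vdim_unique[OF vector_space_hscale vdim_I] by blast
    moreover have "hil (int r + 1) = hil (int r) + (r + 2)"
      using hil_rec[of "int r + 1"] by (simp add: nat_add_distrib)
    ultimately have "\<delta> (int r + 1) \<ge> int r + 2" unfolding \<delta>_def by simp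
    with \<delta>_le[OF S, of "int r + 1"] \<delta>r show False by simp
  qed
  then obtain w' b' where w': "lift (int r + 1) w' b'" "w' \<notin> (\<lambda>q. w * q) ` hset (int r)"
    unfolding I_def by blast
  have ndvd: "\<not> linear_form a dvd w'"
  proof
    assume "linear_form a dvd w'"
    from linear_form_dvd_hset[OF a0 liftD(1)[OF w'(1)] this]
    obtain q where "q \<in> hset (int r + 1 - 1)" "w' = linear_form a * q" .
    then have "w' \<in> (\<lambda>q. w * q) ` hset (int r)" unfolding a by (intro image_eqI[of _ _ q]) simp_all
    with w'(2) show False ..
  qed
  \<comment> \<open>If the pairing vanished, then \<open>b = w * b1\<close> and
    \<open>b' = w' * b1\<close>, and \<open>b1\<close> would lift \<open>1\<close>: a line on which
    \<open>b1\<close> has the wrong value would have to divide both \<open>w\<close> and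
    \<open>w'\<close>, hence be proportional to \<open>w\<close>, which does not divide
    \<open>w'\<close>.\<close>
  have "w * b' - w' * b \<noteq> 0"
  proof
    assume eq: "w * b' - w' * b = 0"
    then have "linear_form a dvd w' * b" unfolding a by (metis dvd_triv_left right_minus_eq)
    then have "linear_form a dvd b"
      using linear_form_prime[OF a0 liftD(1)[OF w'(1)] liftD(2)[OF w(1)]] ndvd by blast
    then obtain b1 where b1: "b1 \<in> hset (1 + int d - 1)" "b = w * b1"
      using linear_form_dvd_hset[OF a0 liftD(2)[OF w(1)]] unfolding a by blast
    have b1h: "b1 \<in> hset (int d)" using b1(1) by simp
    have "w * b' = w * (w' * b1)" using eq unfolding b1(2) by (simp add: algebra_simps)
    then have b': "b' = w' * b1" using w(2) by simp
    have "A i dvd b1 - hconst (c i) * F * 1" if i: "i \<in> S" for i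
    proof -
      have h: "b1 - hconst (c i) * F * 1 \<in> hset (int d)"
        unfolding mult_1_right by (intro hset_diff b1h hset_hconst_mult F)
      have 1: "A i dvd w * (b1 - hconst (c i) * F * 1)"
        using liftD(3)[OF w(1) i] unfolding b1(2) by (simp add: algebra_simps)
      have 2: "A i dvd w' * (b1 - hconst (c i) * F * 1)"
        using liftD(3)[OF w'(1) i] unfolding b' by (simp add: algebra_simps)
      show ?thesis
      proof (rule ccontr)
        assume n: "\<not> ?thesis"
        with A_prime[OF i liftD(1)[OF w(1)] h 1] have "A i dvd linear_form a" unfolding a by blast
        then obtain e where e: "a = (\<lambda>j. e * \<alpha> i j)"
          using linear_form_dvd_linear_form[OF A_nonzero[OF i]] by blast
        have e0: "e \<noteq> 0" using a0 e by auto
        have "A i dvd w'" using A_prime[OF i liftD(1)[OF w'(1)] h 2] n by blast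
        then obtain q where "w' = A i * q" by blast
        moreover have "hconst (1 / e) * hconst e = 1" using e0 by (simp add: hconst_mult[symmetric])
        ultimately have "w' = linear_form a * (hconst (1 / e) * q)"
          unfolding e linear_form_scale by (simp add: algebra_simps)
        with ndvd show False by simp
      qed
    qed
    then have "lift 0 1 b1" unfolding lift_def using b1(1) by simp
    then show False using not1 liftI_I by blast
  qed
  moreover have "lift (int k - int d) w b" using w(1) d by simp
  moreover have "int (k + r) - int d = int r + 1" using d by simp
  then have "lift (int (k + r) - int d) w' b'" using w'(1) by (simp only:)
  ultimately show thesis using that by blast
qed

end

section \<open>Logarithmic vector fields\<close>

lemma partial_superset:
  "finite A \<Longrightarrow> Poly_Mapping.keys p \<subseteq> A \<Longrightarrow> partial i p =
    (\<Sum>m\<in>A. Poly_Mapping.single (m - Poly_Mapping.single i 1)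
      (of_nat (Poly_Mapping.lookup m i) * Poly_Mapping.lookup p m))"
  unfolding partial_def by (rule sum.mono_neutral_left) (auto simp: in_keys_iff)

lemma partial_zero [simp]: "partial i 0 = 0"
  by (simp add: partial_def)

lemma partial_add: "partial i (p + q) = partial i p + partial i q"
proof -
  let ?A = "Poly_Mapping.keys p \<union> Poly_Mapping.keys q"
  have "Poly_Mapping.keys (p + q) \<subseteq> ?A" by (rule keys_add)
  then show ?thesis
    by (simp add: partial_superset[of ?A] lookup_add distrib_left single_add sum.distrib)
qed

lemma partial_sum: "partial i (sum f A) = (\<Sum>j\<in>A. partial i (f j))"
  by (induction A rule: infinite_finite_induct) (auto simp: partial_add)

lemma partial_single:
  "partial i (Poly_Mapping.single m c) =
    Poly_Mapping.single (m - Poly_Mapping.single i 1) (of_nat (Poly_Mapping.lookup m i) * c)"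
  by (subst partial_superset[of "{m}"]) auto

lemma partial_mult_single:
  fixes c c' :: "'a::comm_semiring_1"
  shows "partial i (Poly_Mapping.single m c * Poly_Mapping.single m' c') =
    partial i (Poly_Mapping.single m c) * Poly_Mapping.single m' c' +
    Poly_Mapping.single m c * partial i (Poly_Mapping.single m' c')"
proof -
  \<comment> \<open>Subtraction of exponents is truncated and commutes with adding \<open>m'\<close>
    only if \<open>i\<close> occurs in \<open>m\<close>; otherwise the coefficient is zero on both
    sides.\<close>
  have shift: "Poly_Mapping.single (m - Poly_Mapping.single i 1 + m') (of_nat (Poly_Mapping.lookup m i) * c) =
    Poly_Mapping.single (m + m' - Poly_Mapping.single i 1) (of_nat (Poly_Mapping.lookup m i) * c)"
    for m m' :: "3 \<Rightarrow>\<^sub>0 nat" and c :: 'a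
  proof (cases "Poly_Mapping.lookup m i = 0")
    case False
    have "m - Poly_Mapping.single i 1 + m' = m + m' - Poly_Mapping.single i 1"
    proof (rule poly_mapping_eqI)
      fix k
      show "Poly_Mapping.lookup (m - Poly_Mapping.single i 1 + m') k =
        Poly_Mapping.lookup (m + m' - Poly_Mapping.single i 1) k"
        using False by (cases "k = i") (simp_all add: lookup_add lookup_minus lookup_single)
    qed
    then show ?thesis by simp
  qed simp
  show ?thesis
    unfolding partial_single mult_single
    using shift[of m m' "c * c'"] shift[of m' m "c * c'"]
    by (simp add: lookup_add distrib_right distrib_left single_add mult.assoc mult.commute mult.left_commute add.commute)
qed

lemma partial_mult: "partial i (p * q) = partial i p * q + p * partial i q"
  for p q :: "'a::comm_semiring_1 hpoly"
proof (induction p rule: hpoly_induct)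
  case (single m c)
  show ?case
  proof (induction q rule: hpoly_induct)
    case (single m' c')
    show ?case by (rule partial_mult_single)
  qed (simp_all add: partial_add algebra_simps)
qed (simp_all add: partial_add algebra_simps)

lemma partial_hconst [simp]: "partial i (hconst c) = 0"
  by (simp add: hconst_def partial_single)

lemma partial_one [simp]: "partial i (1 :: 'a::comm_semiring_1 hpoly) = 0"
  using partial_hconst[of i "1 :: 'a"] by simp

lemma partial_hvar: "partial i (hvar j) = (if i = j then 1 else 0)"
  by (simp add: hvar_def partial_single lookup_single when_def)

lemma partial_linear_form: "partial i (linear_form a) = hconst (a i)"
  for a :: "3 \<Rightarrow> 'a::field"
proof -
  have "partial i (linear_form a) = (\<Sum>j\<in>UNIV. if i = j then hconst (a j) else 0)"
    unfolding linear_form_eq partial_sum by (rule sum.cong) (auto simp: partial_mult partial_hvar)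
  then show ?thesis by simp
qed

lemma partial_prod_linear_forms:
  fixes a :: "'i \<Rightarrow> 3 \<Rightarrow> 'a::field"
  assumes "finite A"
  shows "partial k (\<Prod>j\<in>A. linear_form (a j)) = (\<Sum>j\<in>A. hconst (a j k) * (\<Prod>l\<in>A - {j}. linear_form (a l)))"
  using assms
proof (induction A rule: finite_induct)
  case (insert x A)
  have "(\<Prod>l\<in>insert x A - {j}. linear_form (a l)) = linear_form (a x) * (\<Prod>l\<in>A - {j}. linear_form (a l))"
    if "j \<in> A" for j
  proof -
    have "insert x A - {j} = insert x (A - {j})" using insert(2) that by auto
    then show ?thesis using insert(1,2) by simp
  qed
  then have "(\<Sum>j\<in>A. hconst (a j k) * (\<Prod>l\<in>insert x A - {j}. linear_form (a l))) =
    linear_form (a x) * (\<Sum>j\<in>A. hconst (a j k) * (\<Prod>l\<in>A - {j}. linear_form (a l)))"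
    unfolding sum_distrib_left by (intro sum.cong) (simp_all add: algebra_simps)
  moreover have "insert x A - {x} = A" using insert(2) by auto
  ultimately show ?case
    using insert by (simp add: partial_mult partial_linear_form)
qed simp

text \<open>The derivative of \<open>linear_form a\<close> along the field
  \<open>\<theta>\<close>.\<close>

definition ev :: "(3 \<Rightarrow> 'a::field) \<Rightarrow> (3 \<Rightarrow> 'a hpoly) \<Rightarrow> 'a hpoly" where
  "ev a \<theta> = (\<Sum>i\<in>UNIV. hconst (a i) * \<theta> i)"

lemma ev_hvar [simp]: "ev a hvar = linear_form a"
  by (simp add: ev_def linear_form_eq)

lemma ev_hset: "(\<And>i. \<theta> i \<in> hset n) \<Longrightarrow> ev a \<theta> \<in> hset n"
  unfolding ev_def by (auto intro: hset_sum hset_hconst_mult)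

text \<open>The determinant with rows \<open>x\<close>, \<open>y\<close>, \<open>z\<close>. With the
  Euler field \<open>hvar\<close> as last row it is the one in Saito's criterion.\<close>

definition det3 :: "(3 \<Rightarrow> 'r::comm_ring) \<Rightarrow> (3 \<Rightarrow> 'r) \<Rightarrow> (3 \<Rightarrow> 'r) \<Rightarrow> 'r" where
  "det3 x y z = lval (cross x y) z"

lemma det3_cramer_row:
  fixes x y z a :: "3 \<Rightarrow> 'r::comm_ring"
  shows "a i * det3 x y z = lval a x * cross y z i + lval a y * cross z x i + lval a z * cross x y i"
proof -
  have "\<forall>i. a i * det3 x y z = lval a x * cross y z i + lval a y * cross z x i + lval a z * cross x y i"
    unfolding all_3 det3_def lval_3 by (simp add: algebra_simps)
  then show ?thesis ..
qed

lemma det3_cramer_col: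
  fixes x y z s :: "3 \<Rightarrow> 'r::comm_ring"
  shows "det3 x y z * s i = det3 s y z * x i + det3 x s z * y i + det3 x y s * z i"
proof -
  have "\<forall>i. det3 x y z * s i = det3 s y z * x i + det3 x s z * y i + det3 x y s * z i"
    unfolding all_3 det3_def lval_3 by (simp add: algebra_simps)
  then show ?thesis ..
qed

lemma cross_in_hset:
  fixes x y :: "3 \<Rightarrow> 'a::comm_ring_1 hpoly"
  assumes "\<And>i. x i \<in> hset m" "\<And>i. y i \<in> hset n"
  shows "cross x y i \<in> hset (m + n)"
  unfolding cross_def using assms by (auto intro!: hset_diff hset_mult)

lemma det3_in_hset:
  fixes x y z :: "3 \<Rightarrow> 'a::comm_ring_1 hpoly"
  assumes "\<And>i. x i \<in> hset m" "\<And>i. y i \<in> hset n" "\<And>i. z i \<in> hset l"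
  shows "det3 x y z \<in> hset (m + n + l)"
  unfolding det3_def lval_def by (intro hset_sum hset_mult cross_in_hset assms)

definition log_fields :: "'a::field hpoly \<Rightarrow> int \<Rightarrow> (3 \<Rightarrow> 'a hpoly) set" where
  "log_fields f n = {\<theta>. (\<forall>i. \<theta> i \<in> hset n) \<and> (\<Sum>i\<in>UNIV. partial i f * \<theta> i) = 0}"

lemma subspace_log_fields: "module.subspace fscale (log_fields f n)"
proof -
  have "(\<Sum>i\<in>UNIV. partial i f * (hconst c * \<theta> i)) = hconst c * (\<Sum>i\<in>UNIV. partial i f * \<theta> i)" for c \<theta>
    unfolding sum_distrib_left by (rule sum.cong) (simp_all add: algebra_simps)
  then show ?thesis
    unfolding subspace_fscale log_fields_def
    by (auto simp: hset_add hset_hconst_mult distrib_left sum.distrib)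
qed

section \<open>Fields tangent to the lines of an arrangement\<close>

locale arrangement =
  fixes \<alpha> :: "nat \<Rightarrow> 3 \<Rightarrow> 'a::field_char_0" and m :: nat
  assumes nonzero: "\<And>j. j < m \<Longrightarrow> \<alpha> j \<noteq> (\<lambda>_. 0)"
    and distinct: "\<And>i j. i < m \<Longrightarrow> j < m \<Longrightarrow> i \<noteq> j \<Longrightarrow> \<not> linear_form (\<alpha> i) dvd linear_form (\<alpha> j)"
begin

abbreviation "A j \<equiv> linear_form (\<alpha> j)"
abbreviation "f \<equiv> defining_poly m \<alpha>"
abbreviation "cof j \<equiv> (\<Prod>l\<in>{..<m} - {j}. A l)"

lemma f_eq: "f = (\<Prod>j\<in>{..<m}. A j)"
  by (simp add: defining_poly_def)

lemma f_cof: "j < m \<Longrightarrow> f = A j * cof j"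
  unfolding f_eq by (rule prod.remove) auto

lemma f_nonzero: "f \<noteq> 0"
  unfolding f_eq using nonzero by (simp add: linear_form_eq_0_iff)

lemma gradient: "(\<Sum>i\<in>UNIV. partial i f * \<theta> i) = (\<Sum>j<m. ev (\<alpha> j) \<theta> * cof j)"
proof -
  have "(\<Sum>i\<in>UNIV. partial i f * \<theta> i) = (\<Sum>i\<in>UNIV. \<Sum>j<m. hconst (\<alpha> j i) * \<theta> i * cof j)"
    unfolding f_eq partial_prod_linear_forms[OF finite_lessThan] sum_distrib_right
    by (intro sum.cong) (simp_all add: algebra_simps)
  also have "\<dots> = (\<Sum>j<m. \<Sum>i\<in>UNIV. hconst (\<alpha> j i) * \<theta> i * cof j)" by (rule sum.swap)
  finally show ?thesis by (simp add: ev_def sum_distrib_right)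
qed

lemma euler: "(\<Sum>i\<in>UNIV. partial i f * hvar i) = of_nat m * f"
proof -
  have "(\<Sum>j<m. ev (\<alpha> j) hvar * cof j) = (\<Sum>j<m. f)"
    by (rule sum.cong) (use f_cof in auto)
  then show ?thesis unfolding gradient by simp
qed

lemma of_nat_m: "of_nat m * f = hconst (of_nat m) * f"
  by (simp add: hconst_def)

text \<open>In the sum \<open>gradient\<close> every term but the \<open>j\<close>-th contains the
  factor \<open>A j\<close>, and \<open>A j\<close> does not divide \<open>cof j\<close>: killing
  \<open>f\<close> forces tangency to each line.\<close>

lemma log_fields_dvd:
  assumes \<theta>: "\<theta> \<in> log_fields f n" and j: "j < m"
  shows "A j dvd ev (\<alpha> j) \<theta>"
proof -
  have h: "\<And>i. \<theta> i \<in> hset n" and 0: "(\<Sum>l<m. ev (\<alpha> l) \<theta> * cof l) = 0"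
    using \<theta> gradient[of \<theta>] by (auto simp: log_fields_def)
  have "A j dvd (\<Sum>l\<in>{..<m} - {j}. ev (\<alpha> l) \<theta> * cof l)"
  proof (rule dvd_sum)
    fix l assume l: "l \<in> {..<m} - {j}"
    have "A j dvd cof l" by (rule dvd_prodI) (use l j in auto)
    then show "A j dvd ev (\<alpha> l) \<theta> * cof l" by simp
  qed
  moreover have "ev (\<alpha> j) \<theta> * cof j = - (\<Sum>l\<in>{..<m} - {j}. ev (\<alpha> l) \<theta> * cof l)"
    using 0 j by (simp add: sum.remove[of _ j] eq_neg_iff_add_eq_0)
  ultimately have "A j dvd ev (\<alpha> j) \<theta> * cof j" by simp
  moreover have "cof j \<in> hset (int (card ({..<m} - {j})))" by (rule hset_prod) auto
  moreover have "\<not> A j dvd cof j"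
    by (rule linear_form_not_dvd_prod[OF nonzero[OF j]]) (use distinct j in auto)
  ultimately show ?thesis
    using linear_form_prime[OF nonzero[OF j] ev_hset[of \<theta> n, OF h]] by blast
qed

text \<open>A field tangent to all lines multiplies \<open>f\<close> by the sum of the quotients
  \<open>q j\<close>, while the Euler field multiplies it by \<open>m\<close>. As \<open>m\<close>
  is invertible, a multiple of the Euler field corrects the first to zero.\<close>

lemma log_fieldsI:
  assumes h: "\<And>i. \<theta> i \<in> hset n" and d: "\<And>j. j < m \<Longrightarrow> A j dvd ev (\<alpha> j) \<theta>" and m: "m > 0"
  obtains p where "p \<in> hset (n - 1)" "(\<lambda>i. \<theta> i + p * hvar i) \<in> log_fields f n"
proof -
  have "\<forall>j. \<exists>q. j < m \<longrightarrow> q \<in> hset (n - 1) \<and> ev (\<alpha> j) \<theta> = A j * q"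
  proof
    fix j
    show "\<exists>q. j < m \<longrightarrow> q \<in> hset (n - 1) \<and> ev (\<alpha> j) \<theta> = A j * q"
    proof (cases "j < m")
      case True
      from linear_form_dvd_hset[OF nonzero[OF True] ev_hset[of \<theta> n, OF h] d[OF True]]
      show ?thesis by blast
    qed simp
  qed
  then obtain q where q: "\<And>j. j < m \<Longrightarrow> q j \<in> hset (n - 1)" "\<And>j. j < m \<Longrightarrow> ev (\<alpha> j) \<theta> = A j * q j"
    by metis
  define p where "p = - (hconst (1 / of_nat m) * (\<Sum>j<m. q j))"
  have p: "p \<in> hset (n - 1)"
    unfolding p_def by (intro hset_uminus hset_hconst_mult hset_sum q) simp
  have "(\<Sum>i\<in>UNIV. partial i f * \<theta> i) = (\<Sum>j<m. f * q j)"
    unfolding gradient by (rule sum.cong) (use q f_cof in \<open>auto simp: algebra_simps\<close>)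
  also have "\<dots> = f * (\<Sum>j<m. q j)" by (simp add: sum_distrib_left)
  finally have 1: "(\<Sum>i\<in>UNIV. partial i f * \<theta> i) = f * (\<Sum>j<m. q j)" .
  have "(\<Sum>i\<in>UNIV. partial i f * (p * hvar i)) = p * (\<Sum>i\<in>UNIV. partial i f * hvar i)"
    unfolding sum_distrib_left by (rule sum.cong) (simp_all add: algebra_simps)
  also have "\<dots> = hconst (of_nat m) * p * f" unfolding euler of_nat_m by (simp add: algebra_simps)
  also have "hconst (of_nat m) * p = - ((hconst (of_nat m) * hconst (1 / of_nat m)) * (\<Sum>j<m. q j))"
    unfolding p_def by (simp add: algebra_simps)
  also have "hconst (of_nat m) * hconst (1 / of_nat m) = (1 :: 'a hpoly)"
    using m unfolding hconst_mult[symmetric] by simp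
  finally have "(\<Sum>i\<in>UNIV. partial i f * (p * hvar i)) = - (f * (\<Sum>j<m. q j))" by (simp add: algebra_simps)
  with 1 have "(\<Sum>i\<in>UNIV. partial i f * (\<theta> i + p * hvar i)) = 0"
    by (simp add: distrib_left sum.distrib)
  moreover have "\<theta> i + p * hvar i \<in> hset n" for i
    using h[of i] hset_mult'[OF p hvar_in_hset, of n] by (intro hset_add) auto
  ultimately have "(\<lambda>i. \<theta> i + p * hvar i) \<in> log_fields f n"
    unfolding log_fields_def by blast
  with p that show thesis by blast
qed

lemma euler_multiple_zero:
  assumes "(\<lambda>i. p * hvar i) \<in> log_fields f n" "m > 0"
  shows "p = 0"
proof -
  have "0 = (\<Sum>i\<in>UNIV. partial i f * (p * hvar i))" using assms by (simp add: log_fields_def)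
  also have "\<dots> = p * (\<Sum>i\<in>UNIV. partial i f * hvar i)"
    unfolding sum_distrib_left by (rule sum.cong) (simp_all add: algebra_simps)
  also have "\<dots> = p * (hconst (of_nat m) * f)" unfolding euler of_nat_m ..
  finally show ?thesis using assms(2) f_nonzero by simp
qed

lemma lval_hconst: "lval (\<lambda>i. hconst (a i)) \<theta> = ev a \<theta>"
  by (simp add: lval_def ev_def)

text \<open>All three rows are tangent to every line. By Cramer's rule \<open>A j\<close> divides
  the determinant times a nonzero coefficient of \<open>\<alpha> j\<close>.\<close>

lemma log_fields_det:
  assumes \<theta>: "\<theta> \<in> log_fields f n" "\<theta>' \<in> log_fields f n'"
  obtains q where "q \<in> hset (n + n' + 1 - int m)" "det3 \<theta> \<theta>' hvar = f * q"
proof -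
  have h: "\<And>i. \<theta> i \<in> hset n" "\<And>i. \<theta>' i \<in> hset n'" using \<theta> by (auto simp: log_fields_def)
  have hd: "det3 \<theta> \<theta>' hvar \<in> hset (n + n' + 1)" by (rule det3_in_hset) (use h in auto)
  have dvd: "A j dvd det3 \<theta> \<theta>' hvar" if "j \<in> {..<m}" for j
  proof -
    have j: "j < m" using that by simp
    obtain i where i: "\<alpha> j i \<noteq> 0" using nonzero[OF j] by auto
    let ?a = "\<lambda>i. hconst (\<alpha> j i)"
    have "A j dvd hconst (\<alpha> j i) * det3 \<theta> \<theta>' hvar"
      unfolding det3_cramer_row[of ?a i \<theta> \<theta>' hvar] lval_hconst
      using log_fields_dvd[OF \<theta>(1) j] log_fields_dvd[OF \<theta>(2) j] by simp
    then have "A j dvd hconst (1 / \<alpha> j i) * (hconst (\<alpha> j i) * det3 \<theta> \<theta>' hvar)" by (rule dvd_mult)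
    also have "\<dots> = (hconst (1 / \<alpha> j i) * hconst (\<alpha> j i)) * det3 \<theta> \<theta>' hvar" by (simp add: algebra_simps)
    also have "hconst (1 / \<alpha> j i) * hconst (\<alpha> j i) = 1"
      unfolding hconst_mult[symmetric] using i by simp
    finally show ?thesis by simp
  qed
  have "\<exists>q. q \<in> hset (n + n' + 1 - int m) \<and> det3 \<theta> \<theta>' hvar = f * q"
    using prod_linear_forms_dvd[of "{..<m}" \<alpha>, OF _ _ _ hd dvd] nonzero distinct
    unfolding f_eq by (metis card_lessThan finite_lessThan lessThan_iff)
  with that show thesis by blast
qed

end

text \<open>Two lines through \<open>v\<close> play different roles: the line \<open>i0\<close> of
  the arrangement, spanned by \<open>u\<close> and \<open>v\<close>, normalizes the fields, and the
  general line spanned by \<open>u'\<close> and \<open>v\<close> serves for restriction.\<close>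

locale arrangement_at_point = arrangement \<alpha> m
  for \<alpha> :: "nat \<Rightarrow> 3 \<Rightarrow> 'a::field_char_0" and m +
  fixes i0 :: nat and u u' v :: "3 \<Rightarrow> 'a"
  assumes i0: "i0 < m" and cross_u: "cross u v = \<alpha> i0"
    and u'_generic: "\<And>i j. i < m \<Longrightarrow> j < m \<Longrightarrow> i \<noteq> j \<Longrightarrow> lval (\<alpha> i) v \<noteq> 0 \<Longrightarrow> lval (\<alpha> j) v \<noteq> 0 \<Longrightarrow>
      lval (\<alpha> i) u' * lval (\<alpha> j) v \<noteq> lval (\<alpha> j) u' * lval (\<alpha> i) v"
    and cross_u': "cross u' v \<noteq> (\<lambda>_. 0)"
begin

definition S where "S = {i. i < m \<and> lval (\<alpha> i) v \<noteq> 0}"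
text \<open>Tangency to the line \<open>i0\<close> is absorbed by the Euler field, so
  \<open>i0\<close> is left out and \<open>d\<close> is one less than the multiplicity of
  \<open>v\<close>.\<close>

definition T where "T = {i. i < m \<and> i \<noteq> i0 \<and> lval (\<alpha> i) v = 0}"
definition F where "F = (\<Prod>i\<in>T. A i)"
definition d where "d = card T"
definition c where "c i = - lval (\<alpha> i) u / lval (\<alpha> i) v"

lemma finite_T [simp]: "finite T" unfolding T_def by simp

lemma F_hset: "F \<in> hset (int d)"
  unfolding F_def d_def by (rule hset_prod) auto

lemma F_nonzero: "F \<noteq> 0"
  unfolding F_def using nonzero by (auto simp: T_def linear_form_eq_0_iff)

sublocale I: interpolation \<alpha> S F c d u' v
  by standard (use F_hset u'_generic cross_u' in \<open>auto simp: S_def\<close>)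

lemma lval_i0 [simp]: "lval (\<alpha> i0) u = 0" "lval (\<alpha> i0) v = 0"
  unfolding cross_u[symmetric] by simp_all

lemma cross_u_nonzero: "cross u v \<noteq> (\<lambda>_. 0)"
  unfolding cross_u using nonzero[OF i0] .

text \<open>After subtraction of a multiple of the Euler field, a field tangent to the line
  \<open>i0\<close> points along \<open>u\<close> and \<open>v\<close>. Tangency to the other lines
  through \<open>v\<close> forces the factor \<open>F\<close> in the coefficient of
  \<open>u\<close>.\<close>

definition field :: "'a hpoly \<Rightarrow> 'a hpoly \<Rightarrow> 'a hpoly \<Rightarrow> 3 \<Rightarrow> 'a hpoly" where
  "field w b p = (\<lambda>j. F * w * hconst (u j) + b * hconst (v j) + p * hvar j)"

lemma ev_field: "ev a (field w b p) = F * w * hconst (lval a u) + b * hconst (lval a v) + p * linear_form a"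
  unfolding ev_def field_def lval_3 sum_3 linear_form_3
  by (simp add: hconst_add hconst_mult algebra_simps)

lemma field_in_hset:
  assumes "w \<in> hset (n - int d)" "b \<in> hset n" "p \<in> hset (n - 1)"
  shows "field w b p j \<in> hset n"
proof -
  have "F * w \<in> hset n" by (rule hset_mult'[OF F_hset assms(1)]) simp
  moreover have "p * hvar j \<in> hset n" by (rule hset_mult'[OF assms(3) hvar_in_hset]) simp
  ultimately show ?thesis
    unfolding field_def using assms(2)
    by (intro hset_add) (simp_all add: mult.commute[of _ "hconst _"] hset_hconst_mult)
qed

text \<open>For a line off \<open>v\<close> the tangency condition can be solved for
  \<open>b\<close>; this is the origin of the constants \<open>c j\<close>.\<close>

lemma S_smult:
  assumes "j \<in> S"
  shows "F * w * hconst (lval (\<alpha> j) u) + b * hconst (lval (\<alpha> j) v) =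
    hconst (lval (\<alpha> j) v) * (b - hconst (c j) * F * w)"
proof -
  have "hconst (lval (\<alpha> j) v) * hconst (c j) = - hconst (lval (\<alpha> j) u)"
    using assms unfolding hconst_mult[symmetric] by (simp add: c_def S_def hconst_uminus)
  then have "hconst (lval (\<alpha> j) v) * (b - hconst (c j) * F * w) =
    hconst (lval (\<alpha> j) v) * b - (- hconst (lval (\<alpha> j) u)) * F * w"
    by (simp only: right_diff_distrib mult.assoc[symmetric])
  then show ?thesis by (simp add: algebra_simps)
qed

lemma dvd_hconst_mult_iff: "e \<noteq> 0 \<Longrightarrow> p dvd hconst e * q \<longleftrightarrow> p dvd q" for p q :: "'a hpoly"
proof
  assume e: "e \<noteq> 0" and "p dvd hconst e * q"
  then have "p dvd hconst (1 / e) * (hconst e * q)" by simp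
  also have "\<dots> = (hconst (1 / e) * hconst e) * q" by (simp add: algebra_simps)
  also have "hconst (1 / e) * hconst e = 1" unfolding hconst_mult[symmetric] using e by simp
  finally show "p dvd q" by simp
qed simp

lemma lift_to_field:
  assumes "I.lift (n - int d) w b"
  obtains p where "field w b p \<in> log_fields f n"
proof -
  have w: "w \<in> hset (n - int d)" "b \<in> hset n" using I.liftD[OF assms] by auto
  have "A j dvd ev (\<alpha> j) (field w b 0)" if j: "j < m" for j
  proof -
    consider "j = i0" | "j \<in> T" | "j \<in> S" using j unfolding S_def T_def by auto
    then show ?thesis
    proof cases
      case 1
      then show ?thesis unfolding ev_field by simp
    next
      case 2
      then have "A j dvd F" unfolding F_def by (intro dvd_prodI) auto
      with 2 show ?thesis unfolding ev_field by (simp add: T_def)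
    next
      case 3
      then show ?thesis unfolding ev_field using I.liftD(3)[OF assms 3] S_smult[OF 3, of w b] by simp
    qed
  qed
  note dvd = this
  have "m > 0" using i0 by simp
  from log_fieldsI[of "field w b 0", OF field_in_hset[OF w zero_in_hset] dvd this]
  obtain p where "(\<lambda>i. field w b 0 i + p * hvar i) \<in> log_fields f n" by blast
  moreover have "(\<lambda>i. field w b 0 i + p * hvar i) = field w b p"
    by (simp add: field_def fun_eq_iff)
  ultimately show thesis using that by simp
qed

lemma field_to_lift:
  assumes \<theta>: "\<theta> \<in> log_fields f n"
  obtains w b p where "I.lift (n - int d) w b" "\<theta> = field w b p"
proof -
  have h: "\<And>i. \<theta> i \<in> hset n" using \<theta> by (auto simp: log_fields_def)
  obtain p where p: "p \<in> hset (n - 1)" "ev (\<alpha> i0) \<theta> = A i0 * p"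
    using linear_form_dvd_hset[OF nonzero[OF i0] ev_hset[of \<theta> n, OF h] log_fields_dvd[OF \<theta> i0]] by blast
  define \<eta> where "\<eta> i = \<theta> i - p * hvar i" for i
  have ph: "p * hvar i \<in> hset n" for i by (rule hset_mult'[OF p(1) hvar_in_hset]) simp
  have \<eta>h: "\<And>i. \<eta> i \<in> hset n" unfolding \<eta>_def by (intro hset_diff h ph)
  have ev_\<eta>: "ev a \<eta> = ev a \<theta> - p * linear_form a" for a
    unfolding ev_def \<eta>_def sum_3 linear_form_3 by (simp add: algebra_simps)
  obtain a b e where hv: "\<And>j. hvar j = hconst (u j) * linear_form a + hconst (v j) * linear_form b
       + hconst (e j) * linear_form (cross u v)"
    and id: "\<And>i j. u j * a i + v j * b i + e j * cross u v i = (if i = j then 1 else 0)"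
    using dual_basis[OF cross_u_nonzero] by metis
  \<comment> \<open>\<open>p\<close> was chosen so that the derivative of the form of the line
    \<open>i0\<close> along \<open>\<eta>\<close> vanishes; in the dual basis only the coordinates
    along \<open>u\<close> and \<open>v\<close> remain.\<close>
  have ev0: "ev (cross u v) \<eta> = 0" unfolding cross_u ev_\<eta> p(2) by simp
  have \<eta>_eq: "\<eta> j = ev a \<eta> * hconst (u j) + ev b \<eta> * hconst (v j)" for j
  proof -
    have "\<eta> j = (\<Sum>i\<in>UNIV. if i = j then \<eta> i else 0)" by simp
    also have "\<dots> = (\<Sum>i\<in>UNIV. hconst (u j * a i + v j * b i + e j * cross u v i) * \<eta> i)"
      unfolding id by (rule sum.cong) auto
    also have "\<dots> = hconst (u j) * ev a \<eta> + hconst (v j) * ev b \<eta> + hconst (e j) * ev (cross u v) \<eta>"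
      unfolding ev_def sum_distrib_left sum.distrib[symmetric]
      by (rule sum.cong) (simp_all add: hconst_add hconst_mult algebra_simps)
    finally show ?thesis unfolding ev0 by (simp add: mult.commute)
  qed
  have dvd: "A j dvd ev a \<eta> * hconst (lval (\<alpha> j) u) + ev b \<eta> * hconst (lval (\<alpha> j) v)" if j: "j < m" for j
  proof -
    have "ev (\<alpha> j) \<eta> = (\<Sum>i\<in>UNIV. hconst (\<alpha> j i) * (ev a \<eta> * hconst (u i) + ev b \<eta> * hconst (v i)))"
      unfolding ev_def[of "\<alpha> j"] by (rule sum.cong, rule refl, rule arg_cong[OF \<eta>_eq])
    also have "\<dots> = ev a \<eta> * hconst (lval (\<alpha> j) u) + ev b \<eta> * hconst (lval (\<alpha> j) v)"
      unfolding sum_3 lval_3 by (simp add: hconst_add hconst_mult algebra_simps)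
    finally have "ev (\<alpha> j) \<eta> = ev a \<eta> * hconst (lval (\<alpha> j) u) + ev b \<eta> * hconst (lval (\<alpha> j) v)" .
    moreover have "A j dvd ev (\<alpha> j) \<eta>"
      unfolding ev_\<eta> using log_fields_dvd[OF \<theta> j] by simp
    ultimately show ?thesis by simp
  qed
  have "A j dvd ev a \<eta>" if j: "j \<in> T" for j
  proof -
    have jm: "j < m" "j \<noteq> i0" "lval (\<alpha> j) v = 0" using j by (auto simp: T_def)
    have "lval (\<alpha> j) u \<noteq> 0"
    proof
      assume 0: "lval (\<alpha> j) u = 0"
      have "A j = (\<Sum>i\<in>UNIV. hconst (\<alpha> j i) * hvar i)" by (rule linear_form_eq)
      also have "\<dots> = hconst (lval (\<alpha> j) u) * linear_form a + hconst (lval (\<alpha> j) v) * linear_form b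
         + hconst (lval (\<alpha> j) e) * linear_form (cross u v)"
        by (subst hv) (simp add: sum_3 lval_3 hconst_add hconst_mult algebra_simps)
      finally have "A i0 dvd A j" unfolding 0 jm(3) cross_u by simp
      then show False using distinct[OF i0 jm(1)] jm(2) by simp
    qed
    from dvd_hconst_mult_iff[OF this, of "A j" "ev a \<eta>"] dvd[OF jm(1)] show ?thesis
      unfolding jm(3) by (simp add: mult.commute)
  qed
  then obtain w where w: "w \<in> hset (n - int (card T))" "ev a \<eta> = (\<Prod>i\<in>T. A i) * w"
    using prod_linear_forms_dvd[of T \<alpha> "ev a \<eta>" n] nonzero distinct ev_hset[of \<eta> n a, OF \<eta>h]
    by (auto simp: T_def)
  then have aw: "ev a \<eta> = F * w" "w \<in> hset (n - int d)" by (simp_all add: F_def d_def)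
  have "I.lift (n - int d) w (ev b \<eta>)"
    unfolding I.lift_def
  proof (intro conjI ballI)
    show "w \<in> hset (n - int d)" by fact
    show "ev b \<eta> \<in> hset (n - int d + int d)" using ev_hset[of \<eta> n b, OF \<eta>h] by simp
    fix j assume j: "j \<in> S"
    then have jm: "j < m" "lval (\<alpha> j) v \<noteq> 0" by (auto simp: S_def)
    show "A j dvd ev b \<eta> - hconst (c j) * F * w"
      using dvd[OF jm(1)] unfolding aw(1) S_smult[OF j] dvd_hconst_mult_iff[OF jm(2)] .
  qed
  moreover have "\<theta> = field w (ev b \<eta>) p"
  proof
    fix j
    show "\<theta> j = field w (ev b \<eta>) p j"
      using \<eta>_eq[of j] unfolding field_def aw(1)[symmetric] \<eta>_def by (simp add: algebra_simps)
  qed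
  ultimately show thesis by (rule that)
qed

abbreviation "hu \<equiv> \<lambda>j. hconst (u j)"
abbreviation "hv \<equiv> \<lambda>j. hconst (v j)"

lemma det3_uv: "det3 hu hv hvar = A i0"
  unfolding det3_def cross_u[symmetric] linear_form_3 lval_3
  by (simp add: hconst_diff hconst_mult)

text \<open>This determinant and the next recover \<open>w\<close> and \<open>b\<close> from a field
  whatever its Euler part, by maps that are linear in the field.\<close>

lemma det3_field_v: "det3 (field w b p) hv hvar = A i0 * F * w"
proof -
  have "det3 (field w b p) hv hvar = F * w * det3 hu hv hvar"
    unfolding det3_def lval_3 cross_simps field_def by (simp add: algebra_simps)
  then show ?thesis unfolding det3_uv by (simp add: algebra_simps)
qed

lemma det3_field_u: "det3 hu (field w b p) hvar = A i0 * b"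
proof -
  have "det3 hu (field w b p) hvar = b * det3 hu hv hvar"
    unfolding det3_def lval_3 cross_simps field_def by (simp add: algebra_simps)
  then show ?thesis unfolding det3_uv by (simp add: algebra_simps)
qed

lemma det3_fields: "det3 (field w b p) (field w' b' p') hvar = A i0 * F * (w * b' - w' * b)"
proof -
  have "det3 (field w b p) (field w' b' p') hvar = F * (w * b' - w' * b) * det3 hu hv hvar"
    unfolding det3_def lval_3 cross_simps field_def by (simp add: algebra_simps)
  then show ?thesis unfolding det3_uv by (simp add: algebra_simps)
qed

lemma A_i0_nonzero: "A i0 \<noteq> 0"
  using nonzero[OF i0] by (simp add: linear_form_eq_0_iff)

lemma subspace_map_det3:
  assumes "module.subspace fscale V"
  shows "subspace_map fscale hscale V (\<lambda>\<theta>. det3 \<theta> hv hvar)"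
    and "subspace_map fscale hscale V (\<lambda>\<theta>. det3 hu \<theta> hvar)"
  unfolding subspace_map_def subspace_map_axioms_def
  using assms
  by (simp_all add: vector_space_fscale vector_space_hscale fscale_def hscale_def det3_def lval_3 algebra_simps)

text \<open>The fields map onto \<open>I (n - d)\<close> by their component \<open>w\<close>. On the
  kernel \<open>b\<close> ranges over the multiples of \<open>g\<close> and determines the field,
  because a multiple of the Euler field that kills \<open>f\<close> is zero.\<close>

lemma vdim_log_fields: "vdim fscale (log_fields f n) (hil (n - I.M) + I.dI (n - int d))"
proof -
  interpret t: subspace_map fscale hscale "log_fields f n" "\<lambda>\<theta>. det3 \<theta> hv hvar"
    by (rule subspace_map_det3(1)[OF subspace_log_fields])
  let ?K = "{\<theta> \<in> log_fields f n. det3 \<theta> hv hvar = 0}"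
  interpret k: subspace_map fscale hscale ?K "\<lambda>\<theta>. det3 hu \<theta> hvar"
    by (rule subspace_map_det3(2)[OF t.subspace_kernel])
  have A0: "A i0 * F \<noteq> 0" using A_i0_nonzero F_nonzero by simp
  have m0: "m > 0" using i0 by simp
  have K: "\<exists>q p. q \<in> hset (n - I.M) \<and> \<theta> = field 0 (I.g * q) p" if "\<theta> \<in> ?K" for \<theta>
  proof -
    from that obtain w b p where wb: "I.lift (n - int d) w b" "\<theta> = field w b p"
      using field_to_lift by blast
    have "w = 0" using that A0 unfolding wb(2) by (simp add: det3_field_v)
    then have b: "b \<in> hset n" "\<And>i. i \<in> S \<Longrightarrow> A i dvd b"
      using I.liftD[OF wb(1)] by simp_all
    from I.dvd_g[OF b] obtain q where "q \<in> hset (n - I.M)" "b = I.g * q" .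
    with \<open>w = 0\<close> wb(2) show ?thesis by blast
  qed
  have "{\<theta> \<in> ?K. det3 hu \<theta> hvar = 0} = {0}"
  proof (intro equalityI subsetI)
    fix \<theta> assume \<theta>: "\<theta> \<in> {\<theta> \<in> ?K. det3 hu \<theta> hvar = 0}"
    then obtain q p where q: "\<theta> = field 0 (I.g * q) p" using K by blast
    with \<theta> have "I.g * q = 0" using A_i0_nonzero by (simp add: det3_field_u)
    then have eq: "\<theta> = (\<lambda>i. p * hvar i)" unfolding q by (simp add: field_def)
    from \<theta> have "\<theta> \<in> log_fields f n" by simp
    from euler_multiple_zero[OF this[unfolded eq] m0] show "\<theta> \<in> {0}" unfolding eq by (simp add: fun_eq_iff)
  qed (use k.subspace_kernel in \<open>auto simp: subspace_fscale\<close>)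
  then have 1: "vdim fscale {\<theta> \<in> ?K. det3 hu \<theta> hvar = 0} 0"
    using vdim_trivial[OF vector_space_fscale] by simp
  have im1: "(\<lambda>\<theta>. det3 hu \<theta> hvar) ` ?K = (\<lambda>q. (A i0 * I.g) * q) ` hset (n - I.M)"
  proof (intro equalityI subsetI)
    fix z assume "z \<in> (\<lambda>\<theta>. det3 hu \<theta> hvar) ` ?K"
    then obtain \<theta> where "\<theta> \<in> ?K" "z = det3 hu \<theta> hvar" by blast
    with K[of \<theta>] obtain q p where q: "q \<in> hset (n - I.M)" "z = det3 hu (field 0 (I.g * q) p) hvar" by blast
    have "z = (A i0 * I.g) * q" unfolding q(2) det3_field_u by (simp add: algebra_simps)
    with q(1) show "z \<in> (\<lambda>q. (A i0 * I.g) * q) ` hset (n - I.M)" by (rule rev_image_eqI)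
  next
    fix z assume "z \<in> (\<lambda>q. (A i0 * I.g) * q) ` hset (n - I.M)"
    then obtain q where q: "q \<in> hset (n - I.M)" "z = (A i0 * I.g) * q" by blast
    have gq: "I.g * q \<in> hset n" by (rule hset_mult'[OF I.g_hset q(1)]) simp
    have "A i dvd I.g * q" if "i \<in> S" for i
      unfolding I.g_def using I.fin that by (intro dvd_mult2 dvd_prodI)
    then have "I.lift (n - int d) 0 (I.g * q)" unfolding I.lift_def using gq by simp
    then obtain p where p: "field 0 (I.g * q) p \<in> log_fields f n" by (rule lift_to_field)
    then have "field 0 (I.g * q) p \<in> ?K" by (simp add: det3_field_v)
    moreover have "z = det3 hu (field 0 (I.g * q) p) hvar"
      unfolding q(2) det3_field_u by (simp add: algebra_simps)
    ultimately show "z \<in> (\<lambda>\<theta>. det3 hu \<theta> hvar) ` ?K" by blast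
  qed
  interpret mg: subspace_map hscale hscale "hset (n - I.M)" "\<lambda>q. (A i0 * I.g) * q"
    by (rule subspace_map_mult[OF subspace_hset])
  have 2: "vdim hscale ((\<lambda>\<theta>. det3 hu \<theta> hvar) ` ?K) (hil (n - I.M))"
    unfolding im1 by (rule mg.vdim_image[OF vdim_hset]) (use A_i0_nonzero in simp)
  have 3: "vdim fscale ?K (hil (n - I.M))" using k.vdim_exact[OF 1 2] by simp
  have im2: "(\<lambda>\<theta>. det3 \<theta> hv hvar) ` log_fields f n = (\<lambda>w. (A i0 * F) * w) ` I.I (n - int d)"
  proof (intro equalityI subsetI)
    fix z assume "z \<in> (\<lambda>\<theta>. det3 \<theta> hv hvar) ` log_fields f n"
    then obtain \<theta> where \<theta>: "\<theta> \<in> log_fields f n" "z = det3 \<theta> hv hvar" by blast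
    from field_to_lift[OF \<theta>(1)] obtain w b p where wb: "I.lift (n - int d) w b" "\<theta> = field w b p" .
    have "z = (A i0 * F) * w" unfolding \<theta>(2) wb(2) det3_field_v ..
    with I.liftI_I[OF wb(1)] show "z \<in> (\<lambda>w. (A i0 * F) * w) ` I.I (n - int d)" by (rule rev_image_eqI)
  next
    fix z assume "z \<in> (\<lambda>w. (A i0 * F) * w) ` I.I (n - int d)"
    then obtain w where w: "w \<in> I.I (n - int d)" "z = (A i0 * F) * w" by blast
    from w(1) obtain b where "I.lift (n - int d) w b" by (rule I.IE)
    then obtain p where p: "field w b p \<in> log_fields f n" by (rule lift_to_field)
    have "z = det3 (field w b p) hv hvar" unfolding w(2) det3_field_v ..
    with p show "z \<in> (\<lambda>\<theta>. det3 \<theta> hv hvar) ` log_fields f n" by blast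
  qed
  interpret mF: subspace_map hscale hscale "I.I (n - int d)" "\<lambda>q. (A i0 * F) * q"
    by (rule subspace_map_mult[OF I.subspace_I])
  have 4: "vdim hscale ((\<lambda>\<theta>. det3 \<theta> hv hvar) ` log_fields f n) (I.dI (n - int d))"
    unfolding im2 by (rule mF.vdim_image[OF I.vdim_I]) (use A0 in simp)
  show ?thesis by (rule t.vdim_exact[OF 3 4])
qed

lemma exists_independent_log_fields:
  fixes k r :: nat
  assumes "S \<noteq> {}" "I.M + int d = 2 * int k + int r" "k \<ge> 1" "k \<le> d + 1" "d \<le> k + r"
    "I.\<delta> (I.M - 1) = int k * int (k + r) - I.M * int d"
  obtains \<theta> \<theta>' where "\<theta> \<in> log_fields f (int k)" "\<theta>' \<in> log_fields f (int (k + r))" "det3 \<theta> \<theta>' hvar \<noteq> 0"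
proof -
  obtain w b w' b' where l: "I.lift (int k - int d) w b" "I.lift (int (k + r) - int d) w' b'" "w * b' - w' * b \<noteq> 0"
    using I.exists_independent_lifts[OF assms] .
  obtain p where p: "field w b p \<in> log_fields f (int k)" using lift_to_field[OF l(1)] .
  obtain p' where p': "field w' b' p' \<in> log_fields f (int (k + r))" using lift_to_field[OF l(2)] .
  have "det3 (field w b p) (field w' b' p') hvar \<noteq> 0"
    unfolding det3_fields using l(3) A_i0_nonzero F_nonzero by simp
  with p p' that show thesis by blast
qed

end

text \<open>The points \<open>(1, t, t^2)\<close> of a conic: the form \<open>b\<close> vanishes
  there only for the finitely many roots of the nonzero polynomial
  \<open>b 0 + b 1 t + b 2 t^2\<close>.\<close>

lemma avoid_zeros:
  fixes B :: "(3 \<Rightarrow> 'a::field_char_0) set"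
  assumes "finite B" "(\<lambda>_. 0) \<notin> B"
  obtains x where "\<And>b. b \<in> B \<Longrightarrow> lval b x \<noteq> 0"
proof -
  define P where "P = (\<Prod>b\<in>B. [:b 0, b 1, b 2:])"
  have "[:b 0, b 1, b 2:] \<noteq> 0" if "b \<in> B" for b
  proof
    assume "[:b 0, b 1, b 2:] = 0"
    then have "b i = 0" for i using all_3[of "\<lambda>i. b i = 0"] by simp
    then have "b = (\<lambda>_. 0)" by blast
    with that assms(2) show False by simp
  qed
  then have "P \<noteq> 0" unfolding P_def using assms(1) by simp
  then have "finite {t. poly P t = 0}" by (rule poly_roots_finite)
  then obtain t where t: "poly P t \<noteq> 0"
    using infinite_UNIV_char_0[where 'a = 'a] by (metis (mono_tags, lifting) UNIV_eq_I mem_Collect_eq)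
  show thesis
  proof (rule that[of "\<lambda>i. if i = 0 then 1 else if i = 1 then t else t\<^sup>2"])
    fix b assume "b \<in> B"
    then have "poly [:b 0, b 1, b 2:] t \<noteq> 0"
      using t assms(1) unfolding P_def poly_prod by (auto simp: prod_zero_iff)
    then show "lval b (\<lambda>i. if i = 0 then 1 else if i = 1 then t else t\<^sup>2) \<noteq> 0"
      unfolding lval_3 by (simp add: algebra_simps power2_eq_square)
  qed
qed

lemma (in arrangement) exists_generic:
  assumes v: "v \<noteq> (\<lambda>_. 0)" and i0: "i0 < m" "lval (\<alpha> i0) v = 0"
  obtains u u' where "arrangement_at_point \<alpha> m i0 u u' v"
proof -
  obtain j where j: "v j \<noteq> 0" using v by auto
  \<comment> \<open>By the triple product formula, \<open>cross (cross a x) v\<close> is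
    \<open>- lval x v\<close> times \<open>a\<close> plus \<open>lval a v\<close> times
    \<open>x\<close>. A vector with \<open>lval x v = - 1\<close> therefore yields
    \<open>cross u v = \<alpha> i0\<close>.\<close>
  define x where "x = (\<lambda>i. if i = j then - 1 / v j else 0)"
  have "lval x v = (\<Sum>i\<in>UNIV. if i = j then - 1 else 0)"
    unfolding lval_def by (rule sum.cong) (use j in \<open>auto simp: x_def\<close>)
  then have x: "lval x v = - 1" by simp
  define u where "u = cross (\<alpha> i0) x"
  have "\<forall>i. cross u v i = - lval x v * \<alpha> i0 i + x i * lval (\<alpha> i0) v"
    unfolding all_3 u_def lval_3 by (simp add: algebra_simps)
  then have u: "cross u v = \<alpha> i0" using x i0 by auto
  \<comment> \<open>The point \<open>u'\<close> has to avoid the line \<open>i0\<close>, which makes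
    it independent of \<open>v\<close>, and the lines joining \<open>v\<close> to the intersection
    of two lines that miss \<open>v\<close>.\<close>
  define B where "B = insert (\<alpha> i0) ((\<lambda>(i, j). \<lambda>k. \<alpha> i k * lval (\<alpha> j) v - \<alpha> j k * lval (\<alpha> i) v) `
    {(i, j). i < m \<and> j < m \<and> i \<noteq> j \<and> lval (\<alpha> i) v \<noteq> 0 \<and> lval (\<alpha> j) v \<noteq> 0})"
  have "finite {(i, j). i < m \<and> j < m \<and> i \<noteq> j \<and> lval (\<alpha> i) v \<noteq> 0 \<and> lval (\<alpha> j) v \<noteq> 0}"
    by (rule finite_subset[of _ "{..<m} \<times> {..<m}"]) auto
  then have "finite B" unfolding B_def by simp
  moreover have "(\<lambda>_. 0) \<notin> B"
  proof
    assume "(\<lambda>_. 0) \<in> B"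
    then obtain i j where ij: "i < m" "j < m" "i \<noteq> j" "lval (\<alpha> j) v \<noteq> 0"
      and 0: "(\<lambda>k. \<alpha> i k * lval (\<alpha> j) v - \<alpha> j k * lval (\<alpha> i) v) = (\<lambda>_. 0)"
      unfolding B_def using nonzero[OF i0(1)] by auto
    have "\<alpha> i k = (lval (\<alpha> i) v / lval (\<alpha> j) v) * \<alpha> j k" for k
      using fun_cong[OF 0, of k] ij(4) by (simp add: field_simps)
    then have "\<alpha> i = (\<lambda>k. (lval (\<alpha> i) v / lval (\<alpha> j) v) * \<alpha> j k)" by blast
    then have "linear_form (\<alpha> i) = hconst (lval (\<alpha> i) v / lval (\<alpha> j) v) * linear_form (\<alpha> j)"
      using linear_form_scale[of "lval (\<alpha> i) v / lval (\<alpha> j) v" "\<alpha> j"] by simp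
    then have "linear_form (\<alpha> j) dvd linear_form (\<alpha> i)" by simp
    then show False using distinct[OF ij(2,1)] ij(3) by blast
  qed
  ultimately obtain u' where u': "\<And>b. b \<in> B \<Longrightarrow> lval b u' \<noteq> 0" using avoid_zeros[of B] by blast
  have "arrangement_at_point \<alpha> m i0 u u' v"
  proof
    show "i0 < m" by fact
    show "cross u v = \<alpha> i0" by fact
    show "lval (\<alpha> i) u' * lval (\<alpha> j) v \<noteq> lval (\<alpha> j) u' * lval (\<alpha> i) v"
      if "i < m" "j < m" "i \<noteq> j" "lval (\<alpha> i) v \<noteq> 0" "lval (\<alpha> j) v \<noteq> 0" for i j
    proof -
      have "(\<lambda>k. \<alpha> i k * lval (\<alpha> j) v - \<alpha> j k * lval (\<alpha> i) v) \<in> B"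
        unfolding B_def using that by auto
      from u'[OF this] show ?thesis
        unfolding lval_3 by (simp add: algebra_simps)
    qed
    show "cross u' v \<noteq> (\<lambda>_. 0)"
    proof
      assume 0: "cross u' v = (\<lambda>_. 0)"
      have "lval (cross u v) u' = - lval (cross u' v) u" unfolding lval_3 by (simp add: algebra_simps)
      also have "\<dots> = 0" unfolding 0 by (simp add: lval_3)
      finally show False using u'[of "\<alpha> i0"] unfolding u B_def by simp
    qed
  qed
  with that show thesis by blast
qed

section \<open>Points and regular sections\<close>

text \<open>For the ring acting on itself, \<open>subspace\<close> and \<open>span\<close> mean
  ideal and generated ideal.\<close>

lemma module_mult: "module ((*) :: 'r::comm_ring_1 \<Rightarrow> 'r \<Rightarrow> 'r)"
  by standard (simp_all add: algebra_simps)

lemma hcomponent_mult_general: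
  fixes p q :: "'a::comm_semiring_0 hpoly"
  shows "hcomponent n (p * q) = (\<Sum>e\<in>mon_degree ` Poly_Mapping.keys q.
    if e \<le> n then hcomponent (n - e) p * hcomponent e q else 0)"
proof -
  have "hcomponent n (p * q) = hcomponent n (\<Sum>e\<in>mon_degree ` Poly_Mapping.keys q. p * hcomponent e q)"
    by (subst sum_hcomponent[of q]) (simp add: sum_distrib_left)
  then show ?thesis by (simp add: hcomponent_sum hcomponent_mult[OF homogeneous_hcomponent])
qed

text \<open>
  The homogeneous Nullstellensatz on a basic open set: an ideal that is maximal among the
  homogeneous ones missing all powers of \<open>x\<close> is prime.
\<close>

lemma power_in_ideal:
  fixes J :: "'a::field hpoly set"
  assumes hom: "\<And>p. p \<in> J \<Longrightarrow> \<exists>d. homogeneous d p"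
    and J: "\<And>P. P \<in> proj_plane \<Longrightarrow> hvar i \<notin> P \<Longrightarrow> \<not> J \<subseteq> P"
  shows "\<exists>N. hvar i ^ N \<in> module.span (*) J"
proof (rule ccontr)
  \<comment> \<open>The identity showing that \<open>X\<close> in \<open>I + (a)\<close> and
    \<open>Y\<close> in \<open>I + (b)\<close> imply \<open>X Y\<close> in
    \<open>I + (a b)\<close>.\<close>
  have ring: "Y * (X - q * a) + (q * a * (Y - q' * b) + (q * q') * (a * b)) = X * Y"
    for X Y q q' a b :: "'a hpoly"
    by (simp add: algebra_simps)
  interpret R: module "(*) :: 'a hpoly \<Rightarrow> _" by (rule module_mult)
  assume "\<not> ?thesis"
  then have notin: "hvar i ^ N \<notin> R.span J" for N by blast
  define hid where "hid I \<longleftrightarrow> R.subspace I \<and> (\<forall>p\<in>I. \<forall>d. hcomponent d p \<in> I)" for I :: "'a hpoly set"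
  have hid_span: "hid (R.span K)" if K: "\<And>p d. p \<in> K \<Longrightarrow> hcomponent d p \<in> R.span K" for K
  proof -
    have "R.subspace {p. \<forall>d. hcomponent d p \<in> R.span K}"
      unfolding R.subspace_def
    proof (intro conjI ballI allI)
      fix q p assume p: "p \<in> {p. \<forall>d. hcomponent d p \<in> R.span K}"
      have "hcomponent n (q * p) \<in> R.span K" for n
        unfolding hcomponent_mult_general using p
        by (intro R.span_sum) (auto intro: R.span_scale R.span_zero)
      then show "q * p \<in> {p. \<forall>d. hcomponent d p \<in> R.span K}" by simp
    qed (auto simp: hcomponent_add R.span_zero intro: R.span_add)
    from R.span_minimal[OF _ this, of K] K have "R.span K \<subseteq> {p. \<forall>d. hcomponent d p \<in> R.span K}" by auto
    then show ?thesis unfolding hid_def using R.subspace_span by blast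
  qed
  define C where "C = {I. hid I \<and> J \<subseteq> I \<and> (\<forall>N. hvar i ^ N \<notin> I)}"
  have "hcomponent d p \<in> R.span J" if "p \<in> J" for p d
    using hom[OF that] R.span_base[OF that] R.span_zero by (auto simp: hcomponent_homogeneous)
  then have "R.span J \<in> C" unfolding C_def using hid_span[of J] notin R.span_superset[of J] by blast
  moreover have "\<Union>Q \<in> C" if Q: "Q \<noteq> {}" "subset.chain C Q" for Q
  proof -
    from Q have QC: "\<And>I. I \<in> Q \<Longrightarrow> I \<in> C" and ch: "\<And>I I'. I \<in> Q \<Longrightarrow> I' \<in> Q \<Longrightarrow> I \<subseteq> I' \<or> I' \<subseteq> I"
      unfolding subset_chain_def by blast+
    have sub: "\<And>I. I \<in> Q \<Longrightarrow> R.subspace I" using QC unfolding C_def hid_def by blast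
    have "R.subspace (\<Union>Q)"
      unfolding R.subspace_def
    proof (intro conjI ballI allI)
      show "0 \<in> \<Union>Q" using Q(1) R.subspace_0[OF sub] by blast
      fix x y assume "x \<in> \<Union>Q" "y \<in> \<Union>Q"
      then obtain I where "I \<in> Q" "x \<in> I" "y \<in> I" using ch by blast
      then show "x + y \<in> \<Union>Q" using R.subspace_add[OF sub] by blast
    next
      fix c x assume "x \<in> \<Union>Q"
      then show "c * x \<in> \<Union>Q" using R.subspace_scale[OF sub] by blast
    qed
    then show ?thesis using Q(1) QC unfolding C_def hid_def by blast
  qed
  ultimately obtain I where I: "I \<in> C" and max: "\<And>X. X \<in> C \<Longrightarrow> I \<subseteq> X \<Longrightarrow> X = I"
    using subset_Zorn_nonempty[of C] by (metis empty_iff)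
  have sub: "R.subspace I" and hI: "\<And>p d. p \<in> I \<Longrightarrow> hcomponent d p \<in> I" and JI: "J \<subseteq> I"
    and pw: "\<And>N. hvar i ^ N \<notin> I" using I unfolding C_def hid_def by auto
  have spI: "R.span I = I" using sub by simp
  \<comment> \<open>Otherwise the ideal generated by \<open>I\<close> and \<open>a\<close>, again
    homogeneous, would contradict maximality.\<close>
  have ex: "\<exists>N q. hvar i ^ N - q * a \<in> I" if a: "homogeneous e a" "a \<notin> I" for e a
  proof (rule ccontr)
    assume n: "\<not> ?thesis"
    have "hcomponent d p \<in> R.span (insert a I)" if "p \<in> insert a I" for p d
    proof -
      have "hcomponent d p \<in> insert a I \<or> hcomponent d p = 0"
        using that hI a(1) by (auto simp: hcomponent_homogeneous)
      then show ?thesis using R.span_base R.span_zero by metis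
    qed
    then have 1: "hid (R.span (insert a I))" by (rule hid_span)
    have 2: "I \<subseteq> R.span (insert a I)" and 3: "a \<in> R.span (insert a I)"
      using R.span_superset[of "insert a I"] by auto
    have "hvar i ^ N \<notin> R.span (insert a I)" for N
      using n unfolding R.span_insert spI by blast
    with 1 2 JI have "R.span (insert a I) \<in> C" unfolding C_def by blast
    from max[OF this 2] 3 a(2) show False by simp
  qed
  have hprime: "a \<in> I \<or> b \<in> I" if ab: "homogeneous d a" "homogeneous e b" "a * b \<in> I" for a b d e
  proof (rule ccontr)
    assume "\<not> ?thesis"
    then obtain N q N' q' where x: "hvar i ^ N - q * a \<in> I" "hvar i ^ N' - q' * b \<in> I"
      using ex[OF ab(1)] ex[OF ab(2)] by blast
    have "hvar i ^ N' * (hvar i ^ N - q * a) + (q * a * (hvar i ^ N' - q' * b) + (q * q') * (a * b)) \<in> I"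
      by (intro R.subspace_add[OF sub] R.subspace_scale[OF sub] x ab(3))
    then have "hvar i ^ (N + N') \<in> I" unfolding ring power_add .
    then show False using pw[of "N + N'"] by contradiction
  qed
  have prime: "p \<in> I \<or> q \<in> I" if pq: "p * q \<in> I" for p q
  proof (rule ccontr)
    assume n: "\<not> ?thesis"
    \<comment> \<open>Reduction to homogeneous factors: for the highest components of
      \<open>p\<close> and \<open>q\<close> outside \<open>I\<close>, the component of
      \<open>p * q\<close> in degree \<open>d + e\<close> is their product modulo
      \<open>I\<close>.\<close>
    have ex_max: "\<exists>d. hcomponent d p \<notin> I \<and> (\<forall>d'>d. hcomponent d' p \<in> I)" if "p \<notin> I" for p
    proof -
      let ?D = "{d \<in> mon_degree ` Poly_Mapping.keys p. hcomponent d p \<notin> I}"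
      have "?D \<noteq> {}"
      proof
        assume "?D = {}"
        then have "(\<Sum>d\<in>mon_degree ` Poly_Mapping.keys p. hcomponent d p) \<in> I"
          by (intro R.subspace_sum[OF sub]) auto
        then show False using that sum_hcomponent[of p] by simp
      qed
      moreover have fin: "finite ?D" by simp
      ultimately have "Max ?D \<in> ?D" by (rule Max_in[rotated])
      moreover have "hcomponent d' p \<in> I" if d': "d' > Max ?D" for d'
      proof (cases "d' \<in> mon_degree ` Poly_Mapping.keys p")
        case True
        show ?thesis
        proof (rule ccontr)
          assume "hcomponent d' p \<notin> I"
          with True have "d' \<in> ?D" by simp
          from Max_ge[OF fin this] d' show False by simp
        qed
      next
        case False
        then have "hcomponent d' p = 0"
          by (intro poly_mapping_eqI) (auto simp: lookup_hcomponent in_keys_iff)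
        then show ?thesis using R.subspace_0[OF sub] by simp
      qed
      ultimately show ?thesis by blast
    qed
    obtain d e where d: "hcomponent d p \<notin> I" "\<And>d'. d' > d \<Longrightarrow> hcomponent d' p \<in> I"
      and e: "hcomponent e q \<notin> I" "\<And>e'. e' > e \<Longrightarrow> hcomponent e' q \<in> I"
      using ex_max[of p] ex_max[of q] n by blast
    let ?t = "\<lambda>e'. if e' \<le> d + e then hcomponent (d + e - e') p * hcomponent e' q else 0"
    let ?E = "mon_degree ` Poly_Mapping.keys q"
    have eE: "e \<in> ?E"
    proof (rule ccontr)
      assume "e \<notin> ?E"
      then have "hcomponent e q = 0"
        by (intro poly_mapping_eqI) (auto simp: lookup_hcomponent in_keys_iff)
      then show False using e(1) R.subspace_0[OF sub] by simp
    qed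
    have rest: "(\<Sum>e'\<in>?E - {e}. ?t e') \<in> I"
    proof (rule R.subspace_sum[OF sub])
      fix e' assume "e' \<in> ?E - {e}"
      then consider "e' > e" | "e' < e" by fastforce
      then show "?t e' \<in> I"
      proof cases
        case 1
        then show ?thesis using R.subspace_scale[OF sub e(2)] R.subspace_0[OF sub] by simp
      next
        case 2
        then have "hcomponent (d + e - e') p \<in> I" by (intro d(2)) simp
        from R.subspace_scale[OF sub this, of "hcomponent e' q"] show ?thesis
          using R.subspace_0[OF sub] by (simp add: mult.commute)
      qed
    qed
    have "hcomponent (d + e) (p * q) = ?t e + (\<Sum>e'\<in>?E - {e}. ?t e')"
      unfolding hcomponent_mult_general by (rule sum.remove) (use eE in auto)
    then have "hcomponent d p * hcomponent e q = hcomponent (d + e) (p * q) - (\<Sum>e'\<in>?E - {e}. ?t e')"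
      by simp
    then have "hcomponent d p * hcomponent e q \<in> I"
      using R.subspace_diff[OF sub hI[OF pq] rest] by simp
    then show False using hprime[OF homogeneous_hcomponent homogeneous_hcomponent] d(1) e(1) by blast
  qed
  have "I \<in> proj_plane"
    unfolding proj_plane_def
  proof (intro CollectI conjI ballI allI impI)
    show "0 \<in> I" by (rule R.subspace_0[OF sub])
    show "p + q \<in> I" if "p \<in> I" "q \<in> I" for p q using R.subspace_add[OF sub that] .
    show "q * p \<in> I" if "p \<in> I" for p q using R.subspace_scale[OF sub that] .
    show "1 \<notin> I" using pw[of 0] by simp
    show "\<not> (\<forall>i. hvar i \<in> I)" using pw[of 1] by auto
  qed (use prime hI in auto)
  moreover have "hvar i \<notin> I" using pw[of 1] by simp
  ultimately show False using J[of I] JI by blast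
qed

section \<open>Points and basic open sets\<close>

lemma proj_planeD:
  assumes "P \<in> proj_plane"
  shows "0 \<in> P" "1 \<notin> P" "p * q \<in> P \<Longrightarrow> p \<in> P \<or> q \<in> P" "\<exists>i. hvar i \<notin> P"
  using assms unfolding proj_plane_def by blast+

lemma proj_plane_ideal: "P \<in> proj_plane \<Longrightarrow> p \<in> P \<Longrightarrow> q * p \<in> P"
  unfolding proj_plane_def by blast

lemma proj_plane_power: "P \<in> proj_plane \<Longrightarrow> p \<notin> P \<Longrightarrow> p ^ n \<notin> P"
  by (induction n) (auto dest: proj_planeD)

lemma proj_plane_prod:
  "P \<in> proj_plane \<Longrightarrow> finite A \<Longrightarrow> (\<And>j. j \<in> A \<Longrightarrow> h j \<notin> P) \<Longrightarrow> prod h A \<notin> P"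
  by (induction A rule: infinite_finite_induct) (auto dest: proj_planeD)

lemma generic_point: "{0} \<in> (proj_plane :: 'a::field pt set)"
  unfolding proj_plane_def by auto

definition basic_open :: "'a::field hpoly \<Rightarrow> 'a pt set" where
  "basic_open q = {P \<in> proj_plane. q \<notin> P}"

lemma zopen_basic_open: "zopen (basic_open q)"
  unfolding zopen_def basic_open_def zero_locus_def by (intro exI[of _ "{q}"]) auto

lemma zopen_subset: "zopen U \<Longrightarrow> U \<subseteq> proj_plane"
  unfolding zopen_def by auto

lemma zopen_inter_basic_open:
  assumes "zopen U"
  shows "zopen (U \<inter> basic_open q)"
proof -
  from assms obtain J where J: "U = proj_plane - zero_locus J" unfolding zopen_def by blast
  have "U \<inter> basic_open q = proj_plane - zero_locus ((\<lambda>p. p * q) ` J)"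
  proof (intro equalityI subsetI)
    fix P assume P: "P \<in> U \<inter> basic_open q"
    then obtain p where "P \<in> proj_plane" "p \<in> J" "p \<notin> P" "q \<notin> P"
      unfolding J basic_open_def zero_locus_def by blast
    then show "P \<in> proj_plane - zero_locus ((\<lambda>p. p * q) ` J)"
      unfolding zero_locus_def using proj_planeD(3)[of P p q] by blast
  next
    fix P assume P: "P \<in> proj_plane - zero_locus ((\<lambda>p. p * q) ` J)"
    then obtain p where p: "P \<in> proj_plane" "p \<in> J" "p * q \<notin> P"
      unfolding zero_locus_def by blast
    then have "q \<notin> P" "p \<notin> P"
      using proj_plane_ideal[of P q p] proj_plane_ideal[of P p q] by (auto simp: mult.commute)
    with p show "P \<in> U \<inter> basic_open q" unfolding J basic_open_def zero_locus_def by blast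
  qed
  then show ?thesis unfolding zopen_def by blast
qed

text \<open>All nonempty open sets share the generic point, so any two of them meet and sections can
  be compared on the intersection.\<close>

lemma generic_point_in_zopen: "zopen U \<Longrightarrow> U \<noteq> {} \<Longrightarrow> {0} \<in> U"
  unfolding zopen_def zero_locus_def using generic_point proj_planeD(1) by blast

lemma generic_point_in_basic_open: "q \<noteq> 0 \<Longrightarrow> {0} \<in> basic_open q"
  unfolding basic_open_def using generic_point by auto

lemma basic_open_cover: "P \<in> proj_plane \<Longrightarrow> \<exists>i. P \<in> basic_open (hvar i)"
  unfolding basic_open_def using proj_planeD(4) by blast

section \<open>Fractions and sections of the line bundles \<open>O(n)\<close>\<close>

definition fr :: "'a::idom \<Rightarrow> 'a fract" where "fr p = Fract p 1"

lemma fr_simps [simp]: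
  "fr 0 = 0" "fr 1 = 1" "fr (p + q) = fr p + fr q" "fr (p * q) = fr p * fr q"
  "fr (- p) = - fr p" "fr (p - q) = fr p - fr q"
  by (simp_all add: fr_def Zero_fract_def[symmetric] One_fract_def[symmetric])

lemma fr_eq_iff [simp]: "fr p = fr q \<longleftrightarrow> p = q"
  by (simp add: fr_def eq_fract)

lemma fr_eq_0_iff [simp]: "fr p = 0 \<longleftrightarrow> p = 0"
  using fr_eq_iff[of p 0] by (simp del: fr_eq_iff)

lemma fr_power [simp]: "fr (p ^ n) = fr p ^ n"
  by (induction n) simp_all

lemma fr_sum: "fr (sum g A) = (\<Sum>i\<in>A. fr (g i))"
  by (induction A rule: infinite_finite_induct) simp_all

lemma Fract_eq_fr: "Fract g h = fr g / fr h"
  by (simp add: fr_def)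

lemma twist_iff:
  assumes U: "U \<subseteq> proj_plane"
  shows "z \<in> twist n U \<longleftrightarrow> (\<forall>P\<in>U. \<exists>b g h. g \<in> hset (b + n) \<and> h \<in> hset b \<and> h \<notin> P \<and> z = fr g / fr h)"
proof (intro iffI ballI)
  fix P assume z: "z \<in> twist n U" and P: "P \<in> U"
  then obtain d e g h where *: "homogeneous d g" "homogeneous e h" "int d = int e + n" "h \<notin> P" "z = Fract g h"
    unfolding twist_def by blast
  then have "g \<in> hset (int e + n)" "h \<in> hset (int e)" by (simp_all flip: *(3))
  with * show "\<exists>b g h. g \<in> hset (b + n) \<and> h \<in> hset b \<and> h \<notin> P \<and> z = fr g / fr h"
    unfolding Fract_eq_fr by blast
next
  assume *: "\<forall>P\<in>U. \<exists>b g h. g \<in> hset (b + n) \<and> h \<in> hset b \<and> h \<notin> P \<and> z = fr g / fr h"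
  show "z \<in> twist n U"
    unfolding twist_def
  proof (intro CollectI ballI)
    fix P assume P: "P \<in> U"
    with U have PP: "P \<in> proj_plane" by blast
    from * P obtain b g h where gh: "g \<in> hset (b + n)" "h \<in> hset b" "h \<notin> P" "z = fr g / fr h" by blast
    have b: "b \<ge> 0" using gh(2,3) proj_planeD(1)[OF PP] by (cases "b < 0") (auto simp: hset_neg)
    show "\<exists>d e g h. homogeneous d g \<and> homogeneous e h \<and> int d = int e + n \<and> h \<notin> P \<and> z = Fract g h"
    proof (cases "b + n \<ge> 0")
      case True
      then show ?thesis
        using gh b unfolding hset_def Fract_eq_fr
        by (intro exI[of _ "nat (b + n)"] exI[of _ "nat b"] exI[of _ g] exI[of _ h]) auto
    next
      case False
      then have g: "g = 0" using gh(1) by (simp add: hset_neg)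
      obtain i where i: "hvar i \<notin> P" using proj_planeD(4)[OF PP] by blast
      \<comment> \<open>The numerator is zero, with a negative formal degree. A power of a variable
        outside \<open>P\<close> pads the denominator until both degrees are natural
        numbers.\<close>
      let ?h = "h * hvar i ^ nat (- (b + n))"
      have "?h \<in> hset (b + int (nat (- (b + n))))" by (intro hset_mult gh hset_power hvar_in_hset)
      then have "?h \<in> hset (int (nat (- n)))" using False b by simp
      moreover have "?h \<notin> P" using gh(3) proj_plane_power[OF PP i] proj_planeD(3)[OF PP] by blast
      moreover have "z = Fract 0 ?h" using gh(4) g by (simp add: Fract_eq_fr)
      moreover have "int 0 = int (nat (- n)) + n" using False b by simp
      ultimately show ?thesis
        unfolding hset_int using homogeneous_zero by blast
    qed
  qed
qed

lemma twist_mono: "z \<in> twist n U \<Longrightarrow> V \<subseteq> U \<Longrightarrow> z \<in> twist n V"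
  unfolding twist_def by blast

lemma twist_add:
  assumes U: "U \<subseteq> proj_plane" and z: "z \<in> twist n U" "z' \<in> twist n U"
  shows "z + z' \<in> twist n U"
  unfolding twist_iff[OF U]
proof
  fix P assume P: "P \<in> U"
  then have PP: "P \<in> proj_plane" using U by blast
  from z P obtain b g h b' g' h' where *: "g \<in> hset (b + n)" "h \<in> hset b" "h \<notin> P" "z = fr g / fr h"
    "g' \<in> hset (b' + n)" "h' \<in> hset b'" "h' \<notin> P" "z' = fr g' / fr h'"
    unfolding twist_iff[OF U] by metis
  have h0: "h \<noteq> 0" "h' \<noteq> 0" using * proj_planeD(1)[OF PP] by auto
  have "g * h' + g' * h \<in> hset (b + b' + n)"
    by (intro hset_add hset_mult'[OF *(1,6)] hset_mult'[OF *(5,2)]) simp_all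
  moreover have "h * h' \<in> hset (b + b')" by (intro hset_mult *)
  moreover have "h * h' \<notin> P" using * proj_planeD(3)[OF PP] by blast
  moreover have "z + z' = fr (g * h' + g' * h) / fr (h * h')"
    using h0 unfolding * by (simp add: field_simps)
  ultimately show "\<exists>b g h. g \<in> hset (b + n) \<and> h \<in> hset b \<and> h \<notin> P \<and> z + z' = fr g / fr h" by blast
qed

lemma twist_mult:
  assumes U: "U \<subseteq> proj_plane" and z: "z \<in> twist n U" "z' \<in> twist n' U"
  shows "z * z' \<in> twist (n + n') U"
  unfolding twist_iff[OF U]
proof
  fix P assume P: "P \<in> U"
  then have PP: "P \<in> proj_plane" using U by blast
  from z P obtain b g h b' g' h' where *: "g \<in> hset (b + n)" "h \<in> hset b" "h \<notin> P" "z = fr g / fr h"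
    "g' \<in> hset (b' + n')" "h' \<in> hset b'" "h' \<notin> P" "z' = fr g' / fr h'"
    unfolding twist_iff[OF U] by metis
  have "g * g' \<in> hset (b + b' + (n + n'))"
    by (rule hset_mult'[OF *(1,5)]) simp
  moreover have "h * h' \<in> hset (b + b')" by (intro hset_mult *)
  moreover have "h * h' \<notin> P" using * proj_planeD(3)[OF PP] by blast
  moreover have "z * z' = fr (g * g') / fr (h * h')" unfolding * by simp
  ultimately show "\<exists>b g h. g \<in> hset (b + (n + n')) \<and> h \<in> hset b \<and> h \<notin> P \<and> z * z' = fr g / fr h" by blast
qed

lemma twist_mult':
  "U \<subseteq> proj_plane \<Longrightarrow> z \<in> twist n U \<Longrightarrow> z' \<in> twist n' U \<Longrightarrow> k = n + n' \<Longrightarrow> z * z' \<in> twist k U"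
  using twist_mult by blast

lemma fr_in_twist:
  assumes "U \<subseteq> proj_plane" "p \<in> hset n"
  shows "fr p \<in> twist n U"
  unfolding twist_iff[OF assms(1)]
proof
  fix P assume "P \<in> U"
  then have "1 \<notin> P" using assms(1) proj_planeD(2) by blast
  then show "\<exists>b g h. g \<in> hset (b + n) \<and> h \<in> hset b \<and> h \<notin> P \<and> fr p = fr g / fr h"
    using assms(2) by (intro exI[of _ 0] exI[of _ p] exI[of _ 1]) simp
qed

lemma zero_in_twist: "U \<subseteq> proj_plane \<Longrightarrow> 0 \<in> twist n U"
  using fr_in_twist[of U 0 n] by simp

lemma hvar_powi_in_twist:
  fixes U :: "'a::field pt set"
  assumes "U \<subseteq> basic_open (hvar i)"
  shows "fr (hvar i) powi n \<in> twist n U"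
proof -
  have U: "U \<subseteq> proj_plane" using assms unfolding basic_open_def by blast
  show ?thesis
  proof (cases "n \<ge> 0")
    case True
    then show ?thesis
      using fr_in_twist[OF U, of "hvar i ^ nat n" n] hset_power[OF hvar_in_hset, of i "nat n"]
      by (simp add: power_int_def)
  next
    case False
    show ?thesis
      unfolding twist_iff[OF U]
    proof
      fix P assume "P \<in> U"
      then have "hvar i \<notin> P" "P \<in> proj_plane" using assms unfolding basic_open_def by blast+
      then have "hvar i ^ nat (- n) \<notin> P" using proj_plane_power by blast
      moreover have "(hvar i :: 'a hpoly) ^ nat (- n) \<in> hset (int (nat (- n)))"
        by (rule hset_power[OF hvar_in_hset])
      then have "(hvar i :: 'a hpoly) ^ nat (- n) \<in> hset (- n)" using False by simp
      moreover have "(fr (hvar i) :: 'a ratfun) powi n = fr 1 / fr (hvar i ^ nat (- n))"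
        using False by (simp add: power_int_def field_simps)
      ultimately show "\<exists>b g h. g \<in> hset (b + n) \<and> h \<in> hset b \<and> h \<notin> P \<and> (fr (hvar i) :: 'a ratfun) powi n = fr g / fr h"
        by (intro exI[of _ "- n"] exI[of _ 1] exI[of _ "hvar i ^ nat (- n)"]) simp
    qed
  qed
qed

lemma hvar_linear_form: "hvar i = linear_form (\<lambda>j. if j = i then 1 else 0)"
  for i :: 3
proof -
  have "linear_form (\<lambda>j. if j = i then 1 else 0) = (\<Sum>j\<in>UNIV. if j = i then hvar j else (0 :: 'a::field hpoly))"
    unfolding linear_form_eq by (rule sum.cong) auto
  then show ?thesis by simp
qed

lemma hvar_power_cancel:
  fixes p q :: "'a::field hpoly"
  assumes ij: "i \<noteq> j" and p: "p \<in> hset n" and eq: "hvar j ^ K * p = hvar i ^ N * q"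
  obtains p' where "p' \<in> hset (n - int N)" "p = hvar i ^ N * p'"
proof -
  define a b where "a = (\<lambda>k. if k = i then (1::'a) else 0)" and "b = (\<lambda>k. if k = j then (1::'a) else 0)"
  have a0: "a \<noteq> (\<lambda>_. 0)" unfolding a_def by (metis zero_neq_one)
  have ab: "hvar i = linear_form a" "hvar j = linear_form b" unfolding a_def b_def by (rule hvar_linear_form)+
  have "\<not> linear_form a dvd linear_form b"
  proof
    assume "linear_form a dvd linear_form b"
    then obtain c where "b = (\<lambda>k. c * a k)" using linear_form_dvd_linear_form[OF a0] by blast
    then have "b j = c * a j" by simp
    then show False using ij by (simp add: a_def b_def)
  qed
  then have "\<not> linear_form a dvd (\<Prod>k\<in>{..<K}. linear_form b)"
    by (intro linear_form_not_dvd_prod[OF a0]) auto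
  then have nd: "\<not> linear_form a dvd hvar j ^ K" unfolding ab by simp
  have "linear_form a ^ N dvd hvar j ^ K * p" using eq unfolding ab by (metis dvd_triv_left)
  from power_linear_form_dvd_cancel[OF a0 hset_power[OF hvar_in_hset] nd p this] that
  show thesis unfolding ab by blast
qed

text \<open>The possible denominators of \<open>z\<close> form an ideal containing a power of every
  variable. Powers of two different variables are coprime, so a section that admits both as
  denominators is a polynomial.\<close>

lemma twist_proj_plane:
  fixes z :: "'a::field ratfun"
  assumes "z \<in> twist n proj_plane"
  obtains p where "p \<in> hset n" "z = fr p"
proof -
  interpret R: module "(*) :: 'a hpoly \<Rightarrow> _" by (rule module_mult)
  define Q where "Q = {h. \<exists>g. fr h * z = fr g}"
  have subQ: "R.subspace Q"
    unfolding R.subspace_def Q_def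
  proof (intro conjI ballI allI)
    show "0 \<in> {h. \<exists>g. fr h * z = fr g}" by (auto intro: exI[of _ 0])
    fix x y assume "x \<in> {h. \<exists>g. fr h * z = fr g}" "y \<in> {h. \<exists>g. fr h * z = fr g}"
    then obtain g g' where "fr x * z = fr g" "fr y * z = fr g'" by blast
    then show "x + y \<in> {h. \<exists>g. fr h * z = fr g}"
      by (auto simp: distrib_right intro!: exI[of _ "g + g'"])
  next
    fix c x assume "x \<in> {h. \<exists>g. fr h * z = fr g}"
    then obtain g where "fr x * z = fr g" by blast
    then show "c * x \<in> {h. \<exists>g. fr h * z = fr g}"
      by (auto simp: mult.assoc intro!: exI[of _ "c * g"])
  qed
  have "\<exists>N g. fr (hvar i ^ N) * z = fr g" for i
  proof -
    let ?J = "{h \<in> Q. \<exists>d. homogeneous d h}"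
    have "\<exists>N. hvar i ^ N \<in> R.span ?J"
    proof (rule power_in_ideal)
      fix P :: "'a pt" assume P: "P \<in> proj_plane" "hvar i \<notin> P"
      then obtain b g h where *: "g \<in> hset (b + n)" "h \<in> hset b" "h \<notin> P" "z = fr g / fr h"
        using assms unfolding twist_iff[OF order_refl] by metis
      have "h \<noteq> 0" using * proj_planeD(1)[OF P(1)] by auto
      then have "fr h * z = fr g" unfolding * by simp
      then have "h \<in> ?J" using *(2) unfolding Q_def hset_def by blast
      then show "\<not> ?J \<subseteq> P" using *(3) by blast
    qed auto
    moreover have "R.span ?J \<subseteq> Q" by (rule R.span_minimal[OF _ subQ]) auto
    ultimately show ?thesis unfolding Q_def by blast
  qed
  then obtain N g N' g' where g: "fr (hvar 0 ^ N) * z = fr g" "fr (hvar 1 ^ N') * z = fr g'" by metis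
  have eq: "hvar 1 ^ N' * g = hvar 0 ^ N * g'"
  proof -
    have "fr (hvar 1 ^ N') * fr g = fr (hvar 0 ^ N) * fr g'" unfolding g[symmetric] by (simp add: algebra_simps)
    then show ?thesis by (simp only: fr_simps(4)[symmetric] fr_eq_iff)
  qed
  \<comment> \<open>A representation of \<open>z\<close> at the generic point shows the degree of
    \<open>g\<close>.\<close>
  obtain b a h where *: "a \<in> hset (b + n)" "h \<in> hset b" "h \<notin> {0}" "z = fr a / fr h"
    using assms generic_point unfolding twist_iff[OF order_refl] by metis
  have "fr (g * h) = fr (hvar 0 ^ N) * (z * fr h)" unfolding fr_simps(4) g(1)[symmetric] by (simp only: mult.assoc)
  also have "z * fr h = fr a" using *(3,4) by simp
  finally have "fr (g * h) = fr (hvar 0 ^ N * a)" by simp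
  then have "g * h = hvar 0 ^ N * a" by (simp only: fr_eq_iff)
  moreover have "hvar 0 ^ N * a \<in> hset (int N + (b + n))" by (intro hset_mult hset_power hvar_in_hset *)
  ultimately have "g * h \<in> hset (int N + (b + n))" by (simp only:)
  moreover have "h \<noteq> 0" using *(3) by simp
  ultimately have "g \<in> hset (int N + (b + n) - b)" using hset_cancel[OF *(2)] by blast
  then obtain p where p: "p \<in> hset (int N + (b + n) - b - int N)" "g = hvar 0 ^ N * p"
    using hvar_power_cancel[OF _ _ eq] by (metis distinct_3(1))
  have "fr (hvar 0) ^ N * z = fr (hvar 0) ^ N * fr p" using g(1) unfolding p(2) by simp
  then have "z = fr p" by simp
  with p(1) that show thesis by simp
qed

lemma twist_cover:
  fixes z :: "'a::field ratfun"
  assumes "\<And>i. z \<in> twist n (basic_open (hvar i))"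
  obtains p where "p \<in> hset n" "z = fr p"
proof -
  have "z \<in> twist n proj_plane"
    unfolding twist_def
  proof (intro CollectI ballI)
    fix P :: "'a pt" assume "P \<in> proj_plane"
    then obtain i where "P \<in> basic_open (hvar i)" using basic_open_cover by blast
    with assms[of i] show "\<exists>d e g h. homogeneous d g \<and> homogeneous e h \<and> int d = int e + n \<and> h \<notin> P \<and> z = Fract g h"
      unfolding twist_def by blast
  qed
  with that show thesis using twist_proj_plane by blast
qed

section \<open>From resolutions of sheaves to graded resolutions\<close>

abbreviation X :: "3 \<Rightarrow> 'a::field ratfun" where "X i \<equiv> fr (hvar i)"

abbreviation D :: "3 \<Rightarrow> 'a::field pt set" where "D i \<equiv> basic_open (hvar i)"

lemma D_subset: "D i \<subseteq> proj_plane"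
  unfolding basic_open_def by blast

lemma D_nonempty: "D i \<noteq> {}"
  using generic_point_in_basic_open[OF hvar_nonzero] by blast

lemma zero_in_line_sum: "U \<subseteq> proj_plane \<Longrightarrow> (\<lambda>_. 0) \<in> line_sum ns U"
  unfolding line_sum_def by (simp add: zero_in_twist)

lemma line_sum_mono: "s \<in> line_sum ns U \<Longrightarrow> V \<subseteq> U \<Longrightarrow> s \<in> line_sum ns V"
  unfolding line_sum_def using twist_mono by blast

lemma sheaf_homD:
  assumes hom: "sheaf_hom F G \<phi>" and U: "zopen U" "U \<noteq> {}" and s: "s \<in> F U"
  shows "\<phi> U s \<in> G U"
    and "t \<in> F U \<Longrightarrow> \<phi> U (\<lambda>i. s i + t i) = (\<lambda>j. \<phi> U s j + \<phi> U t j)"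
    and "c \<in> twist 0 U \<Longrightarrow> \<phi> U (\<lambda>i. c * s i) = (\<lambda>j. c * \<phi> U s j)"
    and "zopen V \<Longrightarrow> V \<noteq> {} \<Longrightarrow> V \<subseteq> U \<Longrightarrow> \<phi> V s = \<phi> U s"
proof -
  have *: "(\<forall>s\<in>F U. \<phi> U s \<in> G U) \<and>
     (\<forall>s\<in>F U. \<forall>t\<in>F U. \<phi> U (\<lambda>i. s i + t i) = (\<lambda>j. \<phi> U s j + \<phi> U t j)) \<and>
     (\<forall>c\<in>twist 0 U. \<forall>s\<in>F U. \<phi> U (\<lambda>i. c * s i) = (\<lambda>j. c * \<phi> U s j)) \<and>
     (\<forall>V. zopen V \<and> V \<noteq> {} \<and> V \<subseteq> U \<longrightarrow> (\<forall>s\<in>F U. \<phi> V s = \<phi> U s))"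
    by (rule mp[OF spec[OF hom[unfolded sheaf_hom_def], of U]]) (use U in blast)
  note c1 = conjunct1[OF *] and c2 = conjunct1[OF conjunct2[OF *]]
    and c3 = conjunct1[OF conjunct2[OF conjunct2[OF *]]] and c4 = conjunct2[OF conjunct2[OF conjunct2[OF *]]]
  show "\<phi> U s \<in> G U" by (rule bspec[OF c1 s])
  show "\<phi> U (\<lambda>i. s i + t i) = (\<lambda>j. \<phi> U s j + \<phi> U t j)" if "t \<in> F U"
    by (rule bspec[OF bspec[OF c2 s] that])
  show "\<phi> U (\<lambda>i. c * s i) = (\<lambda>j. c * \<phi> U s j)" if "c \<in> twist 0 U"
    by (rule bspec[OF bspec[OF c3 that] s])
  show "\<phi> V s = \<phi> U s" if "zopen V" "V \<noteq> {}" "V \<subseteq> U"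
    by (rule bspec[OF mp[OF spec[OF c4]] s]) (use that in blast)
qed

lemma sheaf_hom_zero:
  assumes "sheaf_hom F G \<phi>" "zopen U" "U \<noteq> {}" "(\<lambda>_. 0) \<in> F U"
  shows "\<phi> U (\<lambda>_. 0) = (\<lambda>_. 0)"
proof
  fix j
  have "\<phi> U (\<lambda>_. 0) j = \<phi> U (\<lambda>_. 0) j + \<phi> U (\<lambda>_. 0) j"
    using fun_cong[OF sheaf_homD(2)[OF assms assms(4)], of j] unfolding add_0_left .
  then show "\<phi> U (\<lambda>_. 0) j = 0" by (simp only: add_cancel_right_right)
qed

text \<open>Over \<open>D 0\<close> a sum of line bundles is free on the unit vectors times powers
  of \<open>X 0\<close>, and their images give the rows \<open>G j\<close>. Restriction maps are
  inclusions, so the formula on the intersection of \<open>U\<close> with \<open>D 0\<close> already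
  holds on \<open>U\<close>. The second conclusion records the regularity of each row on each
  \<open>D i\<close>.\<close>

lemma line_sum_hom_matrix:
  fixes H :: "('a::field, 'j) psheaf"
  assumes hom: "sheaf_hom (line_sum ns) H \<phi>"
  obtains G where
    "\<And>U s. zopen U \<Longrightarrow> U \<noteq> {} \<Longrightarrow> s \<in> line_sum ns U \<Longrightarrow> \<phi> U s = (\<lambda>l. \<Sum>j<length ns. s j * G j l)"
    "\<And>i j. j < length ns \<Longrightarrow> (\<lambda>l. X i powi (ns ! j) * G j l) \<in> H (D i)"
proof -
  note maps = sheaf_homD(1)[OF hom] and add = sheaf_homD(2)[OF hom]
  have mult: "\<phi> U (\<lambda>i. c * s i) = (\<lambda>j. c * \<phi> U s j)"
    if "zopen U" "U \<noteq> {}" "c \<in> twist 0 U" "s \<in> line_sum ns U" for U c s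
    using sheaf_homD(3)[OF hom that(1,2,4,3)] .
  have restrict: "\<phi> V s = \<phi> U s"
    if "zopen U" "U \<noteq> {}" "zopen V" "V \<noteq> {}" "V \<subseteq> U" "s \<in> line_sum ns U" for U V s
    using sheaf_homD(4)[OF hom that(1,2,6,3-5)] .
  define e where "e i j = (\<lambda>l. if l = j then X i powi (ns ! j) else (0 :: 'a ratfun))" for i j
  have e: "e i j \<in> line_sum ns U" if "j < length ns" "U \<subseteq> D i" for i j U
  proof -
    have "U \<subseteq> proj_plane" using that(2) D_subset by blast
    then show ?thesis
      unfolding line_sum_def e_def using that(1) hvar_powi_in_twist[OF that(2)] zero_in_twist by auto
  qed
  define G where "G j l = \<phi> (D 0) (e 0 j) l * X 0 powi (- (ns ! j))" for j l
  have formula: "\<phi> U s = (\<lambda>l. \<Sum>j<length ns. s j * G j l)"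
    if U: "zopen U" "U \<noteq> {}" and s: "s \<in> line_sum ns U" for U s
  proof -
    let ?V = "U \<inter> D 0"
    have V: "zopen ?V" by (rule zopen_inter_basic_open[OF U(1)])
    have V0: "?V \<noteq> {}"
      using generic_point_in_zopen[OF U] generic_point_in_basic_open[OF hvar_nonzero] by blast
    have VP: "?V \<subseteq> proj_plane" using D_subset by blast
    have sV: "s \<in> line_sum ns ?V" by (rule line_sum_mono[OF s]) simp
    have part: "(\<lambda>l. if l \<in> A then s l else 0) \<in> line_sum ns ?V \<and>
      \<phi> ?V (\<lambda>l. if l \<in> A then s l else 0) = (\<lambda>l. \<Sum>j\<in>A. s j * G j l)"
      if "finite A" "A \<subseteq> {..<length ns}" for A
      using that
    proof (induction A rule: finite_induct)
      case empty
      show ?case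
        using zero_in_line_sum[OF VP] sheaf_hom_zero[OF hom V V0] by simp
    next
      case (insert j A)
      have j: "j < length ns" using insert by simp
      define c where "c = s j * X 0 powi (- (ns ! j))"
      have c: "c \<in> twist 0 ?V"
        unfolding c_def
      proof (rule twist_mult'[OF VP])
        show "s j \<in> twist (ns ! j) ?V" using sV j unfolding line_sum_def by blast
        show "X 0 powi (- (ns ! j)) \<in> twist (- (ns ! j)) ?V" by (rule hvar_powi_in_twist) simp
      qed simp
      let ?s = "\<lambda>l. if l \<in> A then s l else 0"
      have s: "?s \<in> line_sum ns ?V" "\<phi> ?V ?s = (\<lambda>l. \<Sum>j\<in>A. s j * G j l)" using insert by simp_all
      have ce: "(\<lambda>l. c * e 0 j l) \<in> line_sum ns ?V"
        using e[OF j, of ?V 0] twist_mult[OF VP c] unfolding line_sum_def by simp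
      have eq: "(\<lambda>l. if l \<in> insert j A then s l else 0) = (\<lambda>l. ?s l + c * e 0 j l)"
        using insert(2) by (auto simp: fun_eq_iff e_def c_def power_int_minus)
      have "\<phi> ?V (\<lambda>l. c * e 0 j l) = (\<lambda>l. c * \<phi> ?V (e 0 j) l)"
        by (rule mult[OF V V0 c e[OF j]]) simp
      also have "\<phi> ?V (e 0 j) = \<phi> (D 0) (e 0 j)"
        by (rule restrict[OF zopen_basic_open D_nonempty V V0 _ e[OF j]]) auto
      also have "(\<lambda>l. c * \<phi> (D 0) (e 0 j) l) = (\<lambda>l. s j * G j l)"
        unfolding c_def G_def by (simp add: algebra_simps)
      finally have "\<phi> ?V (\<lambda>l. ?s l + c * e 0 j l) = (\<lambda>l. (\<Sum>j\<in>A. s j * G j l) + s j * G j l)"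
        unfolding add[OF V V0 s(1) ce] s(2) by simp
      moreover have "(\<lambda>l. ?s l + c * e 0 j l) \<in> line_sum ns ?V"
      proof -
        have "?s l + c * e 0 j l \<in> twist (ns ! l) ?V" if "l < length ns" for l
          using s(1) ce that unfolding line_sum_def by (intro twist_add[OF VP]) blast+
        moreover have "?s l + c * e 0 j l = 0" if "l \<ge> length ns" for l
          using s(1) ce that unfolding line_sum_def by simp
        ultimately show ?thesis unfolding line_sum_def by blast
      qed
      ultimately show ?case
        unfolding eq using insert(1,2) by (simp add: add.commute)
    qed
    have "(\<lambda>l. if l \<in> {..<length ns} then s l else 0) = s"
      using s unfolding line_sum_def by (auto simp: fun_eq_iff)
    with part[of "{..<length ns}"] have "\<phi> ?V s = (\<lambda>l. \<Sum>j<length ns. s j * G j l)" by simp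
    moreover have "\<phi> ?V s = \<phi> U s" by (rule restrict[OF U V V0 _ s]) simp
    ultimately show ?thesis by simp
  qed
  have "(\<lambda>l. X i powi (ns ! j) * G j l) \<in> H (D i)" if j: "j < length ns" for i j
  proof -
    have ej: "e i j \<in> line_sum ns (D i)" by (rule e[OF j order_refl])
    have "(\<Sum>j'<length ns. e i j j' * G j' l) = (\<Sum>j'<length ns. if j' = j then X i powi (ns ! j) * G j l else 0)" for l
      by (rule sum.cong) (auto simp: e_def)
    then have "\<phi> (D i) (e i j) = (\<lambda>l. X i powi (ns ! j) * G j l)"
      using formula[OF zopen_basic_open D_nonempty ej] j by simp
    then show ?thesis using maps[OF zopen_basic_open D_nonempty ej] by simp
  qed
  with formula that show thesis by blast
qed

text \<open>An entry that becomes regular on each \<open>D i\<close> after the same shift in degree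
  is a global section of \<open>O(b - a)\<close>; the matrix entries are therefore forms.\<close>

lemma twist_all_D:
  assumes "\<And>i. X i powi a * z \<in> twist b (D i)"
  obtains p where "p \<in> hset (b - a)" "z = fr p"
proof (rule twist_cover)
  fix i
  have "X i powi (- a) * (X i powi a * z) \<in> twist (b - a) (D i)"
    by (rule twist_mult'[OF D_subset hvar_powi_in_twist assms]) simp_all
  moreover have "X i powi (- a) * (X i powi a * z) = z"
    by (simp add: power_int_minus)
  ultimately show "z \<in> twist (b - a) (D i)" by simp
qed (use that in blast)

text \<open>The degree \<open>n\<close> part of the free graded module of twisted global sections of
  \<open>line_sum ns\<close>.\<close>

definition graded_sum :: "int list \<Rightarrow> int \<Rightarrow> (nat \<Rightarrow> 'a::field hpoly) set" where
  "graded_sum ns n = {s. (\<forall>j<length ns. s j \<in> hset (n + ns ! j)) \<and> (\<forall>j\<ge>length ns. s j = 0)}"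

lemma vdim_graded_sum: "vdim fscale (graded_sum ns n) (\<Sum>j<length ns. hil (n + ns ! j))"
  unfolding graded_sum_def by (rule vdim_product[OF vdim_hset subspace_hset])

lemma subspace_graded_sum: "module.subspace fscale (graded_sum ns n)"
  unfolding subspace_fscale graded_sum_def by (auto simp: hset_add hset_hconst_mult)

lemma graded_sum_add: "s \<in> graded_sum ns n \<Longrightarrow> t \<in> graded_sum ns n \<Longrightarrow> (\<lambda>j. s j + t j) \<in> graded_sum ns n"
  unfolding graded_sum_def by (auto simp: hset_add)

lemma graded_sum_diff: "s \<in> graded_sum ns n \<Longrightarrow> t \<in> graded_sum ns n \<Longrightarrow> (\<lambda>j. s j - t j) \<in> graded_sum ns n"
  unfolding graded_sum_def by (auto simp: hset_diff)

lemma graded_sum_mult: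
  "s \<in> graded_sum ns n \<Longrightarrow> p \<in> hset m \<Longrightarrow> k = n + m \<Longrightarrow> (\<lambda>j. p * s j) \<in> graded_sum ns k"
  unfolding graded_sum_def by (auto intro: hset_mult')

lemma graded_sum_section:
  assumes "s \<in> graded_sum ns (int n)" "U \<subseteq> D i"
  shows "(\<lambda>j. fr (s j) * X i powi (- int n)) \<in> line_sum ns U"
proof -
  have U: "U \<subseteq> proj_plane" using assms(2) D_subset by blast
  have "fr (s j) * X i powi (- int n) \<in> twist (ns ! j) U" if "j < length ns" for j
  proof (rule twist_mult'[OF U])
    show "fr (s j) \<in> twist (int n + ns ! j) U"
      using assms(1) that unfolding graded_sum_def by (intro fr_in_twist[OF U]) blast
    show "X i powi (- int n) \<in> twist (- int n) U" by (rule hvar_powi_in_twist[OF assms(2)])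
  qed simp
  moreover have "fr (s j) * X i powi (- int n) = 0" if "j \<ge> length ns" for j
    using assms(1) that unfolding graded_sum_def by simp
  ultimately show ?thesis unfolding line_sum_def by blast
qed

section \<open>Components in integer degrees, and a Koszul complex\<close>

definition hcompi :: "int \<Rightarrow> 'a::comm_monoid_add hpoly \<Rightarrow> 'a hpoly" where
  "hcompi n p = (if n < 0 then 0 else hcomponent (nat n) p)"

lemma hcompi_in_hset [simp]: "hcompi n p \<in> hset n"
  by (simp add: hcompi_def hset_def)

lemma hcompi_hset: "p \<in> hset n \<Longrightarrow> hcompi n p = p"
  by (auto simp: hcompi_def hset_def hcomponent_homogeneous)

lemma hcompi_sum: "hcompi n (sum g A) = (\<Sum>i\<in>A. hcompi n (g i))"
  by (simp add: hcompi_def hcomponent_sum)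

lemma hcompi_mult:
  fixes p q :: "'a::comm_semiring_0 hpoly"
  assumes "q \<in> hset e"
  shows "hcompi n (p * q) = hcompi (n - e) p * q"
proof (cases "e < 0 \<or> n < 0")
  case True
  then show ?thesis
  proof (cases "e < 0")
    case False
    with True have "n < 0" "n - e < 0" by auto
    then show ?thesis by (simp add: hcompi_def)
  qed (use assms in \<open>simp add: hset_neg hcompi_def\<close>)
next
  case False
  with assms have q: "homogeneous (nat e) q" by (simp add: hset_def)
  from False show ?thesis
    unfolding hcompi_def hcomponent_mult[OF q] by (auto simp: nat_diff_distrib nat_le_eq_zle)
qed

lemma lookup_hvar_power_mult:
  fixes p :: "'a::comm_semiring_1 hpoly"
  shows "Poly_Mapping.lookup (hvar i ^ N * p) k =
    (if Poly_Mapping.lookup k i \<ge> N then Poly_Mapping.lookup p (k - Poly_Mapping.single i N) else 0)"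
proof -
  have hv: "hvar i ^ N = (Poly_Mapping.single (Poly_Mapping.single i N) 1 :: 'a hpoly)"
  proof (induction N)
    case (Suc N)
    then show ?case by (simp add: hvar_def mult_single single_add[symmetric])
  qed simp
  show ?thesis
  proof (induction p rule: hpoly_induct)
    case (single m c)
    have "Poly_Mapping.single i N + m = k \<longleftrightarrow>
      Poly_Mapping.lookup k i \<ge> N \<and> m = k - Poly_Mapping.single i N"
    proof
      assume "Poly_Mapping.single i N + m = k"
      then show "Poly_Mapping.lookup k i \<ge> N \<and> m = k - Poly_Mapping.single i N"
        by (auto simp: lookup_add)
    next
      assume k: "Poly_Mapping.lookup k i \<ge> N \<and> m = k - Poly_Mapping.single i N"
      show "Poly_Mapping.single i N + m = k"
      proof (rule poly_mapping_eqI)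
        fix l
        show "Poly_Mapping.lookup (Poly_Mapping.single i N + m) l = Poly_Mapping.lookup k l"
          using k by (cases "l = i") (auto simp: lookup_add lookup_minus lookup_single)
      qed
    qed
    then show ?case unfolding hv mult_single by (auto simp: lookup_single when_def)
  qed (auto simp: lookup_add distrib_left)
qed

text \<open>Exactness of a Koszul complex, checked on monomials.\<close>

lemma koszul:
  fixes u :: "'a::field hpoly"
  assumes u: "u \<in> hset c" and eq: "hvar 2 ^ N * u = hvar 0 ^ N * a + hvar 1 ^ N * b"
  obtains a' b' where "a' \<in> hset (c - int N)" "b' \<in> hset (c - int N)" "u = hvar 0 ^ N * a' + hvar 1 ^ N * b'"
proof -
  have split: "\<exists>q \<in> hset (c - int N). \<exists>r \<in> hset c. u = hvar i ^ N * q + r \<and>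
      (\<forall>m. Poly_Mapping.lookup r m \<noteq> 0 \<longrightarrow> Poly_Mapping.lookup u m \<noteq> 0 \<and> Poly_Mapping.lookup m i < N)"
    if u: "u \<in> hset c" for i and u :: "'a hpoly"
  proof -
    let ?K = "{m \<in> Poly_Mapping.keys u. Poly_Mapping.lookup m i \<ge> N}"
    define q where "q = (\<Sum>m\<in>?K. Poly_Mapping.single (m - Poly_Mapping.single i N) (Poly_Mapping.lookup u m))"
    define r where "r = u - hvar i ^ N * q"
    have q_eq: "Poly_Mapping.lookup (hvar i ^ N * q) m = (if Poly_Mapping.lookup m i \<ge> N then Poly_Mapping.lookup u m else 0)" for m
    proof (cases "Poly_Mapping.lookup m i \<ge> N")
      case True
      have inj: "m' = m" if "m' \<in> ?K" "m' - Poly_Mapping.single i N = m - Poly_Mapping.single i N" for m'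
      proof (rule poly_mapping_eqI)
        fix l
        have "Poly_Mapping.lookup (m' - Poly_Mapping.single i N) l = Poly_Mapping.lookup (m - Poly_Mapping.single i N) l"
          using that by simp
        then show "Poly_Mapping.lookup m' l = Poly_Mapping.lookup m l"
          using that(1) True by (cases "l = i") (auto simp: lookup_minus lookup_single)
      qed
      have "Poly_Mapping.lookup q (m - Poly_Mapping.single i N) =
        (\<Sum>m'\<in>?K. if m' = m then Poly_Mapping.lookup u m' else 0)"
        unfolding q_def lookup_sum lookup_single when_def
        by (rule sum.cong) (use inj in auto)
      also have "\<dots> = Poly_Mapping.lookup u m"
        using True by (auto simp: in_keys_iff)
      finally show ?thesis unfolding lookup_hvar_power_mult using True by simp
    qed (simp add: lookup_hvar_power_mult)
    have c0: "u = 0" if "c < 0" using u that by (simp add: hset_neg)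
    have "hvar i ^ N * q \<in> hset c"
    proof (cases "c < 0")
      case True
      then have "q = 0" unfolding q_def using c0 by simp
      then show ?thesis by simp
    next
      case False
      have "homogeneous (nat c) (hvar i ^ N * q)"
        using u unfolding homogeneous_def hset_def by (auto simp: in_keys_iff q_eq split: if_splits)
      with False show ?thesis by (simp add: hset_def)
    qed
    then have qh: "q \<in> hset (c - int N)" and rh: "r \<in> hset c"
      using hset_cancel[OF hset_power[OF hvar_in_hset, of i N], of q c] u
      by (simp_all add: r_def hset_diff mult.commute)
    show ?thesis
      by (rule bexI[OF _ qh], rule bexI[OF _ rh])
         (auto simp: r_def lookup_minus q_eq split: if_splits)
  qed
  obtain a' r where a': "a' \<in> hset (c - int N)" "r \<in> hset c" "u = hvar 0 ^ N * a' + r"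
    "\<And>m. Poly_Mapping.lookup r m \<noteq> 0 \<Longrightarrow> Poly_Mapping.lookup u m \<noteq> 0 \<and> Poly_Mapping.lookup m 0 < N"
    using split[OF u, of 0] by blast
  obtain b' r' where b': "b' \<in> hset (c - int N)" "r = hvar 1 ^ N * b' + r'"
    "\<And>m. Poly_Mapping.lookup r' m \<noteq> 0 \<Longrightarrow> Poly_Mapping.lookup r m \<noteq> 0 \<and> Poly_Mapping.lookup m 1 < N"
    using split[OF a'(2), of 1] by blast
  have "r' = 0"
  proof (rule ccontr)
    assume "r' \<noteq> 0"
    then obtain m where m: "Poly_Mapping.lookup r' m \<noteq> 0"
      by (metis lookup_zero poly_mapping_eqI)
    then have m01: "Poly_Mapping.lookup m 0 < N" "Poly_Mapping.lookup m 1 < N" using a'(4) b'(3) by blast+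
    \<comment> \<open>The monomial \<open>?k\<close> still has exponents below \<open>N\<close> in
      the first two variables, but would occur in a combination of their \<open>N\<close>-th
      powers.\<close>
    let ?k = "m + Poly_Mapping.single 2 N"
    have r': "r' = u - hvar 0 ^ N * a' - hvar 1 ^ N * b'" unfolding a'(3) b'(2) by simp
    have "hvar 2 ^ N * r' = hvar 2 ^ N * u - hvar 0 ^ N * (hvar 2 ^ N * a') - hvar 1 ^ N * (hvar 2 ^ N * b')"
      unfolding r' by (simp add: algebra_simps)
    also have "\<dots> = hvar 0 ^ N * (a - hvar 2 ^ N * a') + hvar 1 ^ N * (b - hvar 2 ^ N * b')"
      unfolding eq by (simp add: algebra_simps)
    finally have "Poly_Mapping.lookup (hvar 2 ^ N * r') ?k =
      Poly_Mapping.lookup (hvar 0 ^ N * (a - hvar 2 ^ N * a') + hvar 1 ^ N * (b - hvar 2 ^ N * b')) ?k" by simp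
    also have "\<dots> = 0"
      unfolding lookup_add[of "hvar 0 ^ N * _"] lookup_hvar_power_mult using m01 by (simp add: lookup_add lookup_single)
    also have "Poly_Mapping.lookup (hvar 2 ^ N * r') ?k = Poly_Mapping.lookup r' m"
      unfolding lookup_hvar_power_mult by (simp add: lookup_add)
    finally show False using m by simp
  qed
  then have "u = hvar 0 ^ N * a' + hvar 1 ^ N * b'" using a'(3) b'(2) by simp
  with a'(1) b'(1) that show thesis by blast
qed

section \<open>The graded resolution induced by a resolution of sheaves\<close>

locale line_resolution =
  fixes f :: "'a::field hpoly" and as bs :: "int list" and \<phi> \<psi>
  assumes exact: "short_exact (line_sum bs) (line_sum as) (log_vector_fields f) \<phi> \<psi>"
begin

lemma hom_\<phi>: "sheaf_hom (line_sum bs) (line_sum as) \<phi>"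
  and hom_\<psi>: "sheaf_hom (line_sum as) (log_vector_fields f) \<psi>"
  using exact unfolding short_exact_def by blast+

lemma exact_sections:
  assumes "zopen U" "U \<noteq> {}"
  shows "inj_on (\<phi> U) (line_sum bs U)"
    and "\<phi> U ` line_sum bs U = {s \<in> line_sum as U. \<psi> U s = (\<lambda>_. 0)}"
    and "t \<in> log_vector_fields f U \<Longrightarrow> P \<in> U \<Longrightarrow>
      \<exists>V. zopen V \<and> P \<in> V \<and> V \<subseteq> U \<and> (\<exists>s\<in>line_sum as V. \<psi> V s = t)"
  using exact assms unfolding short_exact_def by blast+

definition matrices :: "(nat \<Rightarrow> 3 \<Rightarrow> 'a hpoly) \<Rightarrow> (nat \<Rightarrow> nat \<Rightarrow> 'a hpoly) \<Rightarrow> bool" where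
  "matrices g M \<longleftrightarrow> (\<forall>j<length as. \<forall>l. g j l \<in> hset (- (as ! j))) \<and>
    (\<forall>j<length bs. \<forall>l<length as. M j l \<in> hset (as ! l - bs ! j)) \<and>
    (\<forall>j<length bs. \<forall>l\<ge>length as. M j l = 0) \<and>
    (\<forall>U s. zopen U \<and> U \<noteq> {} \<and> s \<in> line_sum as U \<longrightarrow> \<psi> U s = (\<lambda>l. \<Sum>j<length as. s j * fr (g j l))) \<and>
    (\<forall>U s. zopen U \<and> U \<noteq> {} \<and> s \<in> line_sum bs U \<longrightarrow> \<phi> U s = (\<lambda>l. \<Sum>j<length bs. s j * fr (M j l)))"

lemma exists_matrices: "\<exists>g M. matrices g M"
proof -
  obtain G where G: "\<And>U s. zopen U \<Longrightarrow> U \<noteq> {} \<Longrightarrow> s \<in> line_sum as U \<Longrightarrow> \<psi> U s = (\<lambda>l. \<Sum>j<length as. s j * G j l)"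
    "\<And>i j. j < length as \<Longrightarrow> (\<lambda>l. X i powi (as ! j) * G j l) \<in> log_vector_fields f (D i)"
    using line_sum_hom_matrix[OF hom_\<psi>] by blast
  obtain G' where G': "\<And>U s. zopen U \<Longrightarrow> U \<noteq> {} \<Longrightarrow> s \<in> line_sum bs U \<Longrightarrow> \<phi> U s = (\<lambda>l. \<Sum>j<length bs. s j * G' j l)"
    "\<And>i j. j < length bs \<Longrightarrow> (\<lambda>l. X i powi (bs ! j) * G' j l) \<in> line_sum as (D i)"
    using line_sum_hom_matrix[OF hom_\<phi>] by blast
  have "\<exists>p. p \<in> hset (- (as ! j)) \<and> G j l = fr p" if j: "j < length as" for j l
  proof -
    have "X i powi (as ! j) * G j l \<in> twist 0 (D i)" for i
      using G(2)[OF j, of i] unfolding log_vector_fields_def by blast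
    then obtain p where "p \<in> hset (0 - as ! j)" "G j l = fr p" by (rule twist_all_D)
    then show ?thesis by auto
  qed
  then obtain g where g: "\<And>j l. j < length as \<Longrightarrow> g j l \<in> hset (- (as ! j)) \<and> G j l = fr (g j l)"
    by metis
  have "\<exists>p. (l < length as \<longrightarrow> p \<in> hset (as ! l - bs ! j)) \<and> (l \<ge> length as \<longrightarrow> p = 0) \<and> G' j l = fr p"
    if j: "j < length bs" for j l
  proof (cases "l < length as")
    case True
    have "X i powi (bs ! j) * G' j l \<in> twist (as ! l) (D i)" for i
      using G'(2)[OF j, of i] True unfolding line_sum_def by blast
    then obtain p where "p \<in> hset (as ! l - bs ! j)" "G' j l = fr p" by (rule twist_all_D)
    with True show ?thesis by auto
  next
    case False
    then have "X 0 powi (bs ! j) * G' j l = 0"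
      using G'(2)[OF j, of 0] unfolding line_sum_def by simp
    then have "G' j l = 0" by (simp add: power_int_eq_0_iff)
    with False show ?thesis by (intro exI[of _ 0]) simp
  qed
  then obtain M where M: "\<And>j l. j < length bs \<Longrightarrow> (l < length as \<longrightarrow> M j l \<in> hset (as ! l - bs ! j)) \<and>
      (l \<ge> length as \<longrightarrow> M j l = 0) \<and> G' j l = fr (M j l)"
    by metis
  have "\<psi> U s = (\<lambda>l. \<Sum>j<length as. s j * fr (g j l))" if "zopen U" "U \<noteq> {}" "s \<in> line_sum as U" for U s
    unfolding G(1)[OF that] using g by (intro ext sum.cong) auto
  moreover have "\<phi> U s = (\<lambda>l. \<Sum>j<length bs. s j * fr (M j l))" if "zopen U" "U \<noteq> {}" "s \<in> line_sum bs U" for U s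
    unfolding G'(1)[OF that] using M by (intro ext sum.cong) auto
  ultimately show ?thesis
    unfolding matrices_def using g M by (intro exI[of _ g] exI[of _ M]) blast
qed

definition g where "g = (SOME g. \<exists>M. matrices g M)"

definition M where "M = (SOME M. matrices g M)"

lemma matrices_g_M: "matrices g M"
proof -
  have "\<exists>M. matrices g M" unfolding g_def by (rule someI_ex[OF exists_matrices])
  then show ?thesis unfolding M_def by (rule someI_ex)
qed

lemma g_hset: "j < length as \<Longrightarrow> g j l \<in> hset (- (as ! j))"
  and M_hset: "j < length bs \<Longrightarrow> k < length as \<Longrightarrow> M j k \<in> hset (as ! k - bs ! j)"
  and M_zero: "j < length bs \<Longrightarrow> k \<ge> length as \<Longrightarrow> M j k = 0"
  and \<psi>_eq: "zopen U \<Longrightarrow> U \<noteq> {} \<Longrightarrow> s \<in> line_sum as U \<Longrightarrow> \<psi> U s = (\<lambda>l. \<Sum>j<length as. s j * fr (g j l))"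
  and \<phi>_eq: "zopen U \<Longrightarrow> U \<noteq> {} \<Longrightarrow> s \<in> line_sum bs U \<Longrightarrow> \<phi> U s = (\<lambda>l. \<Sum>j<length bs. s j * fr (M j l))"
  using matrices_g_M unfolding matrices_def by blast+

definition \<Psi> :: "(nat \<Rightarrow> 'a hpoly) \<Rightarrow> 3 \<Rightarrow> 'a hpoly" where "\<Psi> s = (\<lambda>l. \<Sum>j<length as. s j * g j l)"
definition \<Phi> :: "(nat \<Rightarrow> 'a hpoly) \<Rightarrow> nat \<Rightarrow> 'a hpoly" where "\<Phi> s = (\<lambda>l. \<Sum>j<length bs. s j * M j l)"

lemma \<Psi>_simps:
  "\<Psi> (\<lambda>j. s j + t j) = (\<lambda>l. \<Psi> s l + \<Psi> t l)" "\<Psi> (\<lambda>j. s j - t j) = (\<lambda>l. \<Psi> s l - \<Psi> t l)"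
  "\<Psi> (\<lambda>j. p * s j) = (\<lambda>l. p * \<Psi> s l)"
  by (simp_all add: \<Psi>_def algebra_simps sum.distrib sum_subtractf sum_distrib_left)

lemma \<Phi>_simps:
  "\<Phi> (\<lambda>j. s j + t j) = (\<lambda>l. \<Phi> s l + \<Phi> t l)" "\<Phi> (\<lambda>j. s j - t j) = (\<lambda>l. \<Phi> s l - \<Phi> t l)"
  "\<Phi> (\<lambda>j. p * s j) = (\<lambda>l. p * \<Phi> s l)"
  by (simp_all add: \<Phi>_def algebra_simps sum.distrib sum_subtractf sum_distrib_left)

text \<open>Dehomogenization: a tuple of degree \<open>n\<close> becomes a section over
  \<open>D i\<close> of the untwisted sheaf.\<close>

definition sec :: "3 \<Rightarrow> nat \<Rightarrow> ('i \<Rightarrow> 'a hpoly) \<Rightarrow> 'i \<Rightarrow> 'a ratfun" where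
  "sec i n s = (\<lambda>j. fr (s j) * X i powi (- int n))"

lemma sec_eq_0_iff: "sec i n s = (\<lambda>_. 0) \<longleftrightarrow> s = (\<lambda>_. 0)"
  by (simp add: sec_def fun_eq_iff power_int_eq_0_iff)

lemma sec_in_line_sum: "s \<in> graded_sum ns (int n) \<Longrightarrow> U \<subseteq> D i \<Longrightarrow> sec i n s \<in> line_sum ns U"
  unfolding sec_def by (rule graded_sum_section)

lemma \<psi>_sec:
  assumes "s \<in> graded_sum as (int n)" "zopen U" "U \<noteq> {}" "U \<subseteq> D i"
  shows "\<psi> U (sec i n s) = sec i n (\<Psi> s)"
  unfolding \<psi>_eq[OF assms(2,3) sec_in_line_sum[OF assms(1,4)]]
  by (simp add: sec_def \<Psi>_def fr_sum sum_distrib_left sum_distrib_right algebra_simps)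

lemma \<phi>_sec:
  assumes "s \<in> graded_sum bs (int n)" "zopen U" "U \<noteq> {}" "U \<subseteq> D i"
  shows "\<phi> U (sec i n s) = sec i n (\<Phi> s)"
  unfolding \<phi>_eq[OF assms(2,3) sec_in_line_sum[OF assms(1,4)]]
  by (simp add: sec_def \<Phi>_def fr_sum sum_distrib_left sum_distrib_right algebra_simps)

lemma \<Phi>_graded:
  assumes "t \<in> graded_sum bs n"
  shows "\<Phi> t \<in> graded_sum as n"
proof -
  have "t j * M j l \<in> hset (n + as ! l)" if "j < length bs" "l < length as" for j l
    by (rule hset_mult'[OF _ M_hset[OF that]]) (use assms that in \<open>auto simp: graded_sum_def\<close>)
  then show ?thesis unfolding graded_sum_def \<Phi>_def by (auto intro!: hset_sum simp: M_zero)
qed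

lemma \<Phi>_inject:
  assumes "t \<in> graded_sum bs (int n)" "\<Phi> t = (\<lambda>_. 0)"
  shows "t = (\<lambda>_. 0)"
proof -
  note D = zopen_basic_open[of "hvar 0 :: 'a hpoly"] D_nonempty[of 0]
  have "\<phi> (D 0) (sec 0 n t) = (\<lambda>_. 0)"
    unfolding \<phi>_sec[OF assms(1) D order_refl] sec_eq_0_iff by (rule assms(2))
  also have "\<dots> = \<phi> (D 0) (\<lambda>_. 0)"
    using sheaf_hom_zero[OF hom_\<phi> D zero_in_line_sum[OF D_subset]] by simp
  finally have "sec 0 n t = (\<lambda>_. 0)"
    using exact_sections(1)[OF D] sec_in_line_sum[OF assms(1) order_refl] zero_in_line_sum[OF D_subset]
    by (auto dest: inj_onD)
  then show ?thesis unfolding sec_eq_0_iff .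
qed

lemma \<Psi>_\<Phi>:
  assumes "t \<in> graded_sum bs (int n)"
  shows "\<Psi> (\<Phi> t) = (\<lambda>_. 0)"
proof -
  note D = zopen_basic_open[of "hvar 0 :: 'a hpoly"] D_nonempty[of 0]
  have "\<phi> (D 0) (sec 0 n t) \<in> \<phi> (D 0) ` line_sum bs (D 0)"
    using sec_in_line_sum[OF assms order_refl] by blast
  then have "\<psi> (D 0) (\<phi> (D 0) (sec 0 n t)) = (\<lambda>_. 0)"
    unfolding exact_sections(2)[OF D] by blast
  then show ?thesis
    unfolding \<phi>_sec[OF assms D order_refl] \<psi>_sec[OF \<Phi>_graded[OF assms] D order_refl] sec_eq_0_iff .
qed

text \<open>Exactness gives a preimage over each \<open>D i\<close>. Multiplied by
  \<open>X i ^ n\<close> these preimages agree, since \<open>\<phi>\<close> is injective on the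
  overlaps, and a family of entries regular on all \<open>D i\<close> consists of forms.\<close>

lemma kernel_\<Psi>:
  assumes s: "s \<in> graded_sum as (int n)" and 0: "\<Psi> s = (\<lambda>_. 0)"
  obtains t where "t \<in> graded_sum bs (int n)" "\<Phi> t = s"
proof -
  have "\<exists>t. t \<in> line_sum bs (D i) \<and> \<phi> (D i) t = sec i n s" for i
  proof -
    note D = zopen_basic_open[of "hvar i :: 'a hpoly"] D_nonempty[of i]
    have "\<psi> (D i) (sec i n s) = (\<lambda>_. 0)"
      unfolding \<psi>_sec[OF s D order_refl] sec_eq_0_iff by (rule 0)
    then have "sec i n s \<in> \<phi> (D i) ` line_sum bs (D i)"
      unfolding exact_sections(2)[OF D] using sec_in_line_sum[OF s order_refl] by blast
    then obtain t where "sec i n s = \<phi> (D i) t" "t \<in> line_sum bs (D i)" by (rule imageE)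
    then show ?thesis by (intro exI[of _ t]) simp
  qed
  then obtain t where t: "\<And>i. t i \<in> line_sum bs (D i)" "\<And>i. \<phi> (D i) (t i) = sec i n s" by metis
  have tform: "(\<Sum>j<length bs. t i j * fr (M j l)) = fr (s l) * X i powi (- int n)" for i l
    using t(2)[of i] unfolding \<phi>_eq[OF zopen_basic_open D_nonempty t(1)] sec_def by (rule fun_cong)
  define T where "T i j = X i powi int n * t i j" for i j
  have T0: "T i = T 0" for i
  proof -
    let ?W = "D i \<inter> D 0 :: 'a pt set"
    have W: "zopen ?W" "?W \<noteq> {}"
      using zopen_inter_basic_open[OF zopen_basic_open] generic_point_in_basic_open[OF hvar_nonzero] by blast+
    have WP: "?W \<subseteq> proj_plane" using D_subset by blast
    define t' where "t' j = X 0 powi (- int n) * T i j" for j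
    have t0: "t 0 \<in> line_sum bs ?W" by (rule line_sum_mono[OF t(1)]) simp
    have ti: "t i \<in> line_sum bs ?W" by (rule line_sum_mono[OF t(1)]) simp
    have "t' j \<in> twist (bs ! j) ?W" if "j < length bs" for j
    proof -
      have "t i j \<in> twist (bs ! j) ?W" using ti that unfolding line_sum_def by blast
      then have "T i j \<in> twist (int n + bs ! j) ?W"
        unfolding T_def by (intro twist_mult[OF WP hvar_powi_in_twist]) auto
      then have "t' j \<in> twist (- int n + (int n + bs ! j)) ?W"
        unfolding t'_def by (intro twist_mult[OF WP hvar_powi_in_twist]) auto
      then show ?thesis by simp
    qed
    moreover have "t' j = 0" if "j \<ge> length bs" for j
      using ti that unfolding line_sum_def t'_def T_def by simp
    ultimately have t': "t' \<in> line_sum bs ?W" unfolding line_sum_def by blast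
    have "\<phi> ?W t' = \<phi> ?W (t 0)"
      unfolding \<phi>_eq[OF W t'] \<phi>_eq[OF W t0]
    proof
      fix l
      have "(\<Sum>j<length bs. t' j * fr (M j l)) = X 0 powi (- int n) * (X i powi int n * (\<Sum>j<length bs. t i j * fr (M j l)))"
        by (simp add: t'_def T_def sum_distrib_left algebra_simps)
      also have "\<dots> = X 0 powi (- int n) * fr (s l)"
        unfolding tform by (simp add: power_int_minus field_simps)
      also have "\<dots> = (\<Sum>j<length bs. t 0 j * fr (M j l))" unfolding tform by (simp add: mult.commute)
      finally show "(\<Sum>j<length bs. t' j * fr (M j l)) = (\<Sum>j<length bs. t 0 j * fr (M j l))" .
    qed
    then have "t' = t 0" using exact_sections(1)[OF W] t' t0 by (auto dest: inj_onD)
    show ?thesis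
    proof
      fix j
      have "T i j = X 0 powi int n * t' j" unfolding t'_def by (simp add: power_int_minus)
      also have "\<dots> = T 0 j" unfolding \<open>t' = t 0\<close> T_def ..
      finally show "T i j = T 0 j" .
    qed
  qed
  have "\<exists>p. (j < length bs \<longrightarrow> p \<in> hset (int n + bs ! j)) \<and> (j \<ge> length bs \<longrightarrow> p = 0) \<and> T 0 j = fr p" for j
  proof (cases "j < length bs")
    case True
    have "T 0 j \<in> twist (int n + bs ! j) (D i)" for i
      unfolding T0[of i, symmetric] T_def
    proof (rule twist_mult'[OF D_subset hvar_powi_in_twist])
      show "t i j \<in> twist (bs ! j) (D i)" using t(1)[of i] True unfolding line_sum_def by blast
    qed simp_all
    then obtain p where "p \<in> hset (int n + bs ! j)" "T 0 j = fr p" by (rule twist_cover)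
    with True show ?thesis by auto
  next
    case False
    then have "T 0 j = 0" unfolding T_def using t(1)[of 0] unfolding line_sum_def by simp
    with False show ?thesis by (intro exI[of _ 0]) simp
  qed
  then obtain t' where t': "\<And>j. (j < length bs \<longrightarrow> t' j \<in> hset (int n + bs ! j)) \<and> (j \<ge> length bs \<longrightarrow> t' j = 0)"
    "\<And>j. T 0 j = fr (t' j)" by metis
  have "t' \<in> graded_sum bs (int n)" unfolding graded_sum_def using t'(1) by blast
  moreover have "\<Phi> t' = s"
  proof
    fix l
    have "fr (\<Phi> t' l) = X 0 powi int n * (\<Sum>j<length bs. t 0 j * fr (M j l))"
      unfolding \<Phi>_def fr_sum fr_simps t'(2)[symmetric] T_def by (simp add: sum_distrib_left algebra_simps)
    also have "\<dots> = fr (s l)" unfolding tform by (simp add: power_int_minus field_simps)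
    finally show "\<Phi> t' l = s l" by simp
  qed
  ultimately show thesis by (rule that)
qed

text \<open>The entries of \<open>g\<close> are homogeneous, so the components of \<open>s\<close>
  in the matching degrees already have the same image.\<close>

lemma \<Psi>_homogenize:
  assumes "\<And>l. \<Psi> s l \<in> hset n"
  shows "\<exists>s'. s' \<in> graded_sum as n \<and> \<Psi> s' = \<Psi> s"
proof -
  define s' where "s' j = (if j < length as then hcompi (n + as ! j) (s j) else 0)" for j
  have "s' \<in> graded_sum as n" unfolding graded_sum_def s'_def by simp
  moreover have "\<Psi> s' l = \<Psi> s l" for l
  proof -
    have "\<Psi> s l = hcompi n (\<Psi> s l)" using hcompi_hset[OF assms] by simp
    also have "\<dots> = (\<Sum>j<length as. hcompi (n - - (as ! j)) (s j) * g j l)"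
      unfolding \<Psi>_def hcompi_sum by (rule sum.cong) (simp_all only: hcompi_mult[OF g_hset] lessThan_iff)
    also have "\<dots> = \<Psi> s' l" unfolding \<Psi>_def s'_def by (rule sum.cong) simp_all
    finally show ?thesis ..
  qed
  ultimately show ?thesis by blast
qed

text \<open>The polynomials that multiply \<open>\<theta>\<close> into the image form an ideal.
  Local surjectivity at a point of \<open>D i\<close> provides a homogeneous member that is nonzero
  there, so the ideal contains a power of \<open>hvar i\<close>.\<close>

lemma power_multiple_in_image:
  assumes \<theta>: "\<theta> \<in> log_fields f (int n)"
  shows "\<exists>N s. s \<in> graded_sum as (int n + int N) \<and> \<Psi> s = (\<lambda>l. hvar i ^ N * \<theta> l)"
proof -
  have ring: "p * (q * a) = (p * q) * a" "(p + q) * a = p * a + q * a" for p q a :: "'a hpoly"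
    by (simp_all add: algebra_simps)
  interpret R: module "(*) :: 'a hpoly \<Rightarrow> _" by (rule module_mult)
  define Q where "Q = {h. \<exists>s. \<Psi> s = (\<lambda>l. h * \<theta> l)}"
  have subQ: "R.subspace Q"
    unfolding R.subspace_def
  proof (intro conjI ballI allI)
    show "0 \<in> Q" unfolding Q_def by (intro CollectI exI[of _ "\<lambda>_. 0"]) (simp add: \<Psi>_def)
  next
    fix x y assume "x \<in> Q" "y \<in> Q"
    then obtain s t where "\<Psi> s = (\<lambda>l. x * \<theta> l)" "\<Psi> t = (\<lambda>l. y * \<theta> l)" unfolding Q_def by blast
    then have "\<Psi> (\<lambda>j. s j + t j) = (\<lambda>l. (x + y) * \<theta> l)" unfolding \<Psi>_simps ring by simp
    then show "x + y \<in> Q" unfolding Q_def by blast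
  next
    fix c x assume "x \<in> Q"
    then obtain s where "\<Psi> s = (\<lambda>l. x * \<theta> l)" unfolding Q_def by blast
    then have "\<Psi> (\<lambda>j. c * s j) = (\<lambda>l. (c * x) * \<theta> l)" unfolding \<Psi>_simps by (simp only: ring(1))
    then show "c * x \<in> Q" unfolding Q_def by blast
  qed
  let ?J = "{h \<in> Q. \<exists>d. homogeneous d h}"
  have sec: "sec i n \<theta> \<in> log_vector_fields f (D i)"
    unfolding log_vector_fields_def
  proof (intro CollectI conjI allI)
    fix l
    show "sec i n \<theta> l \<in> twist 0 (D i)"
      unfolding sec_def
    proof (rule twist_mult'[OF D_subset])
      show "fr (\<theta> l) \<in> twist (int n) (D i)"
        by (rule fr_in_twist[OF D_subset]) (use \<theta> in \<open>simp add: log_fields_def\<close>)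
      show "X i powi (- int n) \<in> twist (- int n) (D i)" by (rule hvar_powi_in_twist) simp
    qed simp
  next
    have "(\<Sum>l\<in>UNIV. Fract (partial l f) 1 * sec i n \<theta> l) = fr (\<Sum>l\<in>UNIV. partial l f * \<theta> l) * X i powi (- int n)"
      unfolding sec_def Fract_eq_fr fr_sum sum_distrib_right by (rule sum.cong) (simp_all add: algebra_simps)
    then show "(\<Sum>l\<in>UNIV. Fract (partial l f) 1 * sec i n \<theta> l) = 0"
      using \<theta> by (simp add: log_fields_def)
  qed
  have "\<exists>N. hvar i ^ N \<in> R.span ?J"
  proof (rule power_in_ideal)
    fix P :: "'a pt" assume P: "P \<in> proj_plane" "hvar i \<notin> P"
    then have PD: "P \<in> D i" unfolding basic_open_def by blast
    from exact_sections(3)[OF zopen_basic_open D_nonempty sec PD]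
    obtain V s where V: "zopen V" "P \<in> V" "s \<in> line_sum as V" "\<psi> V s = sec i n \<theta>" by blast
    have VP: "V \<subseteq> proj_plane" by (rule zopen_subset[OF V(1)])
    have V0: "V \<noteq> {}" using V(2) by blast
    have "\<forall>j. \<exists>e a b. j < length as \<longrightarrow> b \<in> hset e \<and> b \<notin> P \<and> s j = fr a / fr b"
    proof
      fix j
      show "\<exists>e a b. j < length as \<longrightarrow> b \<in> hset e \<and> b \<notin> P \<and> s j = fr a / fr b"
      proof (cases "j < length as")
        case True
        then have "s j \<in> twist (as ! j) V" using V(3) unfolding line_sum_def by blast
        then obtain e a b where "b \<in> hset e" "b \<notin> P" "s j = fr a / fr b"
          using V(2) unfolding twist_iff[OF VP] by blast
        then show ?thesis by blast
      qed simp
    qed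
    then obtain e a b where ab: "\<And>j. j < length as \<Longrightarrow> b j \<in> hset (e j) \<and> b j \<notin> P \<and> s j = fr (a j) / fr (b j)"
      by metis
    define h where "h = (\<Prod>j<length as. b j)"
    define c where "c j = (\<Prod>j'\<in>{..<length as} - {j}. b j')" for j
    have bn: "b j \<noteq> 0" if "j < length as" for j using ab[OF that] proj_planeD(1)[OF P(1)] by auto
    have h_eq: "h = b j * c j" if "j < length as" for j
      unfolding h_def c_def by (rule prod.remove) (use that in auto)
    have hP: "h \<notin> P" unfolding h_def by (rule proj_plane_prod[OF P(1)]) (use ab in auto)
    have "homogeneous (\<Sum>j<length as. nat (e j)) h"
      unfolding h_def by (rule homogeneous_prod) (use ab in \<open>auto simp: hset_def\<close>)
    moreover have "h \<in> Q"
    proof -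
      have hs: "fr h * s j = fr (a j * c j)" if "j < length as" for j
        using ab[OF that] bn[OF that] unfolding h_eq[OF that] by simp
      \<comment> \<open>\<open>c j\<close> brings the local preimage to the common denominator
        \<open>h\<close>, and \<open>hvar i ^ n\<close> undoes the division in
        \<open>sec\<close>.\<close>
      have "\<Psi> (\<lambda>j. hvar i ^ n * (a j * c j)) l = h * \<theta> l" for l
      proof -
        have "fr (\<Psi> (\<lambda>j. hvar i ^ n * (a j * c j)) l) = (\<Sum>j<length as. X i ^ n * fr (a j * c j) * fr (g j l))"
          unfolding \<Psi>_def fr_sum by (simp only: fr_simps(4) fr_power)
        also have "\<dots> = (\<Sum>j<length as. X i ^ n * (fr h * s j) * fr (g j l))"
          by (rule sum.cong) (simp_all only: hs lessThan_iff)
        also have "\<dots> = X i ^ n * fr h * (\<Sum>j<length as. s j * fr (g j l))"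
          unfolding sum_distrib_left by (rule sum.cong) (simp_all only: mult_ac)
        also have "(\<Sum>j<length as. s j * fr (g j l)) = sec i n \<theta> l"
          using fun_cong[OF \<psi>_eq[OF V(1) V0 V(3)], of l] unfolding V(4) by (rule sym)
        also have "X i ^ n * fr h * sec i n \<theta> l = fr (h * \<theta> l)"
          unfolding sec_def by (simp add: power_int_minus)
        finally show ?thesis by (simp only: fr_eq_iff)
      qed
      then show ?thesis unfolding Q_def by blast
    qed
    ultimately show "\<not> ?J \<subseteq> P" using hP by blast
  qed auto
  moreover have "R.span ?J \<subseteq> Q" by (rule R.span_minimal[OF _ subQ]) auto
  ultimately obtain N s where Ns: "\<Psi> s = (\<lambda>l. hvar i ^ N * \<theta> l)" unfolding Q_def by blast
  have "hvar i ^ N * \<theta> l \<in> hset (int n + int N)" for l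
    by (rule hset_mult'[OF hset_power[OF hvar_in_hset]]) (use \<theta> in \<open>auto simp: log_fields_def\<close>)
  then have "\<And>l. \<Psi> s l \<in> hset (int n + int N)" unfolding Ns .
  from \<Psi>_homogenize[OF this] show ?thesis unfolding Ns by blast
qed

text \<open>
  The three local preimages of \<open>\<theta>\<close> differ by elements of the image of \<open>\<Phi>\<close>; by exactness of the
  Koszul complex they can be corrected so as to agree.
\<close>

lemma \<Psi>_surj:
  assumes \<theta>: "\<theta> \<in> log_fields f (int n)"
  obtains s where "s \<in> graded_sum as (int n)" "\<Psi> s = \<theta>"
proof -
  have "\<forall>i. \<exists>N s. s \<in> graded_sum as (int n + int N) \<and> \<Psi> s = (\<lambda>l. hvar i ^ N * \<theta> l)"
    using power_multiple_in_image[OF \<theta>] by blast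
  then obtain N0 s0 where s0: "\<And>i. s0 i \<in> graded_sum as (int n + int (N0 i))" "\<And>i. \<Psi> (s0 i) = (\<lambda>l. hvar i ^ N0 i * \<theta> l)"
    by metis
  define N where "N = Max (range N0)"
  have N: "N0 i \<le> N" for i unfolding N_def by (rule Max_ge) auto
  define S where "S i j = hvar i ^ (N - N0 i) * s0 i j" for i j
  have S: "S i \<in> graded_sum as (int n + int N)" for i
    unfolding S_def by (rule graded_sum_mult[OF s0(1) hset_power[OF hvar_in_hset]]) (use N[of i] in simp)
  have \<Psi>S: "\<Psi> (S i) = (\<lambda>l. hvar i ^ N * \<theta> l)" for i
  proof -
    have "hvar i ^ (N - N0 i) * (hvar i ^ N0 i * x) = hvar i ^ N * x" for x :: "'a hpoly"
      using N[of i] by (simp add: mult.assoc[symmetric] power_add[symmetric])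
    then show ?thesis unfolding S_def \<Psi>_simps s0(2) by (simp only:)
  qed
  have pw: "(hvar i :: 'a hpoly) ^ N \<in> hset (int N)" for i by (rule hset_power[OF hvar_in_hset])
  have diff: "\<exists>t. t \<in> graded_sum bs (int (n + N + N)) \<and> \<Phi> t = (\<lambda>j. hvar i' ^ N * S i j - hvar i ^ N * S i' j)" for i i'
  proof -
    have "(\<lambda>j. hvar i' ^ N * S i j - hvar i ^ N * S i' j) \<in> graded_sum as (int (n + N + N))"
      by (intro graded_sum_diff graded_sum_mult[OF S pw]) simp_all
    moreover have "\<Psi> (\<lambda>j. hvar i' ^ N * S i j - hvar i ^ N * S i' j) = (\<lambda>_. 0)"
      unfolding \<Psi>_simps \<Psi>S by (simp add: algebra_simps)
    ultimately show ?thesis by (rule kernel_\<Psi>) blast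
  qed
  obtain u u' u'' where u: "u \<in> graded_sum bs (int (n + N + N))" "\<Phi> u = (\<lambda>j. hvar 1 ^ N * S 0 j - hvar 0 ^ N * S 1 j)"
    and u': "u' \<in> graded_sum bs (int (n + N + N))" "\<Phi> u' = (\<lambda>j. hvar 2 ^ N * S 0 j - hvar 0 ^ N * S 2 j)"
    and u'': "u'' \<in> graded_sum bs (int (n + N + N))" "\<Phi> u'' = (\<lambda>j. hvar 2 ^ N * S 1 j - hvar 1 ^ N * S 2 j)"
    using diff[of 1 0] diff[of 2 0] diff[of 2 1] by blast
  \<comment> \<open>The three differences satisfy the cocycle relation. Injectivity of
    \<open>\<Phi>\<close> carries it over to \<open>u\<close>, \<open>u'\<close>,
    \<open>u''\<close>, which gives the relation required by \<open>koszul\<close>.\<close>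
  define w where "w j = (hvar 2 ^ N * u j - hvar 1 ^ N * u' j) + hvar 0 ^ N * u'' j" for j
  have "w \<in> graded_sum bs (int (n + N + N + N))"
    unfolding w_def by (intro graded_sum_add graded_sum_diff graded_sum_mult[OF u(1) pw] graded_sum_mult[OF u'(1) pw]
        graded_sum_mult[OF u''(1) pw]) simp_all
  moreover have "\<Phi> w = (\<lambda>_. 0)"
    unfolding w_def \<Phi>_simps u(2) u'(2) u''(2) by (simp add: algebra_simps)
  ultimately have "w = (\<lambda>_. 0)" by (rule \<Phi>_inject)
  then have w0: "hvar 2 ^ N * u j = hvar 0 ^ N * (- u'' j) + hvar 1 ^ N * u' j" for j
    unfolding w_def by (simp add: fun_eq_iff algebra_simps)
  have "\<forall>j. \<exists>a b. (j < length bs \<longrightarrow> a \<in> hset (int n + int N + bs ! j) \<and> b \<in> hset (int n + int N + bs ! j)) \<and>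
      (j \<ge> length bs \<longrightarrow> a = 0 \<and> b = 0) \<and> u j = hvar 0 ^ N * a + hvar 1 ^ N * b"
  proof
    fix j
    show "\<exists>a b. (j < length bs \<longrightarrow> a \<in> hset (int n + int N + bs ! j) \<and> b \<in> hset (int n + int N + bs ! j)) \<and>
      (j \<ge> length bs \<longrightarrow> a = 0 \<and> b = 0) \<and> u j = hvar 0 ^ N * a + hvar 1 ^ N * b"
    proof (cases "j < length bs")
      case True
      then have "u j \<in> hset (int (n + N + N) + bs ! j)" using u(1) unfolding graded_sum_def by blast
      from koszul[OF this w0] obtain a b where
        "a \<in> hset (int (n + N + N) + bs ! j - int N)" "b \<in> hset (int (n + N + N) + bs ! j - int N)"
        "u j = hvar 0 ^ N * a + hvar 1 ^ N * b" .
      with True show ?thesis by (intro exI[of _ a] exI[of _ b]) (simp add: algebra_simps)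
    next
      case False
      then show ?thesis using u(1) unfolding graded_sum_def by (intro exI[of _ 0]) simp
    qed
  qed
  then obtain a b where ab: "\<And>j. j < length bs \<Longrightarrow> a j \<in> hset (int n + int N + bs ! j)"
    "\<And>j. j < length bs \<Longrightarrow> b j \<in> hset (int n + int N + bs ! j)"
    "\<And>j. j \<ge> length bs \<Longrightarrow> a j = 0" "\<And>j. j \<ge> length bs \<Longrightarrow> b j = 0"
    "\<And>j. u j = hvar 0 ^ N * a j + hvar 1 ^ N * b j" by metis
  have a: "a \<in> graded_sum bs (int n + int N)" and b: "b \<in> graded_sum bs (int n + int N)"
    unfolding graded_sum_def using ab by auto
  have nN: "int n + int N = int (n + N)" by simp
  \<comment> \<open>The correction makes the preimages belonging to the first two variables
    compatible. Then \<open>\<sigma>\<close> is divisible by the \<open>N\<close>-th power of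
    \<open>hvar 0\<close>, and the quotient is a preimage of \<open>\<theta>\<close> itself.\<close>
  define \<sigma> where "\<sigma> j = S 0 j - \<Phi> b j" for j
  define \<sigma>' where "\<sigma>' j = S 1 j + \<Phi> a j" for j
  have \<sigma>: "\<sigma> \<in> graded_sum as (int n + int N)" unfolding \<sigma>_def by (intro graded_sum_diff S \<Phi>_graded b)
  have "\<Phi> u = \<Phi> (\<lambda>j. hvar 0 ^ N * a j + hvar 1 ^ N * b j)" using ab(5) by presburger
  then have "hvar 1 ^ N * S 0 j - hvar 0 ^ N * S 1 j = hvar 0 ^ N * \<Phi> a j + hvar 1 ^ N * \<Phi> b j" for j
    unfolding u(2) \<Phi>_simps by (rule fun_cong)
  then have eq: "hvar 1 ^ N * \<sigma> j = hvar 0 ^ N * \<sigma>' j" for j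
    unfolding \<sigma>_def \<sigma>'_def by (simp add: algebra_simps)
  have "\<forall>j. \<exists>r. (j < length as \<longrightarrow> r \<in> hset (int n + as ! j)) \<and> (j \<ge> length as \<longrightarrow> r = 0) \<and> \<sigma> j = hvar 0 ^ N * r"
  proof
    fix j
    show "\<exists>r. (j < length as \<longrightarrow> r \<in> hset (int n + as ! j)) \<and> (j \<ge> length as \<longrightarrow> r = 0) \<and> \<sigma> j = hvar 0 ^ N * r"
    proof (cases "j < length as")
      case True
      then have "\<sigma> j \<in> hset (int n + int N + as ! j)" using \<sigma> unfolding graded_sum_def by blast
      from hvar_power_cancel[OF distinct_3(1) this eq] obtain r where
        "r \<in> hset (int n + int N + as ! j - int N)" "\<sigma> j = hvar 0 ^ N * r" .
      with True show ?thesis by (intro exI[of _ r]) (simp add: algebra_simps)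
    next
      case False
      then show ?thesis using \<sigma> unfolding graded_sum_def by (intro exI[of _ 0]) simp
    qed
  qed
  then obtain \<rho> where \<rho>: "\<And>j. j < length as \<Longrightarrow> \<rho> j \<in> hset (int n + as ! j)" "\<And>j. j \<ge> length as \<Longrightarrow> \<rho> j = 0"
    "\<And>j. \<sigma> j = hvar 0 ^ N * \<rho> j" by metis
  have "\<rho> \<in> graded_sum as (int n)" unfolding graded_sum_def using \<rho> by auto
  moreover have "\<Psi> \<rho> = \<theta>"
  proof
    fix l
    have \<sigma>_eq: "\<sigma> = (\<lambda>j. hvar 0 ^ N * \<rho> j)" using \<rho>(3) by blast
    have "\<Psi> \<sigma> = (\<lambda>l. \<Psi> (S 0) l - \<Psi> (\<Phi> b) l)" unfolding \<sigma>_def \<Psi>_simps ..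
    then have "\<Psi> \<sigma> l = hvar 0 ^ N * \<theta> l" unfolding \<Psi>S \<Psi>_\<Phi>[OF b[unfolded nN]] by simp
    moreover have "\<Psi> \<sigma> l = hvar 0 ^ N * \<Psi> \<rho> l" unfolding \<sigma>_eq \<Psi>_simps ..
    ultimately show "\<Psi> \<rho> l = \<theta> l" by simp
  qed
  ultimately show thesis by (rule that)
qed

lemma \<Psi>_log_fields:
  assumes s: "s \<in> graded_sum as (int n)"
  shows "\<Psi> s \<in> log_fields f (int n)"
proof -
  have "s j * g j l \<in> hset (int n)" if "j < length as" for j l
    by (rule hset_mult'[OF _ g_hset[OF that]]) (use s that in \<open>auto simp: graded_sum_def\<close>)
  then have h: "\<Psi> s l \<in> hset (int n)" for l unfolding \<Psi>_def by (intro hset_sum) simp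
  have "sec 0 n (\<Psi> s) \<in> log_vector_fields f (D 0)"
    unfolding \<psi>_sec[OF s zopen_basic_open D_nonempty order_refl, symmetric]
    by (rule sheaf_homD(1)[OF hom_\<psi> zopen_basic_open D_nonempty sec_in_line_sum[OF s order_refl]])
  then have "(\<Sum>l\<in>UNIV. fr (partial l f) * sec 0 n (\<Psi> s) l) = 0"
    unfolding log_vector_fields_def Fract_eq_fr by simp
  moreover have "(\<Sum>l\<in>UNIV. fr (partial l f) * sec 0 n (\<Psi> s) l) =
      fr (\<Sum>l\<in>UNIV. partial l f * \<Psi> s l) * X 0 powi (- int n)"
    unfolding sec_def fr_sum sum_distrib_right by (rule sum.cong) (simp_all add: algebra_simps)
  ultimately have "(\<Sum>l\<in>UNIV. partial l f * \<Psi> s l) = 0" by (simp add: power_int_eq_0_iff)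
  with h show ?thesis unfolding log_fields_def by simp
qed

text \<open>The sequence of twisted global sections is exact in every degree
  \<open>n \<ge> 0\<close>, surjectivity included.\<close>

theorem hilbert_function:
  assumes "vdim fscale (log_fields f (int n)) k"
  shows "(\<Sum>j<length as. hil (int n + as ! j)) = (\<Sum>j<length bs. hil (int n + bs ! j)) + k"
proof -
  interpret p: subspace_map fscale fscale "graded_sum as (int n)" \<Psi>
    unfolding subspace_map_def subspace_map_axioms_def
    by (intro conjI allI impI vector_space_fscale subspace_graded_sum)
       (simp_all add: fscale_def plus_fun_def \<Psi>_simps)
  interpret q: subspace_map fscale fscale "graded_sum bs (int n)" \<Phi>
    unfolding subspace_map_def subspace_map_axioms_def
    by (intro conjI allI impI vector_space_fscale subspace_graded_sum)
       (simp_all add: fscale_def plus_fun_def \<Phi>_simps)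
  have 0: "(0 :: 'i \<Rightarrow> 'a hpoly) = (\<lambda>_. 0)" by (simp add: fun_eq_iff)
  have ker: "{s \<in> graded_sum as (int n). \<Psi> s = 0} = \<Phi> ` graded_sum bs (int n)"
  proof (intro equalityI subsetI)
    fix s assume "s \<in> {s \<in> graded_sum as (int n). \<Psi> s = 0}"
    then have "s \<in> graded_sum as (int n)" "\<Psi> s = (\<lambda>_. 0)" by (auto simp: fun_eq_iff)
    then show "s \<in> \<Phi> ` graded_sum bs (int n)" using kernel_\<Psi> by blast
  next
    fix s assume "s \<in> \<Phi> ` graded_sum bs (int n)"
    then show "s \<in> {s \<in> graded_sum as (int n). \<Psi> s = 0}" using \<Phi>_graded \<Psi>_\<Phi> by (auto simp: fun_eq_iff)
  qed
  have 1: "vdim fscale {s \<in> graded_sum as (int n). \<Psi> s = 0} (\<Sum>j<length bs. hil (int n + bs ! j))"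
    unfolding ker
  proof (rule q.vdim_image[OF vdim_graded_sum])
    fix x assume "x \<in> graded_sum bs (int n)" "\<Phi> x = 0"
    then show "x = 0" using \<Phi>_inject[of x n] by (auto simp: fun_eq_iff)
  qed
  have im: "\<Psi> ` graded_sum as (int n) = log_fields f (int n)"
    using \<Psi>_log_fields \<Psi>_surj by (metis (no_types, lifting) image_subsetI subsetI image_eqI subset_antisym)
  from p.vdim_exact[OF 1, of k] assms show ?thesis
    unfolding im using vdim_unique[OF vector_space_fscale vdim_graded_sum] by blast
qed

end

section \<open>Chern classes and Hilbert polynomials\<close>

text \<open>Newton's identity \<open>2 e_2 = p_1^2 - p_2\<close>; the power sums of the twists are
  what the Hilbert polynomial sees.\<close>

lemma coeff_total_chern:
  "coeff (total_chern ns) 0 = 1"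
  "coeff (total_chern ns) 1 = sum_list ns"
  "2 * coeff (total_chern ns) 2 = (sum_list ns)\<^sup>2 - sum_list (map (\<lambda>n. n\<^sup>2) ns)"
proof -
  have "coeff (total_chern ns) 0 = 1 \<and> coeff (total_chern ns) 1 = sum_list ns \<and>
    2 * coeff (total_chern ns) 2 = (sum_list ns)\<^sup>2 - sum_list (map (\<lambda>n. n\<^sup>2) ns)"
  proof (induction ns)
    case Nil
    show ?case by (simp add: total_chern_def)
  next
    case (Cons n ns)
    let ?c = "coeff (total_chern ns)"
    have eq: "total_chern (n # ns) = total_chern ns + pCons 0 (smult n (total_chern ns))"
      by (simp add: total_chern_def)
    have "coeff (total_chern (n # ns)) 0 = ?c 0" "coeff (total_chern (n # ns)) 1 = ?c 1 + n * ?c 0"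
      "coeff (total_chern (n # ns)) 2 = ?c 2 + n * ?c 1"
      unfolding eq by (simp_all add: numeral_2_eq_2)
    with Cons show ?case by (simp add: power2_eq_square algebra_simps)
  qed
  then show "coeff (total_chern ns) 0 = 1" "coeff (total_chern ns) 1 = sum_list ns"
    "2 * coeff (total_chern ns) 2 = (sum_list ns)\<^sup>2 - sum_list (map (\<lambda>n. n\<^sup>2) ns)" by blast+
qed

lemma sum_hil:
  assumes "\<And>a. a \<in> set ns \<Longrightarrow> t + a \<ge> 0"
  shows "2 * int (\<Sum>j<length ns. hil (t + ns ! j)) =
    int (length ns) * t\<^sup>2 + (2 * sum_list ns + 3 * int (length ns)) * t +
    (sum_list (map (\<lambda>n. n\<^sup>2) ns) + 3 * sum_list ns + 2 * int (length ns))"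
proof -
  have "(\<Sum>j<length ns. hil (t + ns ! j)) = sum_list (map (\<lambda>a. hil (t + a)) ns)"
    by (simp add: sum_list_sum_nth atLeast0LessThan)
  moreover have "2 * int (sum_list (map (\<lambda>a. hil (t + a)) ns)) =
    int (length ns) * t\<^sup>2 + (2 * sum_list ns + 3 * int (length ns)) * t +
    (sum_list (map (\<lambda>n. n\<^sup>2) ns) + 3 * sum_list ns + 2 * int (length ns))"
    using assms
  proof (induction ns)
    case (Cons a ns)
    have "t + a \<ge> - 2" using Cons.prems[of a] by simp
    then have "2 * int (hil (t + a)) = (t + a + 1) * (t + a + 2)" by (rule hil_of_nat)
    with Cons show ?case by (simp add: power2_eq_square algebra_simps)
  qed simp
  ultimately show ?thesis by simp
qed

lemma quadratic_zero:
  fixes a b c :: int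
  assumes "\<forall>n\<ge>n0. a * n\<^sup>2 + b * n + c = 0"
  shows "a = 0" "b = 0" "c = 0"
proof -
  have 0: "a * n0\<^sup>2 + b * n0 + c = 0" by (rule assms[rule_format]) simp
  have 1: "a * (n0 + 1)\<^sup>2 + b * (n0 + 1) + c = 0" by (rule assms[rule_format]) simp
  have 2: "a * (n0 + 2)\<^sup>2 + b * (n0 + 2) + c = 0" by (rule assms[rule_format]) simp
  have "2 * a = (a * (n0 + 2)\<^sup>2 + b * (n0 + 2) + c) - 2 * (a * (n0 + 1)\<^sup>2 + b * (n0 + 1) + c) + (a * n0\<^sup>2 + b * n0 + c)"
    by (simp add: power2_eq_square algebra_simps)
  then show a: "a = 0" unfolding 0 1 2 by simp
  show b: "b = 0" using 0 1 unfolding a by (simp add: algebra_simps)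
  show "c = 0" using 0 unfolding a b by simp
qed

text \<open>The hypothesis gives the sheaf the Hilbert polynomial of \<open>O(-M)\<close> plus
  \<open>O(-d)\<close> lowered by the constant \<open>\<delta>\<close>. By Riemann-Roch, here a
  comparison of coefficients, this raises \<open>c2\<close> by \<open>\<delta>\<close> over the
  product \<open>M d\<close>.\<close>

lemma second_chern_number:
  fixes as bs :: "int list"
  assumes hilb: "\<And>n. n \<ge> n0 \<Longrightarrow> 2 * int (\<Sum>j<length as. hil (n + as ! j)) =
      2 * int (\<Sum>j<length bs. hil (n + bs ! j)) + 2 * int (hil (n - M)) + 2 * int (hil (n - d)) - 2 * \<delta>"
    and chern: "\<forall>i<3. coeff ([:1, c1, c2:] * total_chern bs) i = coeff (total_chern as) i"
  shows "c2 = M * d + \<delta>"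
proof -
  define A0 A1 A2 where "A0 = int (length as)" and "A1 = sum_list as" and "A2 = sum_list (map (\<lambda>n. n\<^sup>2) as)"
  define B0 B1 B2 where "B0 = int (length bs)" and "B1 = sum_list bs" and "B2 = sum_list (map (\<lambda>n. n\<^sup>2) bs)"
  \<comment> \<open>From \<open>n1\<close> on all arguments of \<open>hil\<close> are nonnegative,
    so that every term is a polynomial in \<open>n\<close>.\<close>
  define n1 where "n1 = Max (insert n0 (insert \<bar>M\<bar> (insert \<bar>d\<bar> ((\<lambda>a. \<bar>a\<bar>) ` (set as \<union> set bs)))))"
  have n1: "n0 \<le> n1" "\<bar>M\<bar> \<le> n1" "\<bar>d\<bar> \<le> n1" "\<And>a. a \<in> set as \<union> set bs \<Longrightarrow> \<bar>a\<bar> \<le> n1"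
    unfolding n1_def by (rule Max_ge; auto)+
  have "(A0 - B0 - 2) * n\<^sup>2 + (2 * (A1 - B1) + 3 * (A0 - B0) - 6 + 2 * (M + d)) * n +
    ((A2 - B2) + 3 * (A1 - B1) + 2 * (A0 - B0) - M\<^sup>2 - d\<^sup>2 + 3 * (M + d) - 4 + 2 * \<delta>) = 0" if n: "n \<ge> n1" for n
  proof -
    have "n + a \<ge> 0" if "a \<in> set as \<union> set bs" for a using n1(4)[OF that] n by linarith
    then have sums:
      "2 * int (\<Sum>j<length as. hil (n + as ! j)) = A0 * n\<^sup>2 + (2 * A1 + 3 * A0) * n + (A2 + 3 * A1 + 2 * A0)"
      "2 * int (\<Sum>j<length bs. hil (n + bs ! j)) = B0 * n\<^sup>2 + (2 * B1 + 3 * B0) * n + (B2 + 3 * B1 + 2 * B0)"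
      unfolding A0_def A1_def A2_def B0_def B1_def B2_def by (intro sum_hil; blast)+
    have "2 * int (hil (n - M)) = (n - M + 1) * (n - M + 2)" "2 * int (hil (n - d)) = (n - d + 1) * (n - d + 2)"
      by (rule hil_of_nat; use n1(2,3) n in linarith)+
    with hilb[of n] n1(1) n show ?thesis
      unfolding sums by (simp add: power2_eq_square algebra_simps)
  qed
  then have "\<forall>n\<ge>n1. (A0 - B0 - 2) * n\<^sup>2 + (2 * (A1 - B1) + 3 * (A0 - B0) - 6 + 2 * (M + d)) * n +
    ((A2 - B2) + 3 * (A1 - B1) + 2 * (A0 - B0) - M\<^sup>2 - d\<^sup>2 + 3 * (M + d) - 4 + 2 * \<delta>) = 0" by blast
  note q = quadratic_zero[OF this]
  have e0: "A0 - B0 = 2" using q(1) by simp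
  have e1: "A1 - B1 = - (M + d)" using q(2) e0 by simp
  have e2: "A2 - B2 = M\<^sup>2 + d\<^sup>2 - 2 * \<delta>" using q(3) e0 e1 by simp
  let ?b = "coeff (total_chern bs)" and ?a = "coeff (total_chern as)"
  have eq: "[:1, c1, c2:] * p = p + pCons 0 (smult c1 p + pCons 0 (smult c2 p))" for p :: "int poly"
    by simp
  have "?a 1 = ?b 1 + c1 * ?b 0" using chern[rule_format, of 1] unfolding eq by simp
  then have c1: "c1 = A1 - B1" unfolding coeff_total_chern A1_def B1_def by simp
  have "?a 2 = ?b 2 + (c1 * ?b 1 + c2 * ?b 0)"
    using chern[rule_format, of 2] unfolding eq by (simp add: numeral_2_eq_2)
  then have "2 * ?a 2 = 2 * ?b 2 + 2 * (c1 * ?b 1 + c2 * ?b 0)" by simp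
  then have "A1\<^sup>2 - A2 = B1\<^sup>2 - B2 + 2 * (c1 * B1 + c2)"
    unfolding coeff_total_chern A1_def B1_def A2_def B2_def by simp
  then have "2 * c2 = (A1 - B1)\<^sup>2 - (A2 - B2)"
    unfolding c1 by (simp add: power2_eq_square algebra_simps)
  also have "\<dots> = 2 * (M * d + \<delta>)" unfolding e1 e2 by (simp add: power2_eq_square algebra_simps)
  finally show ?thesis by simp
qed

section \<open>Free arrangements\<close>

lemma fr_det3: "fr (det3 x y z) = det3 (\<lambda>i. fr (x i)) (\<lambda>i. fr (y i)) (\<lambda>i. fr (z i))"
  for x y z :: "3 \<Rightarrow> 'r::idom"
  unfolding det3_def lval_3 by simp

lemma det3_scale:
  "det3 (\<lambda>i. c * x i) y z = c * det3 x y z" "det3 x (\<lambda>i. c * y i) z = c * det3 x y z"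
  for x y z :: "3 \<Rightarrow> 'r::comm_ring"
  unfolding det3_def lval_3 by (simp_all add: algebra_simps)

lemma det3_add:
  "det3 (\<lambda>i. x i + x' i) y z = det3 x y z + det3 x' y z"
  "det3 x (\<lambda>i. y i + y' i) z = det3 x y z + det3 x y' z"
  for x y z :: "3 \<Rightarrow> 'r::comm_ring"
  unfolding det3_def lval_3 by (simp_all add: algebra_simps)

lemma det3_same [simp]: "det3 x x z = 0" for x z :: "3 \<Rightarrow> 'r::comm_ring"
  unfolding det3_def lval_3 by (simp add: algebra_simps)

lemma log_vector_fields_add:
  assumes "U \<subseteq> proj_plane" "s \<in> log_vector_fields f U" "t \<in> log_vector_fields f U"
  shows "(\<lambda>i. s i + t i) \<in> log_vector_fields f U"
  using assms unfolding log_vector_fields_def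
  by (auto simp: distrib_left sum.distrib intro: twist_add)

lemma log_vector_fields_scale:
  assumes "U \<subseteq> proj_plane" "c \<in> twist 0 U" "s \<in> log_vector_fields f U"
  shows "(\<lambda>i. c * s i) \<in> log_vector_fields f U"
proof -
  have "(\<Sum>i\<in>UNIV. Fract (partial i f) 1 * (c * s i)) = c * (\<Sum>i\<in>UNIV. Fract (partial i f) 1 * s i)"
    unfolding sum_distrib_left by (rule sum.cong) (simp_all only: mult_ac)
  with assms show ?thesis
    unfolding log_vector_fields_def using twist_mult[OF assms(1,2), of _ 0] by simp
qed

lemma log_vector_fields_mono: "V \<subseteq> U \<Longrightarrow> s \<in> log_vector_fields f U \<Longrightarrow> s \<in> log_vector_fields f V"
  unfolding log_vector_fields_def using twist_mono by blast

text \<open>Saito's criterion, with the coordinates of a field given by Cramer's rule.\<close>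

lemma (in arrangement) free_if_independent:
  fixes k k' :: nat
  assumes \<theta>: "\<theta> \<in> log_fields f (int k)" and \<theta>': "\<theta>' \<in> log_fields f (int k')"
    and deg: "k + k' + 1 = m" and det: "det3 \<theta> \<theta>' hvar \<noteq> 0"
  shows "sheaf_isomorphic (log_vector_fields f) (line_sum [- int k, - int k'])"
proof -
  have m0: "m > 0" using deg by simp
  obtain q where q: "q \<in> hset (int k + int k' + 1 - int m)" "det3 \<theta> \<theta>' hvar = f * q"
    using log_fields_det[OF \<theta> \<theta>'] .
  have "int k + int k' + 1 - int m = 0" using deg by simp
  then have "q \<in> hset 0" using q(1) by (simp only:)
  then obtain e where e: "q = hconst e" by (rule hset_0_hconst)
  have e0: "e \<noteq> 0" using det q(2) unfolding e by auto
  define \<Theta> \<Theta>' where "\<Theta> i = fr (\<theta> i)" and "\<Theta>' i = fr (\<theta>' i)" for i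
  define \<Delta> where "\<Delta> = det3 \<Theta> \<Theta>' X"
  have \<Delta>: "\<Delta> = fr f * fr (hconst e)"
    unfolding \<Delta>_def \<Theta>_def \<Theta>'_def fr_det3[symmetric] q(2) e by simp
  have \<Delta>0: "\<Delta> \<noteq> 0" unfolding \<Delta> using f_nonzero e0 by simp
  define grad where "grad s = (\<Sum>i\<in>UNIV. fr (partial i f) * s i)" for s :: "3 \<Rightarrow> 'a ratfun"
  have grad_lin: "grad (\<lambda>i. a * x i + b * y i + c * z i) = a * grad x + b * grad y + c * grad z" for a b c x y z
    unfolding grad_def sum_3 by (simp add: algebra_simps)
  have grad_\<Theta>: "grad \<Theta> = 0" "grad \<Theta>' = 0"
  proof -
    have "grad \<Theta> = fr (\<Sum>i\<in>UNIV. partial i f * \<theta> i)" "grad \<Theta>' = fr (\<Sum>i\<in>UNIV. partial i f * \<theta>' i)"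
      unfolding grad_def \<Theta>_def \<Theta>'_def fr_sum by simp_all
    then show "grad \<Theta> = 0" "grad \<Theta>' = 0" using \<theta> \<theta>' by (simp_all add: log_fields_def)
  qed
  have grad_X: "grad X \<noteq> 0"
  proof -
    have "grad X = fr (hconst (of_nat m) * f)"
      unfolding of_nat_m[symmetric] euler[symmetric] grad_def fr_sum by simp
    then show ?thesis using m0 f_nonzero by simp
  qed
  have E: "s \<in> log_vector_fields f U \<longleftrightarrow> (\<forall>i. s i \<in> twist 0 U) \<and> grad s = 0" for s U
    unfolding log_vector_fields_def grad_def Fract_eq_fr by simp
  define p p' where "p s = det3 s \<Theta>' X / \<Delta>" and "p' s = det3 \<Theta> s X / \<Delta>" for s
  \<comment> \<open>Cramer's rule gives a third term along the Euler field. The gradient kills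
    \<open>s\<close>, \<open>\<Theta>\<close> and \<open>\<Theta>'\<close> but not the Euler field,
    so this term vanishes.\<close>
  have expand: "s i = p s * \<Theta> i + p' s * \<Theta>' i" if s: "grad s = 0" for s i
  proof -
    note cr = det3_cramer_col[of \<Theta> \<Theta>' X s]
    have "grad (\<lambda>i. \<Delta> * s i + 0 * s i + 0 * s i) = grad (\<lambda>i. det3 s \<Theta>' X * \<Theta> i + det3 \<Theta> s X * \<Theta>' i + det3 \<Theta> \<Theta>' s * X i)"
      unfolding \<Delta>_def cr[symmetric] by simp
    then have "det3 \<Theta> \<Theta>' s * grad X = 0" unfolding grad_lin s grad_\<Theta> by simp
    then have "det3 \<Theta> \<Theta>' s = 0" using grad_X by simp
    then have "\<Delta> * s i = det3 s \<Theta>' X * \<Theta> i + det3 \<Theta> s X * \<Theta>' i" using cr[of i] unfolding \<Delta>_def by simp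
    then have "s i = (det3 s \<Theta>' X * \<Theta> i + det3 \<Theta> s X * \<Theta>' i) / \<Delta>" using \<Delta>0 by (simp add: field_simps)
    then show ?thesis unfolding p_def p'_def by (simp add: add_divide_distrib)
  qed
  \<comment> \<open>A local denominator \<open>b\<close> turns \<open>s\<close> into a polynomial
    log field. Its determinants with \<open>\<theta>\<close> and \<open>\<theta>'\<close> are
    multiples of \<open>f\<close>, which cancels against the \<open>f\<close> in
    \<open>\<Delta>\<close>; only \<open>b\<close> is left in the denominator.\<close>
  have regular: "p s \<in> twist (- int k) U \<and> p' s \<in> twist (- int k') U"
    if U: "U \<subseteq> proj_plane" and s: "s \<in> log_vector_fields f U" for U s
  proof -
    have "\<exists>b x x'. b \<in> hset c \<and> b \<notin> P \<and> x \<in> hset (c - int k) \<and> x' \<in> hset (c - int k') \<and> p s = fr x / fr b \<and> p' s = fr x' / fr b"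
      if "\<exists>b \<sigma>. b \<in> hset c \<and> b \<notin> P \<and> 0 \<in> P \<and> (\<forall>i. \<sigma> i \<in> hset c \<and> fr b * s i = fr (\<sigma> i))" for c P
    proof -
      from that obtain b \<sigma> where b: "b \<in> hset c" "b \<notin> P" "0 \<in> P"
        and \<sigma>: "\<And>i. \<sigma> i \<in> hset c" "\<And>i. fr b * s i = fr (\<sigma> i)" by blast
      have b0: "b \<noteq> 0" using b by blast
      have "fr (\<Sum>i\<in>UNIV. partial i f * \<sigma> i) = grad (\<lambda>i. fr b * s i + 0 * s i + 0 * s i)"
        unfolding grad_def fr_sum fr_simps \<sigma>(2)[symmetric] by simp
      also have "\<dots> = 0" unfolding grad_lin using s unfolding E by simp
      finally have \<sigma>D: "\<sigma> \<in> log_fields f c" unfolding log_fields_def using \<sigma>(1) by simp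
      obtain y where y: "y \<in> hset (c + int k' + 1 - int m)" "det3 \<sigma> \<theta>' hvar = f * y"
        using log_fields_det[OF \<sigma>D \<theta>'] .
      obtain y' where y': "y' \<in> hset (int k + c + 1 - int m)" "det3 \<theta> \<sigma> hvar = f * y'"
        using log_fields_det[OF \<theta> \<sigma>D] .
      have deg': "int m = int k + int k' + 1" using deg by simp
      have ee: "fr (hconst (1 / e)) * fr (hconst e) = 1"
        unfolding fr_simps(4)[symmetric] hconst_mult[symmetric] using e0 by simp
      have "fr b * det3 s \<Theta>' X = fr f * fr y"
        unfolding det3_scale(1)[symmetric] \<sigma>(2) \<Theta>'_def fr_det3[symmetric] y(2) by simp
      also have "\<dots> = fr (hconst (1 / e) * y) * \<Delta>" unfolding \<Delta> using ee by (simp add: mult_ac)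
      finally have 1: "p s = fr (hconst (1 / e) * y) / fr b" using \<Delta>0 b0 unfolding p_def by (simp add: field_simps)
      have "fr b * det3 \<Theta> s X = fr f * fr y'"
        unfolding det3_scale(2)[symmetric] \<sigma>(2) \<Theta>_def fr_det3[symmetric] y'(2) by simp
      also have "\<dots> = fr (hconst (1 / e) * y') * \<Delta>" unfolding \<Delta> using ee by (simp add: mult_ac)
      finally have 2: "p' s = fr (hconst (1 / e) * y') / fr b" using \<Delta>0 b0 unfolding p'_def by (simp add: field_simps)
      have "y \<in> hset (c - int k)" "y' \<in> hset (c - int k')" using y(1) y'(1) unfolding deg' by simp_all
      then show ?thesis using 1 2 b by (meson hset_hconst_mult)
    qed
    moreover have "\<exists>c b \<sigma>. b \<in> hset c \<and> b \<notin> P \<and> 0 \<in> P \<and> (\<forall>i. \<sigma> i \<in> hset c \<and> fr b * s i = fr (\<sigma> i))"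
      if P: "P \<in> U" for P
    proof -
      have PP: "P \<in> proj_plane" using P U by blast
      have "\<forall>i. \<exists>c a b. a \<in> hset c \<and> b \<in> hset c \<and> b \<notin> P \<and> s i = fr a / fr b"
        using s P unfolding E twist_iff[OF U] by simp
      then obtain c a b where ab: "\<And>i. a i \<in> hset (c i)" "\<And>i. b i \<in> hset (c i)" "\<And>i. b i \<notin> P" "\<And>i. s i = fr (a i) / fr (b i)"
        by metis
      have bn: "b i \<noteq> 0" for i using ab(3)[of i] proj_planeD(1)[OF PP] by auto
      define B where "B = b 0 * b 1 * b 2"
      define C where "C = c 0 + c 1 + c 2"
      have B: "B \<in> hset C" unfolding B_def C_def by (intro hset_mult ab)
      have BP: "B \<notin> P" unfolding B_def using ab(3) proj_planeD(3)[OF PP] by blast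
      define \<sigma> where "\<sigma> i = (if i = 0 then a 0 * b 1 * b 2 else if i = 1 then b 0 * a 1 * b 2 else b 0 * b 1 * a 2)" for i :: 3
      have "\<sigma> i \<in> hset C" for i unfolding \<sigma>_def C_def by (auto intro!: hset_mult ab)
      moreover have "\<forall>i. fr B * s i = fr (\<sigma> i)"
        unfolding all_3 \<sigma>_def B_def using bn by (simp add: ab(4))
      ultimately show ?thesis using B BP proj_planeD(1)[OF PP] by blast
    qed
    ultimately have loc: "\<exists>c b x x'. b \<in> hset c \<and> b \<notin> P \<and> x \<in> hset (c - int k) \<and> x' \<in> hset (c - int k') \<and>
        p s = fr x / fr b \<and> p' s = fr x' / fr b" if "P \<in> U" for P
      using that by metis
    show ?thesis
    proof
      show "p s \<in> twist (- int k) U"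
        unfolding twist_iff[OF U]
      proof
        fix P assume "P \<in> U"
        from loc[OF this] obtain c b x where "b \<in> hset c" "b \<notin> P" "x \<in> hset (c - int k)" "p s = fr x / fr b" by blast
        then show "\<exists>b g h. g \<in> hset (b + - int k) \<and> h \<in> hset b \<and> h \<notin> P \<and> p s = fr g / fr h"
          by (intro exI[of _ c] exI[of _ x] exI[of _ b]) simp
      qed
      show "p' s \<in> twist (- int k') U"
        unfolding twist_iff[OF U]
      proof
        fix P assume "P \<in> U"
        from loc[OF this] obtain c b x where "b \<in> hset c" "b \<notin> P" "x \<in> hset (c - int k')" "p' s = fr x / fr b" by blast
        then show "\<exists>b g h. g \<in> hset (b + - int k') \<and> h \<in> hset b \<and> h \<notin> P \<and> p' s = fr g / fr h"
          by (intro exI[of _ c] exI[of _ x] exI[of _ b]) simp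
      qed
    qed
  qed
  define \<phi> :: "'a pt set \<Rightarrow> (3 \<Rightarrow> 'a ratfun) \<Rightarrow> nat \<Rightarrow> 'a ratfun"
    where "\<phi> U s = (\<lambda>j. if j = 0 then p s else if j = 1 then p' s else 0)" for U s
  let ?ns = "[- int k, - int k']"
  have line_sum2: "t \<in> line_sum ?ns U \<longleftrightarrow> t 0 \<in> twist (- int k) U \<and> t 1 \<in> twist (- int k') U \<and> (\<forall>j\<ge>2. t j = 0)" for t U
    unfolding line_sum_def by (auto simp: less_Suc_eq numeral_2_eq_2)
  have hom: "sheaf_hom (log_vector_fields f) (line_sum ?ns) \<phi>"
    unfolding sheaf_hom_def
  proof (intro allI impI conjI ballI)
    fix U :: "'a pt set" assume U: "zopen U \<and> U \<noteq> {}"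
    then have UP: "U \<subseteq> proj_plane" using zopen_subset by blast
    show "\<phi> U s \<in> line_sum ?ns U" if "s \<in> log_vector_fields f U" for s
      unfolding line_sum2 \<phi>_def using regular[OF UP that] by simp
    show "\<phi> U (\<lambda>i. s i + t i) = (\<lambda>j. \<phi> U s j + \<phi> U t j)" for s t
      unfolding \<phi>_def p_def p'_def det3_add by (auto simp: add_divide_distrib fun_eq_iff)
    show "\<phi> U (\<lambda>i. c * s i) = (\<lambda>j. c * \<phi> U s j)" for c s
      unfolding \<phi>_def p_def p'_def det3_scale by (auto simp: fun_eq_iff)
    show "\<phi> V s = \<phi> U s" for V s unfolding \<phi>_def ..
  qed
  have "bij_betw (\<phi> U) (log_vector_fields f U) (line_sum ?ns U)" if U: "zopen U" for U
  proof (rule bij_betwI')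
    have UP: "U \<subseteq> proj_plane" using U by (rule zopen_subset)
    fix s t assume st: "s \<in> log_vector_fields f U" "t \<in> log_vector_fields f U"
    show "\<phi> U s = \<phi> U t \<longleftrightarrow> s = t"
    proof
      assume eq: "\<phi> U s = \<phi> U t"
      have "p s = p t" "p' s = p' t" using fun_cong[OF eq, of 0] fun_cong[OF eq, of 1] by (simp_all add: \<phi>_def)
      then show "s = t" using expand[of s] expand[of t] st unfolding E by (intro ext) simp
    qed simp
  next
    have UP: "U \<subseteq> proj_plane" using U by (rule zopen_subset)
    fix s assume "s \<in> log_vector_fields f U"
    then show "\<phi> U s \<in> line_sum ?ns U" unfolding line_sum2 \<phi>_def using regular[OF UP] by simp
  next
    have UP: "U \<subseteq> proj_plane" using U by (rule zopen_subset)
    fix t :: "nat \<Rightarrow> 'a ratfun" assume t: "t \<in> line_sum ?ns U"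
    define s where "s i = t 0 * \<Theta> i + t 1 * \<Theta>' i" for i
    have "s i \<in> twist 0 U" for i
      unfolding s_def \<Theta>_def \<Theta>'_def
    proof (rule twist_add[OF UP])
      show "t 0 * fr (\<theta> i) \<in> twist 0 U"
        by (rule twist_mult'[OF UP _ fr_in_twist[OF UP]]) (use t \<theta> in \<open>auto simp: line_sum2 log_fields_def\<close>)
      show "t 1 * fr (\<theta>' i) \<in> twist 0 U"
        by (rule twist_mult'[OF UP _ fr_in_twist[OF UP]]) (use t \<theta>' in \<open>auto simp: line_sum2 log_fields_def\<close>)
    qed
    moreover have "grad (\<lambda>i. t 0 * \<Theta> i + t 1 * \<Theta>' i + 0 * \<Theta> i) = 0" unfolding grad_lin grad_\<Theta> by simp
    then have "grad s = 0" unfolding s_def by simp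
    ultimately have "s \<in> log_vector_fields f U" unfolding E by blast
    moreover have "p s = t 0" "p' s = t 1"
      unfolding p_def p'_def s_def det3_add det3_scale using \<Delta>0 by (simp_all add: \<Delta>_def)
    then have "t = \<phi> U s"
      using t unfolding line_sum2 \<phi>_def by (auto simp: fun_eq_iff numeral_2_eq_2 Suc_le_eq)
    ultimately show "\<exists>s\<in>log_vector_fields f U. t = \<phi> U s" by blast
  qed
  with hom show ?thesis unfolding sheaf_isomorphic_def by blast
qed

text \<open>The inverse of the isomorphism is itself a resolution, with \<open>line_sum []\<close>
  as kernel.\<close>

lemma chern_classes_of_free:
  assumes "sheaf_isomorphic (log_vector_fields f) (line_sum [- int a, - int b])"
  shows "has_second_chern_class (log_vector_fields f) (int (a * b))"
proof -
  let ?ns = "[- int a, - int b]" and ?E = "log_vector_fields f"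
  from assms obtain \<phi> where hom: "sheaf_hom ?E (line_sum ?ns) \<phi>"
    and bij: "\<And>U. zopen U \<Longrightarrow> U \<noteq> {} \<Longrightarrow> bij_betw (\<phi> U) (?E U) (line_sum ?ns U)"
    unfolding sheaf_isomorphic_def by blast
  define \<psi> where "\<psi> U = inv_into (?E U) (\<phi> U)" for U
  have \<psi>: "\<psi> U t \<in> ?E U" "\<phi> U (\<psi> U t) = t" if "zopen U" "U \<noteq> {}" "t \<in> line_sum ?ns U" for U t
    using bij[OF that(1,2)] that(3) unfolding \<psi>_def
    by (metis bij_betw_def inv_into_into, metis bij_betw_inv_into_right)
  have \<psi>_eqI: "\<psi> U t = s" if "zopen U" "U \<noteq> {}" "s \<in> ?E U" "\<phi> U s = t" for U s t
    using bij[OF that(1,2)] that(3,4) unfolding \<psi>_def by (metis bij_betw_inv_into_left)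
  have E0: "(\<lambda>_. 0) \<in> ?E U" if "U \<subseteq> proj_plane" for U
    unfolding log_vector_fields_def using zero_in_twist[OF that] by simp
  have \<psi>0: "\<psi> U (\<lambda>_. 0) = (\<lambda>_. 0)" if U: "zopen U" "U \<noteq> {}" for U
    using \<psi>_eqI[OF U E0] sheaf_hom_zero[OF hom U E0] zopen_subset[OF U(1)] by blast
  have hom\<psi>: "sheaf_hom (line_sum ?ns) ?E \<psi>"
    unfolding sheaf_hom_def
  proof (intro allI impI conjI ballI)
    fix U :: "'a pt set" assume "zopen U \<and> U \<noteq> {}"
    then have U: "zopen U" "U \<noteq> {}" by blast+
    note UP = zopen_subset[OF U(1)]
    fix s assume s: "s \<in> line_sum ?ns U"
    show "\<psi> U s \<in> ?E U" using \<psi>(1)[OF U s] .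
    show "\<psi> U (\<lambda>i. s i + t i) = (\<lambda>j. \<psi> U s j + \<psi> U t j)" if t: "t \<in> line_sum ?ns U" for t
      by (rule \<psi>_eqI[OF U log_vector_fields_add[OF UP \<psi>(1)[OF U s] \<psi>(1)[OF U t]]])
         (simp only: sheaf_homD(2)[OF hom U \<psi>(1)[OF U s] \<psi>(1)[OF U t]] \<psi>(2)[OF U s] \<psi>(2)[OF U t])
    show "\<psi> V s = \<psi> U s" if V: "zopen V \<and> V \<noteq> {} \<and> V \<subseteq> U" for V
    proof (rule \<psi>_eqI)
      show "\<psi> U s \<in> ?E V" using log_vector_fields_mono[OF _ \<psi>(1)[OF U s]] V by blast
      show "\<phi> V (\<psi> U s) = s" using sheaf_homD(4)[OF hom U \<psi>(1)[OF U s]] V \<psi>(2)[OF U s] by metis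
    qed (use V in blast)+
  next
    fix U :: "'a pt set" and c s assume "zopen U \<and> U \<noteq> {}" and c: "c \<in> twist 0 U" and s: "s \<in> line_sum ?ns U"
    then have U: "zopen U" "U \<noteq> {}" by blast+
    note UP = zopen_subset[OF U(1)]
    show "\<psi> U (\<lambda>i. c * s i) = (\<lambda>j. c * \<psi> U s j)"
      by (rule \<psi>_eqI[OF U log_vector_fields_scale[OF UP c \<psi>(1)[OF U s]]])
         (simp only: sheaf_homD(3)[OF hom U \<psi>(1)[OF U s] c] \<psi>(2)[OF U s])
  qed
  have hom0: "sheaf_hom (line_sum []) (line_sum ?ns) (\<lambda>U s i. 0)"
    unfolding sheaf_hom_def by (auto intro: zero_in_line_sum[OF zopen_subset])
  have nil: "line_sum [] U = {\<lambda>_. 0}" for U :: "'a pt set"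
    unfolding line_sum_def by (auto simp: fun_eq_iff)
  have "short_exact (line_sum []) (line_sum ?ns) ?E (\<lambda>U s i. 0) \<psi>"
    unfolding short_exact_def
  proof (intro conjI allI impI ballI hom0 hom\<psi>)
    fix U :: "'a pt set" assume "zopen U \<and> U \<noteq> {}"
    then have U: "zopen U" "U \<noteq> {}" by blast+
    note UP = zopen_subset[OF U(1)]
    show "inj_on (\<lambda>s i. 0) (line_sum [] U)" unfolding nil by simp
    show "(\<lambda>s i. 0) ` line_sum [] U = {s \<in> line_sum ?ns U. \<psi> U s = (\<lambda>_. 0)}"
    proof (intro equalityI subsetI)
      fix s assume "s \<in> {s \<in> line_sum ?ns U. \<psi> U s = (\<lambda>_. 0)}"
      then have "s \<in> line_sum ?ns U" "\<psi> U s = (\<lambda>_. 0)" by blast+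
      then have "s = (\<lambda>_. 0)" using \<psi>(2)[OF U] sheaf_hom_zero[OF hom U E0[OF UP]] by metis
      then show "s \<in> (\<lambda>s i. 0) ` line_sum [] U" unfolding nil by simp
    qed (use zero_in_line_sum[OF UP] \<psi>0[OF U] nil in auto)
    fix t P assume t: "t \<in> ?E U" "P \<in> U"
    show "\<exists>V. zopen V \<and> P \<in> V \<and> V \<subseteq> U \<and> (\<exists>s\<in>line_sum ?ns V. \<psi> V s = t)"
      using U t(2) sheaf_homD(1)[OF hom U t(1)] \<psi>_eqI[OF U t(1) refl] by blast
  qed
  moreover have "[:1, - (int a + int b), int (a * b):] * total_chern [] = total_chern ?ns"
    by (simp add: total_chern_def)
  ultimately show ?thesis
    unfolding has_second_chern_class_def has_chern_classes_def by metis
qed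

text \<open>If one form divides another, they are proportional by a nonzero scalar and lie in the
  same primes, so the two lines coincide.\<close>

lemma line_arrangement_arrangement:
  fixes \<alpha> :: "nat \<Rightarrow> 3 \<Rightarrow> 'a::field_char_0"
  assumes "line_arrangement m \<alpha>"
  shows "arrangement \<alpha> m"
proof
  show nz: "\<alpha> j \<noteq> (\<lambda>_. 0)" if "j < m" for j
    using assms that unfolding line_arrangement_def by blast
  show "\<not> linear_form (\<alpha> i) dvd linear_form (\<alpha> j)" if ij: "i < m" "j < m" "i \<noteq> j" for i j
  proof
    assume "linear_form (\<alpha> i) dvd linear_form (\<alpha> j)"
    then obtain c where c: "\<alpha> j = (\<lambda>k. c * \<alpha> i k)" using linear_form_dvd_linear_form[OF nz[OF ij(1)]] by blast
    have c0: "c \<noteq> 0" using nz[OF ij(2)] c by auto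
    have 1: "linear_form (\<alpha> j) = hconst c * linear_form (\<alpha> i)" unfolding c by (rule linear_form_scale)
    have "hconst (1 / c) * hconst c = 1" unfolding hconst_mult[symmetric] using c0 by simp
    then have 2: "linear_form (\<alpha> i) = hconst (1 / c) * linear_form (\<alpha> j)"
      unfolding 1 by (simp add: mult.assoc[symmetric])
    have "linear_form (\<alpha> i) \<in> P \<longleftrightarrow> linear_form (\<alpha> j) \<in> P" if "P \<in> proj_plane" for P
      using proj_plane_ideal[OF that, of "linear_form (\<alpha> i)" "hconst c"]
        proj_plane_ideal[OF that, of "linear_form (\<alpha> j)" "hconst (1 / c)"] 1 2 by metis
    then have "zero_locus {linear_form (\<alpha> i)} = zero_locus {linear_form (\<alpha> j)}"
      unfolding zero_locus_def by blast
    then show False using assms ij unfolding line_arrangement_def inj_on_def by blast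
  qed
qed

theorem theorem2:
  fixes k r m h :: nat
    and \<alpha> :: "nat \<Rightarrow> 3 \<Rightarrow> 'a::field_char_0"
    and v :: "3 \<Rightarrow> 'a"
  assumes "k \<ge> 1"
    and "m = 2 * k + r + 1"
    and "line_arrangement m \<alpha>"
    and "v \<noteq> (\<lambda>_. 0)"
    and "point_multiplicity m \<alpha> v = h"
    and "k \<le> h" and "h \<le> k + r + 1"
  shows "free_with_exponents m \<alpha> k (k + r) \<longleftrightarrow>
         has_second_chern_class (log_tangent_sheaf m \<alpha>) (int (k * (k + r)))"
proof
  assume "free_with_exponents m \<alpha> k (k + r)"
  then show "has_second_chern_class (log_tangent_sheaf m \<alpha>) (int (k * (k + r)))"
    unfolding free_with_exponents_def log_tangent_sheaf_def by (rule chern_classes_of_free)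
next
  assume "has_second_chern_class (log_tangent_sheaf m \<alpha>) (int (k * (k + r)))"
  then obtain c1 as bs \<phi> \<psi> where exact:
      "short_exact (line_sum bs) (line_sum as) (log_vector_fields (defining_poly m \<alpha>)) \<phi> \<psi>"
    and chern: "\<forall>i<3. coeff ([:1, c1, int (k * (k + r)):] * total_chern bs) i = coeff (total_chern as) i"
    unfolding has_second_chern_class_def has_chern_classes_def log_tangent_sheaf_def by blast
  interpret arrangement \<alpha> m by (rule line_arrangement_arrangement) fact
  let ?Z = "{i. i < m \<and> lval (\<alpha> i) v = 0}"
  have h: "card ?Z = h" using assms(5) unfolding point_multiplicity_def lval_def .
  have finZ: "finite ?Z" by simp
  have "?Z \<noteq> {}" using h assms(1,6) by (metis card.empty le_zero_eq not_one_le_zero)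
  then obtain i0 where i0: "i0 < m" "lval (\<alpha> i0) v = 0" by blast
  obtain u u' where uu: "arrangement_at_point \<alpha> m i0 u u' v"
    using exists_generic[OF assms(4) i0] .
  interpret arrangement_at_point \<alpha> m i0 u u' v by (rule uu)
  have "?Z = insert i0 T" "i0 \<notin> T" using i0 by (auto simp: T_def)
  then have d: "h = d + 1" using h unfolding d_def by simp
  have "S \<union> ?Z = {..<m}" "S \<inter> ?Z = {}" by (auto simp: S_def)
  then have "card S + h = m" using card_Un_disjoint[OF I.fin finZ] h by simp
  \<comment> \<open>The bound \<open>h \<le> k + r + 1\<close> leaves at least \<open>k\<close>
    lines off \<open>v\<close>, so \<open>S\<close> is nonempty.\<close>
  then have M: "I.M + int d = 2 * int k + int r" and S: "S \<noteq> {}"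
    using d assms(1,2,7) unfolding I.M_def by auto
  interpret R: line_resolution "defining_poly m \<alpha>" as bs \<phi> \<psi> by standard (rule exact)
  have "int (k * (k + r)) = I.M * int d + I.\<delta> (I.M - 1)"
  proof (rule second_chern_number[OF _ chern])
    \<comment> \<open>Beyond this bound \<open>n - d\<close> is at least \<open>M - 1\<close>, where
      \<open>\<delta>\<close> is constant.\<close>
    fix n assume n: "n \<ge> \<bar>I.M\<bar> + int d"
    then have nn: "n = int (nat n)" by simp
    have \<delta>: "I.\<delta> (n - int d) = I.\<delta> (I.M - 1)" by (rule I.\<delta>_stable[OF S]) (use n in linarith)
    have "(\<Sum>j<length as. hil (n + as ! j)) = (\<Sum>j<length bs. hil (n + bs ! j)) + (hil (n - I.M) + I.dI (n - int d))"
      using R.hilbert_function[of "nat n"] vdim_log_fields[of n] nn by metis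
    moreover have "int (I.dI (n - int d)) = int (hil (n - int d)) - I.\<delta> (n - int d)" by (simp add: I.\<delta>_def)
    ultimately show "2 * int (\<Sum>j<length as. hil (n + as ! j)) =
      2 * int (\<Sum>j<length bs. hil (n + bs ! j)) + 2 * int (hil (n - I.M)) + 2 * int (hil (n - int d)) - 2 * I.\<delta> (I.M - 1)"
      using \<delta> by simp
  qed
  then have "I.\<delta> (I.M - 1) = int k * int (k + r) - I.M * int d" by simp
  from exists_independent_log_fields[OF S M assms(1) _ _ this] obtain \<theta> \<theta>' where
    "\<theta> \<in> log_fields f (int k)" "\<theta>' \<in> log_fields f (int (k + r))" "det3 \<theta> \<theta>' hvar \<noteq> 0"
    using d assms(6,7) by auto
  from free_if_independent[OF this(1,2) _ this(3)]
  show "free_with_exponents m \<alpha> k (k + r)"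
    unfolding free_with_exponents_def log_tangent_sheaf_def using assms(2) by simp
qed

end
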